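(* Let $Q$ be a valued quiver associated to a symmetrizable generalized Cartan matrix $C=(c_{ij})_{i,j\in\mathbb I}$ and let $\mathbf i=(i_1i_2\cdots i_r)$ be a word made up of elements of $\mathbb I$. Then there exists a $\mathbb Q(v)$-algebra homomorphism $$\varphi_{\mathbf i}:\widetilde{\mathbf U}^\imath\longrightarrow \mathcal T_{\mathbf i}(Q)$$ given on generators, for every $i\in\mathbb I$, by $$B_i\longmapsto \sum_{1\le k\le r:\, i_k=i}(x_k+x_k^{-1}),$$ $$\Bbbk_i\longmapsto -v_i^{-1}(v_i-v_i^{-1})^2\Big(\sum_{1\le k\le r:\, i_k=i}x_k\Big)\Big(\sum_{1\le k\le r:\, i_k=i}x_k^{-1}\Big).$$
   Context: Let $\mathbb I=\{1,\dots,N\}$, let $C=(c_{ij})_{i,j\in\mathbb I}$ be a symmetrizable generalized Cartan matrix with symmetrizer $D=\mathrm{diag}(d_i\mid i\in\mathbb I)$ ($d_i$ positive integers, $DC$ symmetric). Let $v$ be an indeterminate and $v_i=v^{d_i}$. Write $[n]=\frac{v^n-v^{-n}}{v-v^{-1}}$, $[m]^!=\prod_{s=1}^m[s]$, $[0]^!=1$; a subscript $c$ means evaluation at $v=c$. $[a,b]=ab-ba$ for elements of an algebra. **Universal $\imath$quantum group of split type.** The Drinfeld double quantum group $\widetilde{\mathbf U}$ is the $\mathbb Q(v)$-algebra generated by $E_i,F_i,\widetilde K_i,\widetilde K_i'$ ($i\in\mathbb I$) (the elements $\widetilde K_i,\widetilde K'_i$ are not required to be invertible) subject to, for $i,j\in\mathbb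 I$: $[E_i,F_j]=\delta_{ij}\frac{\widetilde K_i-\widetilde K_i'}{v_i-v_i^{-1}}$; $[\widetilde K_i,\widetilde K_j]=[\widetilde K_i,\widetilde K_j']=[\widetilde K_i',\widetilde K_j']=0$; $\widetilde K_iE_j=v_i^{c_{ij}}E_j\widetilde K_i$; $\widetilde K_iF_j=v_i^{-c_{ij}}F_j\widetilde K_i$; $\widetilde K_i'E_j=v_i^{-c_{ij}}E_j\widetilde K_i'$; $\widetilde K_i'F_j=v_i^{c_{ij}}F_j\widetilde K_i'$; and for $i\ne j$ the quantum Serre relations $\sum_{n=0}^{1-c_{ij}}(-1)^nE_i^{(n)}E_jE_i^{(1-c_{ij}-n)}=0$ and $\sum_{n=0}^{1-c_{ij}}(-1)^nF_i^{(n)}F_jF_i^{(1-c_{ij}-n)}=0$, where $E_i^{(n)}=E_i^n/[n]^!_{v_i}$, $F_i^{(n)}=F_i^n/[n]^!_{v_i}$. The universal $\imath$quantum group (of split type) $\widetilde{\mathbf U}^\imath$ is the $\mathbb Q(v)$-subalgebra of $\widetilde{\mathbf U}$ generated by $B_i=F_i+E_i\widetilde K_i'$ and $\Bbbk_i=\widetilde K_i\widetilde K_i'$ for $i\in\mathbb I$. **Valued quiver.** For $i\neq j$ let $d_{i,j}$ be the least common multiple of $d_i,d_j$. The valued graph $\Gamma(C)$ has vertex set $\mathbb I$ and, for $i\ne j$, $n_{ij}=-\frac{d_ic_{ij}}{d_{i,j}}$ parallel edges between $i$ and $j$; vertex $i$ has value $d_i$ and each edge between $i$ and $j$ has value $d_{i,j}$.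 A valued quiver $Q$ associated to $C$ is obtained by choosing an arbitrary orientation of each edge of $\Gamma(C)$ (parallel edges may be oriented in opposite directions). Its Euler form is the bilinear form $\langle-,-\rangle_Q$ on $\mathbb Z\mathbb I=\bigoplus_i\mathbb Ze_i$ with $\langle e_i,e_i\rangle_Q=d_i$ and $\langle e_i,e_j\rangle_Q=-r_{ij}d_{i,j}$ for $i\ne j$, where $r_{ij}$ is the number of arrows from $i$ to $j$ in $Q$. **Quantum torus.** $\mathcal T_{\mathbf i}(Q)$ is the $\mathbb Q(v)$-algebra generated by $x_1^{\pm1},\dots,x_r^{\pm1}$ subject to $x_kx_k^{-1}=x_k^{-1}x_k=1$ and $x_lx_k=v^{\langle e_{i_k},e_{i_l}\rangle_Q-\langle e_{i_l},e_{i_k}\rangle_Q}x_kx_l$ for $1\le k,l\le r$. *)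

theory Defs
  imports
    "HOL-Library.Poly_Mapping"
    "HOL-Computational_Algebra.Polynomial"
    "HOL-Computational_Algebra.Fraction_Field"
    "Graph_Theory.Digraph"
    "HOL-Algebra.QuotRing"
    "HOL-Algebra.Subrings"
    "HOL-Algebra.Module"
begin

section \<open>Algebras given by generators and relations\<close>

text \<open>
  An algebra over a field type is an HOL-Algebra record of type \<open>module\<close>, whose \<open>ring\<close> part
  carries the multiplication. (The locale \<open>algebra\<close> of the library is restricted to
  commutative algebras and hence is not used.) Homomorphisms are unital.
\<close>

definition alg_hom ::
    "('k, 'a, 'm) module_scheme \<Rightarrow> ('k, 'b, 'n) module_scheme \<Rightarrow> ('a \<Rightarrow> 'b) set" where
  "alg_hom A B = {h \<in> ring_hom A B. \<forall>c. \<forall>x \<in> carrier A. h (c \<odot>\<^bsub>A\<^esub> x) = c \<odot>\<^bsub>B\<^esub> h x}"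

definition generated_subalgebra :: "('k, 'a, 'm) module_scheme \<Rightarrow> 'a set \<Rightarrow> 'a set" where
  "generated_subalgebra A S =
     \<Inter>{V. subring V A \<and> (\<forall>c. \<forall>x \<in> V. c \<odot>\<^bsub>A\<^esub> x \<in> V) \<and> S \<subseteq> V}"

text \<open>
  The free monoid, written additively, so that finitely supported functions on it, with the
  convolution product of \<open>Poly_Mapping\<close>, form the free associative unital algebra.
\<close>

datatype 'g word = Word (letters: "'g list")

instantiation word :: (type) monoid_add
begin

definition zero_word :: "'a word" where
  "zero_word = Word []"

definition plus_word :: "'a word \<Rightarrow> 'a word \<Rightarrow> 'a word" where
  "plus_word u w = Word (letters u @ letters w)"

instance
  by standard (simp_all add: zero_word_def plus_word_def)

end

type_synonym ('k, 'g) free_alg = "'g word \<Rightarrow>\<^sub>0 'k"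

definition gen :: "'g \<Rightarrow> ('k::field, 'g) free_alg" where
  "gen g = Poly_Mapping.single (Word [g]) 1"

definition scal :: "'k \<Rightarrow> ('k::field, 'g) free_alg" where
  "scal c = Poly_Mapping.single 0 c"

definition free_algebra :: "'g set \<Rightarrow> ('k::field, ('k, 'g) free_alg) module" where
  "free_algebra X =
     \<lparr>carrier = {p. \<forall>w \<in> Poly_Mapping.keys p. set (letters w) \<subseteq> X},
      mult = (*), one = 1, zero = 0, add = (+), smult = (\<lambda>c p. scal c * p)\<rparr>"

definition alg_quot :: "('k, 'a) module \<Rightarrow> 'a set \<Rightarrow> ('k, 'a set) module" (infixl \<open>AQuot\<close> 65) where
  "A AQuot I = ring.extend (A Quot I)
     \<lparr>smult = (\<lambda>c X. \<Union>x\<in>X. I +>\<^bsub>A\<^esub> (c \<odot>\<^bsub>A\<^esub> x))\<rparr>"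

text \<open>
  \<open>presented_algebra X R\<close> has generating set \<open>X\<close> and relations \<open>p = 0\<close> for \<open>p \<in> R\<close>;
  \<open>genideal\<close> is the two-sided ideal, and it is automatically closed under scalars.
  \<open>pres_class X R p\<close> is the image of \<open>p\<close> in it.
\<close>

definition presented_algebra ::
    "'g set \<Rightarrow> ('k::field, 'g) free_alg set \<Rightarrow> ('k, ('k, 'g) free_alg set) module" where
  "presented_algebra X R = free_algebra X AQuot (Idl\<^bsub>free_algebra X\<^esub> R)"

definition pres_class ::
    "'g set \<Rightarrow> ('k::field, 'g) free_alg set \<Rightarrow> ('k, 'g) free_alg \<Rightarrow> ('k, 'g) free_alg set" where
  "pres_class X R p = (Idl\<^bsub>free_algebra X\<^esub> R) +>\<^bsub>free_algebra X\<^esub> p"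

lemma keys_scal: "Poly_Mapping.keys (scal c) \<subseteq> {0}"
  by (simp add: scal_def)

lemma one_eq_scal: "1 = scal 1"
  by (simp add: scal_def)

lemma free_algebra_mult_closed:
  assumes "p \<in> carrier (free_algebra X)" "q \<in> carrier (free_algebra X)"
  shows "p * q \<in> carrier (free_algebra X)"
  using assms Poly_Mapping.keys_mult[of p q]
  by (fastforce simp: free_algebra_def plus_word_def)

lemma scal_in_free_algebra: "scal c \<in> carrier (free_algebra X)"
  using keys_scal[of c] by (auto simp: free_algebra_def zero_word_def)

lemma gen_in_free_algebra: "g \<in> X \<Longrightarrow> gen g \<in> carrier (free_algebra X)"
  by (auto simp: free_algebra_def gen_def)

lemma free_algebra_add_closed:
  assumes "p \<in> carrier (free_algebra X)" "q \<in> carrier (free_algebra X)"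
  shows "p + q \<in> carrier (free_algebra X)"
  using assms Poly_Mapping.keys_add[of p q] by (fastforce simp: free_algebra_def)

lemma free_algebra_uminus_closed:
  assumes "p \<in> carrier (free_algebra X)"
  shows "- p \<in> carrier (free_algebra X)"
  using assms by (simp add: free_algebra_def)

lemma ring_free_algebra: "ring (free_algebra X :: ('k::field, ('k, 'g) free_alg) module)"
  (is "ring ?A")
proof (rule ringI)
  show "abelian_group ?A"
  proof (rule abelian_groupI)
    fix p assume p: "p \<in> carrier ?A"
    show "\<exists>q \<in> carrier ?A. q \<oplus>\<^bsub>?A\<^esub> p = \<zero>\<^bsub>?A\<^esub>"
      by (rule bexI[OF _ free_algebra_uminus_closed[OF p]]) (simp add: free_algebra_def)
  next
    fix p q assume "p \<in> carrier ?A" "q \<in> carrier ?A"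
    from free_algebra_add_closed[OF this] show "p \<oplus>\<^bsub>?A\<^esub> q \<in> carrier ?A"
      by (simp add: free_algebra_def)
  qed (auto simp: free_algebra_def add_ac)
  show "Group.monoid ?A"
  proof (rule Group.monoidI)
    show "\<one>\<^bsub>?A\<^esub> \<in> carrier ?A"
      using scal_in_free_algebra[of 1 X] by (simp add: free_algebra_def one_eq_scal)
  next
    fix p q assume "p \<in> carrier ?A" "q \<in> carrier ?A"
    from free_algebra_mult_closed[OF this] show "p \<otimes>\<^bsub>?A\<^esub> q \<in> carrier ?A"
      by (simp add: free_algebra_def)
  qed (auto simp: free_algebra_def mult.assoc)
qed (auto simp: free_algebra_def distrib_left distrib_right)

lemma free_algebra_one_closed: "1 \<in> carrier (free_algebra X)"
  using scal_in_free_algebra[of 1 X] by (simp add: one_eq_scal)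

lemma free_algebra_zero_closed: "0 \<in> carrier (free_algebra X)"
  by (simp add: free_algebra_def)

lemma free_algebra_diff_closed:
  assumes "p \<in> carrier (free_algebra X)" "q \<in> carrier (free_algebra X)"
  shows "p - q \<in> carrier (free_algebra X)"
  using free_algebra_add_closed[OF assms(1) free_algebra_uminus_closed[OF assms(2)]] by simp

lemma free_algebra_power_closed:
  assumes "p \<in> carrier (free_algebra X)"
  shows "p ^ n \<in> carrier (free_algebra X)"
  by (induction n) (simp_all add: assms free_algebra_one_closed free_algebra_mult_closed)

lemma free_algebra_sum_closed:
  assumes "\<And>n. n \<in> S \<Longrightarrow> f n \<in> carrier (free_algebra X)"
  shows "sum f S \<in> carrier (free_algebra X)"
  using assms
  by (induction S rule: infinite_finite_induct)
     (simp_all add: free_algebra_zero_closed free_algebra_add_closed)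

lemmas free_algebra_closed =
  free_algebra_add_closed free_algebra_uminus_closed free_algebra_diff_closed
  free_algebra_mult_closed free_algebra_power_closed free_algebra_one_closed
  free_algebra_zero_closed free_algebra_sum_closed scal_in_free_algebra gen_in_free_algebra


section \<open>The ground field \<open>\<rat>(v)\<close> and quantum integers\<close>

type_synonym Qv = "rat poly fract"

definition qv :: Qv where
  "qv = Fract [:0, 1:] 1"

definition qint :: "'k::field \<Rightarrow> nat \<Rightarrow> 'k" where
  "qint c n = (c powi int n - c powi (- int n)) / (c - inverse c)"

definition qfact :: "'k::field \<Rightarrow> nat \<Rightarrow> 'k" where
  "qfact c m = (\<Prod>s = 1..m. qint c s)"

definition divpow :: "'k::field \<Rightarrow> ('k, 'g) free_alg \<Rightarrow> nat \<Rightarrow> ('k, 'g) free_alg" where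
  "divpow c p n = scal (inverse (qfact c n)) * p ^ n"


section \<open>Symmetrizable generalized Cartan matrices\<close>

definition gen_cartan_matrix :: "nat \<Rightarrow> (nat \<Rightarrow> nat \<Rightarrow> int) \<Rightarrow> bool" where
  "gen_cartan_matrix N C \<longleftrightarrow>
     (\<forall>i \<in> {1..N}. C i i = 2) \<and>
     (\<forall>i \<in> {1..N}. \<forall>j \<in> {1..N}. i \<noteq> j \<longrightarrow> C i j \<le> 0) \<and>
     (\<forall>i \<in> {1..N}. \<forall>j \<in> {1..N}. C i j = 0 \<longleftrightarrow> C j i = 0)"

definition symmetrizer :: "nat \<Rightarrow> (nat \<Rightarrow> nat \<Rightarrow> int) \<Rightarrow> (nat \<Rightarrow> nat) \<Rightarrow> bool" where
  "symmetrizer N C d \<longleftrightarrow>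
     (\<forall>i \<in> {1..N}. d i > 0) \<and>
     (\<forall>i \<in> {1..N}. \<forall>j \<in> {1..N}. int (d i) * C i j = int (d j) * C j i)"


section \<open>The Drinfeld double and the universal \<open>\<imath>\<close>quantum group of split type\<close>

datatype dgen = dE nat | dF nat | dK nat | dK' nat

definition vi :: "(nat \<Rightarrow> nat) \<Rightarrow> nat \<Rightarrow> Qv" where
  "vi d i = qv ^ d i"

definition dgens :: "nat \<Rightarrow> dgen set" where
  "dgens N = dE ` {1..N} \<union> dF ` {1..N} \<union> dK ` {1..N} \<union> dK' ` {1..N}"

definition commutator :: "'a::ring \<Rightarrow> 'a \<Rightarrow> 'a" where
  "commutator a b = a * b - b * a"

definition serre ::
    "(nat \<Rightarrow> nat \<Rightarrow> int) \<Rightarrow> (nat \<Rightarrow> nat) \<Rightarrow> (nat \<Rightarrow> dgen) \<Rightarrow> nat \<Rightarrow> nat \<Rightarrow> (Qv, dgen) free_alg" where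
  "serre C d X i j =
     (let m = nat (1 - C i j) in
      \<Sum>n = 0..m. (-1) ^ n * divpow (vi d i) (gen (X i)) n * gen (X j)
                   * divpow (vi d i) (gen (X i)) (m - n))"

definition drels :: "nat \<Rightarrow> (nat \<Rightarrow> nat \<Rightarrow> int) \<Rightarrow> (nat \<Rightarrow> nat) \<Rightarrow> (Qv, dgen) free_alg set" where
  "drels N C d =
     (\<Union>i \<in> {1..N}. \<Union>j \<in> {1..N}.
       {commutator (gen (dE i)) (gen (dF j)) -
          (if i = j then scal (inverse (vi d i - inverse (vi d i))) * (gen (dK i) - gen (dK' i)) else 0),
        commutator (gen (dK i)) (gen (dK j)),
        commutator (gen (dK i)) (gen (dK' j)),
        commutator (gen (dK' i)) (gen (dK' j)),
        gen (dK i) * gen (dE j) - scal (vi d i powi C i j) * gen (dE j) * gen (dK i),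
        gen (dK i) * gen (dF j) - scal (vi d i powi (- C i j)) * gen (dF j) * gen (dK i),
        gen (dK' i) * gen (dE j) - scal (vi d i powi (- C i j)) * gen (dE j) * gen (dK' i),
        gen (dK' i) * gen (dF j) - scal (vi d i powi C i j) * gen (dF j) * gen (dK' i)} \<union>
       (if i \<noteq> j then {serre C d dE i j, serre C d dF i j} else {}))"

lemma drels_subset: "drels N C d \<subseteq> carrier (free_algebra (dgens N))"
  unfolding drels_def serre_def divpow_def commutator_def Let_def
  by (intro UN_least Un_least)
     (auto intro!: free_algebra_closed simp: dgens_def)

definition Utilde ::
    "nat \<Rightarrow> (nat \<Rightarrow> nat \<Rightarrow> int) \<Rightarrow> (nat \<Rightarrow> nat) \<Rightarrow> (Qv, (Qv, dgen) free_alg set) module" where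
  "Utilde N C d = presented_algebra (dgens N) (drels N C d)"

definition ugen ::
    "nat \<Rightarrow> (nat \<Rightarrow> nat \<Rightarrow> int) \<Rightarrow> (nat \<Rightarrow> nat) \<Rightarrow> dgen \<Rightarrow> (Qv, dgen) free_alg set" where
  "ugen N C d g = pres_class (dgens N) (drels N C d) (gen g)"

definition iB ::
    "nat \<Rightarrow> (nat \<Rightarrow> nat \<Rightarrow> int) \<Rightarrow> (nat \<Rightarrow> nat) \<Rightarrow> nat \<Rightarrow> (Qv, dgen) free_alg set" where
  "iB N C d i = ugen N C d (dF i) \<oplus>\<^bsub>Utilde N C d\<^esub>
     (ugen N C d (dE i) \<otimes>\<^bsub>Utilde N C d\<^esub> ugen N C d (dK' i))"

definition ik ::
    "nat \<Rightarrow> (nat \<Rightarrow> nat \<Rightarrow> int) \<Rightarrow> (nat \<Rightarrow> nat) \<Rightarrow> nat \<Rightarrow> (Qv, dgen) free_alg set" where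
  "ik N C d i = ugen N C d (dK i) \<otimes>\<^bsub>Utilde N C d\<^esub> ugen N C d (dK' i)"

definition iUtilde ::
    "nat \<Rightarrow> (nat \<Rightarrow> nat \<Rightarrow> int) \<Rightarrow> (nat \<Rightarrow> nat) \<Rightarrow> (Qv, (Qv, dgen) free_alg set) module" where
  "iUtilde N C d = (Utilde N C d)
     \<lparr>carrier := generated_subalgebra (Utilde N C d) (iB N C d ` {1..N} \<union> ik N C d ` {1..N})\<rparr>"


section \<open>Valued quivers\<close>

record 'e valued_quiver =
  quiv :: "(nat, 'e) pre_digraph"
  vval :: "nat \<Rightarrow> nat"
  aval :: "'e \<Rightarrow> nat"

text \<open>
  \<open>Q\<close> is an orientation of the valued graph of \<open>(C, d)\<close>: for distinct \<open>i\<close>, \<open>j\<close> there are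
  \<open>n\<^sub>i\<^sub>j = - d\<^sub>i c\<^sub>i\<^sub>j / lcm d\<^sub>i d\<^sub>j\<close> arrows joining \<open>i\<close> and \<open>j\<close>, in either direction. For a symmetrizer
  \<open>d\<close> the division is exact.
\<close>

definition associated_valued_quiver ::
    "nat \<Rightarrow> (nat \<Rightarrow> nat \<Rightarrow> int) \<Rightarrow> (nat \<Rightarrow> nat) \<Rightarrow> 'e valued_quiver \<Rightarrow> bool" where
  "associated_valued_quiver N C d Q \<longleftrightarrow>
     fin_digraph (quiv Q) \<and> loopfree_digraph (quiv Q) \<and> verts (quiv Q) = {1..N} \<and>
     (\<forall>i \<in> {1..N}. \<forall>j \<in> {1..N}. i \<noteq> j \<longrightarrow>
        int (card {a \<in> arcs (quiv Q). {tail (quiv Q) a, head (quiv Q) a} = {i, j}}) =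
          (- (int (d i) * C i j)) div int (lcm (d i) (d j))) \<and>
     (\<forall>i \<in> {1..N}. vval Q i = d i) \<and>
     (\<forall>a \<in> arcs (quiv Q). aval Q a = lcm (d (tail (quiv Q) a)) (d (head (quiv Q) a)))"

definition num_arrows :: "'e valued_quiver \<Rightarrow> nat \<Rightarrow> nat \<Rightarrow> nat" where
  "num_arrows Q i j = card {a \<in> arcs (quiv Q). tail (quiv Q) a = i \<and> head (quiv Q) a = j}"

definition unit_vec :: "nat \<Rightarrow> nat \<Rightarrow> int" where
  "unit_vec i = (\<lambda>j. if j = i then 1 else 0)"

definition euler_form :: "'e valued_quiver \<Rightarrow> (nat \<Rightarrow> int) \<Rightarrow> (nat \<Rightarrow> int) \<Rightarrow> int" where
  "euler_form Q x y =
     (\<Sum>i \<in> verts (quiv Q). \<Sum>j \<in> verts (quiv Q). x i * y j *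
        (if i = j then int (vval Q i)
         else - int (num_arrows Q i j) * int (lcm (vval Q i) (vval Q j))))"


section \<open>The quantum torus of a word\<close>

text \<open>
  The letters of the word \<open>w = i\<^sub>1 \<dots> i\<^sub>r\<close> are numbered from 1; \<open>tX k\<close> and \<open>tX' k\<close> stand for
  \<open>x\<^sub>k\<close> and its inverse.
\<close>

datatype tgen = tX nat | tX' nat

definition letter :: "nat list \<Rightarrow> nat \<Rightarrow> nat" where
  "letter w k = w ! (k - 1)"

definition tgens :: "nat list \<Rightarrow> tgen set" where
  "tgens w = tX ` {1..length w} \<union> tX' ` {1..length w}"

definition trels :: "'e valued_quiver \<Rightarrow> nat list \<Rightarrow> (Qv, tgen) free_alg set" where
  "trels Q w =
     (\<Union>k \<in> {1..length w}.
        {gen (tX k) * gen (tX' k) - 1, gen (tX' k) * gen (tX k) - 1}) \<union>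
     (\<Union>k \<in> {1..length w}. \<Union>l \<in> {1..length w}.
        {gen (tX l) * gen (tX k) -
           scal (qv powi (euler_form Q (unit_vec (letter w k)) (unit_vec (letter w l)) -
                         euler_form Q (unit_vec (letter w l)) (unit_vec (letter w k)))) *
             gen (tX k) * gen (tX l)})"

lemma trels_subset: "trels Q w \<subseteq> carrier (free_algebra (tgens w))"
  unfolding trels_def by (auto intro!: free_algebra_closed simp: tgens_def)

definition qtorus :: "'e valued_quiver \<Rightarrow> nat list \<Rightarrow> (Qv, (Qv, tgen) free_alg set) module" where
  "qtorus Q w = presented_algebra (tgens w) (trels Q w)"

definition tx :: "'e valued_quiver \<Rightarrow> nat list \<Rightarrow> nat \<Rightarrow> (Qv, tgen) free_alg set" where
  "tx Q w k = pres_class (tgens w) (trels Q w) (gen (tX k))"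

definition tx' :: "'e valued_quiver \<Rightarrow> nat list \<Rightarrow> nat \<Rightarrow> (Qv, tgen) free_alg set" where
  "tx' Q w k = pres_class (tgens w) (trels Q w) (gen (tX' k))"

definition occ :: "nat list \<Rightarrow> nat \<Rightarrow> nat set" where
  "occ w i = {k \<in> {1..length w}. letter w k = i}"

end

theory Submission
  imports Defs "HOL-Library.Function_Algebras"
begin

text \<open>
  The subalgebra generated by the \<open>B\<^sub>i\<close> and \<open>k\<^sub>i\<close> is not given by relations, so that \<open>\<phi>\<close> is well
  defined is shown by letting the double act, from the right, on functions on words with values in
  Laurent series in \<open>t\<close> over the quantum torus: the dual of a Verma module. Here \<open>F\<^sub>i\<close> is a
  translation, \<open>K\<^sub>i\<close> and \<open>K\<^sub>i'\<close> are multiples of \<open>t\<^sup>-\<^sup>1 k\<^sub>i\<close> and \<open>t\<close>, and \<open>E\<^sub>i\<close> is a skew derivation. At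
  \<open>t = 0\<close> the operator \<open>E\<^sub>i K\<^sub>i'\<close> becomes the derivation \<open>\<theta>\<^sub>i\<close> of Kashiwara's \<open>q\<close>-boson algebra, and there
  is a unique functional \<open>\<Psi>\<close> with \<open>\<Psi>(1) = 1\<close> on which \<open>F\<^sub>i + \<theta>\<^sub>i\<close> acts as left multiplication by the
  prescribed image of \<open>B\<^sub>i\<close>. Hence an element of the \<open>\<imath>\<close>quantum group that vanishes in the double has
  image zero.

  The action satisfies the Serre relations of the \<open>F\<^sub>i\<close> only on functionals vanishing on the Serre
  ideal. That \<open>\<Psi>\<close> is one of them is reduced, by means of a second family of operators commuting
  with the \<open>F\<^sub>i + \<theta>\<^sub>i\<close>, to the vanishing of \<open>\<Psi>\<close> on the Serre elements. These values satisfy a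
  three-term recursion with an explicit solution in \<open>\<Sum>x\<^sub>k\<close> and \<open>\<Sum>x\<^sub>k\<^sup>-\<^sup>1\<close>, which terminates because
  \<open>\<langle>e\<^sub>i,e\<^sub>j\<rangle> - \<langle>e\<^sub>j,e\<^sub>i\<rangle> = d\<^sub>i (c\<^sub>i\<^sub>j + 2 s)\<close> with \<open>0 \<le> s \<le> - c\<^sub>i\<^sub>j\<close>.
\<close>

section \<open>Algebras over the ground field\<close>

class qv_space = ab_group_add +
  fixes qs :: "Qv \<Rightarrow> 'a \<Rightarrow> 'a" (infixr \<open>*\<^sub>q\<close> 75)
  assumes qs_add_right: "c *\<^sub>q (x + y) = c *\<^sub>q x + c *\<^sub>q y"
    and qs_add_left: "(c + e) *\<^sub>q x = c *\<^sub>q x + e *\<^sub>q x"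
    and qs_qs [simp]: "c *\<^sub>q e *\<^sub>q x = (c * e) *\<^sub>q x"
    and qs_one [simp]: "1 *\<^sub>q x = x"
begin

lemma qs_zero_right [simp]: "c *\<^sub>q 0 = 0"
  using qs_add_right[of c 0 0] by simp

lemma qs_zero_left [simp]: "0 *\<^sub>q x = 0"
  using qs_add_left[of 0 0 x] by simp

lemma qs_minus_right [simp]: "c *\<^sub>q (- x) = - (c *\<^sub>q x)"
  using qs_add_right[of c x "- x"] by (simp add: eq_neg_iff_add_eq_0 add.commute)

lemma qs_minus_left [simp]: "(- c) *\<^sub>q x = - (c *\<^sub>q x)"
  using qs_add_left[of c "- c" x] by (simp add: eq_neg_iff_add_eq_0 add.commute)

lemma qs_diff_right: "c *\<^sub>q (x - y) = c *\<^sub>q x - c *\<^sub>q y"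
  using qs_add_right[of c x "- y"] by simp

lemma qs_diff_left: "(c - e) *\<^sub>q x = c *\<^sub>q x - e *\<^sub>q x"
  using qs_add_left[of c "- e" x] by simp

lemma qs_sum_right: "c *\<^sub>q sum f A = (\<Sum>a\<in>A. c *\<^sub>q f a)"
  by (induction A rule: infinite_finite_induct) (simp_all add: qs_add_right)

lemma qs_cancel: "c \<noteq> 0 \<Longrightarrow> c *\<^sub>q x = c *\<^sub>q y \<longleftrightarrow> x = y"
proof
  assume "c \<noteq> 0" "c *\<^sub>q x = c *\<^sub>q y"
  then have "inverse c *\<^sub>q c *\<^sub>q x = inverse c *\<^sub>q c *\<^sub>q y"
    by (simp only:)
  then show "x = y"
    using \<open>c \<noteq> 0\<close> by simp
qed simp

lemmas qs_distribs = qs_add_right qs_add_left qs_diff_right qs_diff_left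

end

text \<open>Unital, but without 0 \<noteq> 1: the endomorphism algebra of a zero space has to be an
  instance.\<close>

class qv_algebra = qv_space + ring + monoid_mult +
  assumes qs_mult_left [simp]: "c *\<^sub>q x * y = c *\<^sub>q (x * y)"
    and qs_mult_right [simp]: "x * c *\<^sub>q y = c *\<^sub>q (x * y)"
begin

end

instantiation "fun" :: (type, qv_space) qv_space
begin

definition qs_fun_def: "c *\<^sub>q f = (\<lambda>x. c *\<^sub>q f x)"

instance
  by standard (simp_all add: qs_fun_def fun_eq_iff qs_distribs)

end

lemma qs_fun_apply [simp]: "(c *\<^sub>q f) x = c *\<^sub>q f x"
  by (simp add: qs_fun_def)


subsection \<open>Evaluation of noncommutative polynomials\<close>

definition lift :: "('g \<Rightarrow> 'r::qv_algebra) \<Rightarrow> (Qv, 'g) free_alg \<Rightarrow> 'r" where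
  "lift h p = (\<Sum>u\<in>Poly_Mapping.keys p. Poly_Mapping.lookup p u *\<^sub>q prod_list (map h (letters u)))"

lemma lift_superset:
  assumes "finite A" "Poly_Mapping.keys p \<subseteq> A"
  shows "lift h p = (\<Sum>u\<in>A. Poly_Mapping.lookup p u *\<^sub>q prod_list (map h (letters u)))"
  unfolding lift_def
  by (rule sum.mono_neutral_left) (use assms in \<open>auto simp: in_keys_iff\<close>)

lemma lift_add: "lift h (p + q) = lift h p + lift h q"
proof -
  let ?A = "Poly_Mapping.keys p \<union> Poly_Mapping.keys q"
  have "lift h (p + q) = (\<Sum>u\<in>?A. Poly_Mapping.lookup (p + q) u *\<^sub>q prod_list (map h (letters u)))"
    by (rule lift_superset) (use Poly_Mapping.keys_add[of p q] in auto)
  also have "\<dots> = lift h p + lift h q"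
    by (simp add: lift_superset[of ?A] lookup_add qs_add_left sum.distrib)
  finally show ?thesis .
qed

lemma lift_single: "lift h (Poly_Mapping.single u c) = c *\<^sub>q prod_list (map h (letters u))"
  by (simp add: lift_def)

lemma lift_zero [simp]: "lift h 0 = 0"
  by (simp add: lift_def)

lemma lift_uminus: "lift h (- p) = - lift h p"
  using lift_add[of h p "- p"] by (simp add: eq_neg_iff_add_eq_0 add.commute)

lemma lift_diff: "lift h (p - q) = lift h p - lift h q"
  using lift_add[of h p "- q"] by (simp add: lift_uminus)

lemma lift_sum: "lift h (sum f A) = (\<Sum>a\<in>A. lift h (f a))"
  by (induction A rule: infinite_finite_induct) (simp_all add: lift_add)

lemma poly_mapping_single_induct [case_names single add]:
  assumes "\<And>u c. P (Poly_Mapping.single u c)"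
    and "\<And>p q. P p \<Longrightarrow> P q \<Longrightarrow> P (p + q)"
  shows "P (p :: 'a \<Rightarrow>\<^sub>0 'b::comm_monoid_add)"
proof -
  have "P (\<Sum>u\<in>A. Poly_Mapping.single u (Poly_Mapping.lookup p u))" for A
  proof (induction A rule: infinite_finite_induct)
    case (infinite A)
    then show ?case using assms(1)[of _ 0] by simp
  next
    case empty
    then show ?case using assms(1)[of _ 0] by simp
  qed (use assms in simp)
  moreover have "(\<Sum>u\<in>Poly_Mapping.keys p. Poly_Mapping.single u (Poly_Mapping.lookup p u)) = p"
  proof (rule poly_mapping_eqI)
    fix k
    have "(\<Sum>u\<in>Poly_Mapping.keys p. Poly_Mapping.lookup (Poly_Mapping.single u (Poly_Mapping.lookup p u)) k)
        = (\<Sum>u\<in>Poly_Mapping.keys p. if u = k then Poly_Mapping.lookup p k else 0)"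
      by (rule sum.cong) (auto simp: lookup_single when_def)
    also have "\<dots> = Poly_Mapping.lookup p k"
      by (simp add: in_keys_iff)
    finally show "Poly_Mapping.lookup (\<Sum>u\<in>Poly_Mapping.keys p. Poly_Mapping.single u (Poly_Mapping.lookup p u)) k = Poly_Mapping.lookup p k"
      by (simp add: lookup_sum)
  qed
  ultimately show ?thesis by metis
qed

lemma lift_mult: "lift h (p * q) = lift h p * lift h q"
proof (induction p rule: poly_mapping_single_induct)
  case (single u c)
  show ?case
  proof (induction q rule: poly_mapping_single_induct)
    case (single v e)
    show ?case by (simp add: mult_single lift_single plus_word_def mult.commute)
  qed (simp_all add: distrib_left lift_add)
qed (simp_all add: distrib_right lift_add)

lemma lift_scal: "lift h (scal c) = c *\<^sub>q 1"
  by (simp add: scal_def lift_single zero_word_def)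

lemma lift_one [simp]: "lift h 1 = 1"
  by (simp add: one_eq_scal lift_scal)

lemma lift_gen [simp]: "lift h (gen g) = h g"
  by (simp add: gen_def lift_single)

lemma lift_power: "lift h (p ^ n) = lift h p ^ n"
  by (induction n) (simp_all add: lift_mult)

lemma lift_scal_mult [simp]: "lift h (scal c * p) = c *\<^sub>q lift h p"
  by (simp add: lift_mult lift_scal)

lemmas lift_simps = lift_add lift_diff lift_uminus lift_mult lift_sum lift_power lift_scal


subsection \<open>Linear endomorphisms, acting from the right\<close>

text \<open>As a type of their own the endomorphisms become an instance of
  \<open>qv_algebra\<close>, so that the q-commutator formulas apply to them. The product
  \<open>a * b\<close> applies \<open>a\<close> first; with this order a right module gives a
  homomorphism and not an antihomomorphism.\<close>

typedef (overloaded) 'a rendo =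
  "{f :: 'a::qv_space \<Rightarrow> 'a. (\<forall>x y. f (x + y) = f x + f y) \<and> (\<forall>c x. f (c *\<^sub>q x) = c *\<^sub>q f x)}"
  by (rule exI[of _ "\<lambda>x. x"]) simp

setup_lifting type_definition_rendo

lift_definition app :: "'a::qv_space \<Rightarrow> 'a rendo \<Rightarrow> 'a" (infixl \<open>\<bullet>\<close> 72) is "\<lambda>x f. f x" .

lemma app_add_left: "(x + y) \<bullet> a = x \<bullet> a + y \<bullet> a"
  by transfer simp

lemma app_qs_left [simp]: "(c *\<^sub>q x) \<bullet> a = c *\<^sub>q (x \<bullet> a)"
  by transfer simp

lemma app_zero_left [simp]: "0 \<bullet> a = 0"
  using app_qs_left[of 0 0 a] by simp

lemma app_uminus_left [simp]: "(- x) \<bullet> a = - (x \<bullet> a)"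
  using app_qs_left[of "-1" x a] by simp

lemma app_diff_left: "(x - y) \<bullet> a = x \<bullet> a - y \<bullet> a"
  using app_add_left[of x "- y" a] by simp

lemma rendo_eqI: "(\<And>x. x \<bullet> a = x \<bullet> b) \<Longrightarrow> a = b"
  by transfer auto

instantiation rendo :: (qv_space) qv_algebra
begin

lift_definition zero_rendo :: "'a rendo" is "\<lambda>x. 0" by simp
lift_definition one_rendo :: "'a rendo" is "\<lambda>x. x" by simp
lift_definition plus_rendo :: "'a rendo \<Rightarrow> 'a rendo \<Rightarrow> 'a rendo" is "\<lambda>f g x. f x + g x"
  by (simp add: qs_distribs)
lift_definition minus_rendo :: "'a rendo \<Rightarrow> 'a rendo \<Rightarrow> 'a rendo" is "\<lambda>f g x. f x - g x"
  by (simp add: qs_distribs)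
lift_definition uminus_rendo :: "'a rendo \<Rightarrow> 'a rendo" is "\<lambda>f x. - f x"
  by simp
lift_definition times_rendo :: "'a rendo \<Rightarrow> 'a rendo \<Rightarrow> 'a rendo" is "\<lambda>f g x. g (f x)"
  by simp
lift_definition qs_rendo :: "Qv \<Rightarrow> 'a rendo \<Rightarrow> 'a rendo" is "\<lambda>c f x. c *\<^sub>q f x"
  by (simp add: qs_distribs mult.commute)

instance
  by standard (transfer; force simp: qs_distribs)+

end

lemma app_add [simp]: "x \<bullet> (a + b) = x \<bullet> a + x \<bullet> b"
  and app_diff [simp]: "x \<bullet> (a - b) = x \<bullet> a - x \<bullet> b"
  and app_uminus [simp]: "x \<bullet> (- a) = - (x \<bullet> a)"
  and app_mult [simp]: "x \<bullet> (a * b) = x \<bullet> a \<bullet> b"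
  and app_qs [simp]: "x \<bullet> (c *\<^sub>q a) = c *\<^sub>q (x \<bullet> a)"
  and app_zero [simp]: "x \<bullet> 0 = 0"
  and app_one [simp]: "x \<bullet> 1 = x"
  by (transfer; simp)+

section \<open>Iterated q-commutators\<close>

text \<open>For q = v_i, c = c_ij and n = 1 - c_ij this is, up to a scalar, the quantum Serre
  element in a and b, see \<open>lift_serre\<close>. The shorter brackets make commutators with it
  computable by induction.\<close>

primrec qad :: "Qv \<Rightarrow> int \<Rightarrow> 'r::qv_algebra \<Rightarrow> 'r \<Rightarrow> nat \<Rightarrow> 'r" where
  "qad q c a b 0 = b"
| "qad q c a b (Suc n) = a * qad q c a b n - q powi (c + 2 * int n) *\<^sub>q (qad q c a b n * a)"

lemma qad_twist:
  assumes "A * a = s *\<^sub>q (a * A)" "A * b = r *\<^sub>q (b * A)"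
  shows "A * qad q c a b n = (r * s ^ n) *\<^sub>q (qad q c a b n * A)"
proof (induction n)
  case (Suc n)
  let ?Y = "qad q c a b n" and ?e = "q powi (c + 2 * int n)"
  have "A * qad q c a b (Suc n) = (A * a) * ?Y - ?e *\<^sub>q ((A * ?Y) * a)"
    by (simp add: right_diff_distrib mult.assoc)
  also have "\<dots> = s *\<^sub>q (a * (A * ?Y)) - (?e * (r * s ^ n)) *\<^sub>q (?Y * (A * a))"
    by (simp add: assms(1) Suc.IH mult.assoc)
  also have "\<dots> = (r * s ^ Suc n) *\<^sub>q (qad q c a b (Suc n) * A)"
    by (simp add: assms(1) Suc.IH mult.assoc left_diff_distrib qs_diff_right mult_ac)
  finally show ?case .
qed (simp add: assms)

text \<open>The scalar picked up when E is moved past \<open>qad\<close>: the sum of q^{-(c+2k)} -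
  q^{c+2k} over k < n. Its zero at n = 1 - c becomes visible in the product formula
  \<open>gq_closed\<close>.\<close>

primrec gq :: "Qv \<Rightarrow> int \<Rightarrow> nat \<Rightarrow> Qv" where
  "gq q c 0 = 0"
| "gq q c (Suc n) = gq q c n + q powi (- (c + 2 * int n)) - q powi (c + 2 * int n)"

lemma gq_closed:
  assumes "q \<noteq> 0"
  shows "(q - inverse q) * q powi (c + 2 * int n - 1) * gq q c n
    = - ((1 - q ^ (2 * n)) * (1 - q powi (2 * c + 2 * int n - 2)))"
proof (induction n)
  case (Suc n)
  \<comment> \<open>In x = q^c and y = q^n the induction step is an identity of rational
    functions.\<close>
  define x where "x = q powi c"
  define y where "y = q ^ n"
  have nz: "x \<noteq> 0" "y \<noteq> 0"
    using assms by (simp_all add: x_def y_def)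
  have y: "q powi int n = y" by (simp add: y_def)
  have e: "q powi (c + 2 * int n) = x * y\<^sup>2" "q powi (- (c + 2 * int n)) = inverse (x * y\<^sup>2)"
    "q powi (c + 2 * int (Suc n) - 1) = x * y\<^sup>2 * q" "q powi (c + 2 * int n - 1) = x * y\<^sup>2 / q"
    "q powi (2 * c + 2 * int n - 2) = x\<^sup>2 * y\<^sup>2 / q\<^sup>2"
    "q powi (2 * c + 2 * int (Suc n) - 2) = x\<^sup>2 * y\<^sup>2"
    "q ^ (2 * n) = y\<^sup>2" "q ^ (2 * Suc n) = y\<^sup>2 * q\<^sup>2"
    using assms
    by (simp_all add: power_int_add power_int_diff power_int_mult power_mult x_def y_def
        power2_eq_square power_int_minus power_mult_distrib field_simps)
  have IH: "(q - inverse q) * (x * y\<^sup>2 / q) * gq q c n = - ((1 - y\<^sup>2) * (1 - x\<^sup>2 * y\<^sup>2 / q\<^sup>2))"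
    using Suc.IH unfolding e .
  have "(q - inverse q) * (x * y\<^sup>2 * q) * (gq q c n + inverse (x * y\<^sup>2) - x * y\<^sup>2)
      = q\<^sup>2 * ((q - inverse q) * (x * y\<^sup>2 / q) * gq q c n)
        + (q - inverse q) * q * (1 - x\<^sup>2 * y ^ 4)"
    using assms nz by (simp add: field_simps power2_eq_square eval_nat_numeral)
  also have "\<dots> = - ((1 - y\<^sup>2 * q\<^sup>2) * (1 - x\<^sup>2 * y\<^sup>2))"
    unfolding IH using assms nz by (simp add: field_simps power2_eq_square eval_nat_numeral)
  finally show ?case
    unfolding gq.simps e .
qed simp

lemma gq_zero:
  assumes "q \<noteq> 0" "q\<^sup>2 \<noteq> 1" "c \<le> 0"
  shows "gq q c (nat (1 - c)) = 0"
proof -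
  have "q - inverse q \<noteq> 0"
    using assms by (simp add: field_simps power2_eq_square)
  moreover have "2 * c + 2 * int (nat (1 - c)) - 2 = 0"
    using assms by simp
  ultimately show ?thesis
    using gq_closed[OF assms(1), of c "nat (1 - c)"] assms by simp
qed

text \<open>
  In the applications \<open>b\<close> is a generator \<open>F\<^sub>j\<close>, \<open>a\<close> is \<open>F\<^sub>i\<close>, and \<open>A\<close>, \<open>A'\<close> are multiples of
  \<open>K\<^sub>i\<close>, \<open>K\<^sub>i'\<close>: the part \<open>A'\<close> of the commutator drops out.
\<close>

lemma qad_commutator_base:
  assumes q: "q \<noteq> 0"
    and E: "E * a = a * E + A + A'" "E * b = b * E"
    and A: "A * a = inverse (q\<^sup>2) *\<^sub>q (a * A)" "A * b = q powi (- c) *\<^sub>q (b * A)"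
    and A': "A' * a = q\<^sup>2 *\<^sub>q (a * A')" "A' * b = q powi c *\<^sub>q (b * A')"
  shows "E * qad q c a b n = qad q c a b n * E + gq q c n *\<^sub>q (qad q c a b (n - 1) * A)"
proof (induction n)
  case (Suc n)
  let ?Y = "qad q c a b n" and ?e = "q powi (c + 2 * int n)" and ?Z = "qad q c a b (n - 1)"
  let ?g = "gq q c n" and ?e' = "q powi (- (c + 2 * int n))"
  have AY: "A * ?Y = ?e' *\<^sub>q (?Y * A)" 
  proof -
    have "q powi (- c) * inverse (q\<^sup>2) ^ n = ?e'"
      by (subst power_int_minus, subst power_int_add)
        (use q in \<open>simp_all add: power_int_minus power_int_mult power_inverse\<close>)
    then show ?thesis
      using qad_twist[OF A, of q c n] by simp
  qed
  \<comment> \<open>The factor is exactly the one in the next bracket, so the two contributions of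
    A' cancel.\<close>
  have A'Y: "A' * ?Y = ?e *\<^sub>q (?Y * A')"
  proof -
    have "q powi c * (q\<^sup>2) ^ n = ?e"
      using q by (simp add: power_int_add power_int_mult)
    then show ?thesis
      using qad_twist[OF A', of q c n] by simp
  qed
  \<comment> \<open>The correction terms of the induction hypothesis recombine to the bracket
    \<open>?Y\<close>. For n = 0 the truncated n - 1 is harmless because \<open>gq\<close> is 0
    there.\<close>
  have g: "?g *\<^sub>q (a * ?Z) - (?e * ?g * inverse (q\<^sup>2)) *\<^sub>q (?Z * a) = ?g *\<^sub>q ?Y"
  proof (cases n)
    case (Suc k)
    have "?e * inverse (q\<^sup>2) = q powi (c + 2 * int k)"
      using q Suc by (simp add: power_int_add field_simps power2_eq_square)
    then have "?e * ?g * inverse (q\<^sup>2) = ?g * q powi (c + 2 * int k)"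
      by (metis mult.assoc mult.commute)
    then show ?thesis
      using Suc by (simp only: qad.simps qs_diff_right qs_qs diff_Suc_1)
  qed simp
  have "E * qad q c a b (Suc n) = (E * a) * ?Y - ?e *\<^sub>q ((E * ?Y) * a)"
    by (simp add: right_diff_distrib mult.assoc)
  also have "\<dots> = a * (E * ?Y) + A * ?Y + A' * ?Y - ?e *\<^sub>q (?Y * (E * a)) - (?e * ?g) *\<^sub>q (?Z * (A * a))"
    by (simp add: E(1) Suc.IH distrib_right qs_add_right mult.assoc)
  also have "\<dots> = qad q c a b (Suc n) * E
      + (?g *\<^sub>q (a * ?Z) - (?e * ?g * inverse (q\<^sup>2)) *\<^sub>q (?Z * a)) * A
      + (?e' - ?e) *\<^sub>q (?Y * A)"
    unfolding Suc.IH AY A'Y E(1) A(1)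
    by (simp add: distrib_left qs_distribs left_diff_distrib mult.assoc)
  also have "\<dots> = qad q c a b (Suc n) * E + gq q c (Suc n) *\<^sub>q (?Y * A)"
    unfolding g by (simp add: qs_distribs)
  finally show ?case by simp
qed (simp add: E)

text \<open>The product of 1 - q^{2c+2k} over k < n; the factor k = -c makes it vanish at n = 1 -
  c.\<close>

primrec muq :: "Qv \<Rightarrow> int \<Rightarrow> nat \<Rightarrow> Qv" where
  "muq q c 0 = 1"
| "muq q c (Suc n) = (1 - q powi (2 * c + 2 * int n)) * muq q c n"

lemma muq_zero:
  assumes "c \<le> 0"
  shows "muq q c (nat (1 - c)) = 0"
proof -
  have "nat (1 - c) = Suc (nat (- c))" "2 * c + 2 * int (nat (- c)) = 0"
    using assms by linarith+
  then show ?thesis by simp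
qed

text \<open>Now E hits the inner argument b. The term A survives only in degree 0, since A a =
  q^{-c} a A makes its first bracket with a vanish; each bracket multiplies the A' term by one more
  factor of \<open>muq\<close>.\<close>

lemma qad_commutator_argument:
  assumes q: "q \<noteq> 0"
    and E: "E * a = a * E" "E * b = b * E + A + A'"
    and A: "A * a = q powi (- c) *\<^sub>q (a * A)" and A': "A' * a = q powi c *\<^sub>q (a * A')"
  shows "E * qad q c a b n = qad q c a b n * E + (if n = 0 then A else 0) + muq q c n *\<^sub>q (a ^ n * A')"
proof (induction n)
  case (Suc n)
  let ?Y = "qad q c a b n" and ?e = "q powi (c + 2 * int n)" and ?m = "muq q c n"
  have "?e * q powi c = q powi (2 * c + 2 * int n)"
    by (subst power_int_add[symmetric]) (use q in simp_all)
  then have "?e * q powi c * ?m = q powi (2 * c + 2 * int n) * ?m"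
    by (rule arg_cong)
  then have eq: "?e * ?m * q powi c = q powi (2 * c + 2 * int n) * ?m"
    by (simp only: mult.assoc mult.commute[of ?m])
  have an: "a ^ n * a = a * a ^ n" by (simp add: power_commutes)
  have "E * qad q c a b (Suc n) = (E * a) * ?Y - ?e *\<^sub>q ((E * ?Y) * a)"
    by (simp add: right_diff_distrib mult.assoc)
  also have "\<dots> = a * (?Y * E + (if n = 0 then A else 0) + ?m *\<^sub>q (a ^ n * A'))
      - ?e *\<^sub>q ((?Y * E + (if n = 0 then A else 0) + ?m *\<^sub>q (a ^ n * A')) * a)"
    unfolding E(1) by (simp only: Suc.IH mult.assoc)
  also have "\<dots> = a * (?Y * E) + a * (if n = 0 then A else 0) + ?m *\<^sub>q (a * (a ^ n * A'))
      - (?e *\<^sub>q (?Y * (E * a)) + ?e *\<^sub>q ((if n = 0 then A else 0) * a) + (?e * ?m) *\<^sub>q (a ^ n * (A' * a)))"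
    by (simp add: distrib_left distrib_right qs_add_right mult.assoc del: if_split)
  also have "\<dots> = a * (?Y * E) + ?m *\<^sub>q (a ^ Suc n * A')
      - (?e *\<^sub>q (?Y * (a * E)) + (?e * ?m * q powi c) *\<^sub>q (a ^ Suc n * A'))"
    using q by (cases "n = 0") (simp_all add: A A' E an power_int_minus flip: mult.assoc)
  also have "\<dots> = qad q c a b (Suc n) * E + muq q c (Suc n) *\<^sub>q (a ^ Suc n * A')"
    unfolding eq by (simp add: qs_distribs left_diff_distrib mult.assoc)
  finally show ?case by simp
qed (simp add: E)

section \<open>Expansion of iterated q-commutators in divided powers\<close>

lemma sum_antidiagonal_shift:
  fixes G H :: "nat \<Rightarrow> nat \<Rightarrow> 'a::comm_monoid_add"
  shows "(\<Sum>k\<le>n. G (n - k) k) + (\<Sum>k\<le>n. H (n - k) k) =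
    (\<Sum>k\<le>Suc n. (if k \<le> n then G (n - k) k else 0) + (if k = 0 then 0 else H (Suc n - k) (k - 1)))"
  unfolding sum.distrib
  by (rule arg_cong2[where f = "(+)"]) (simp, subst sum.atMost_Suc_shift, simp)

lemma qint_zero [simp]: "qint q 0 = 0"
  by (simp add: qint_def)

lemma qfact_Suc: "qfact q (Suc n) = qfact q n * qint q (Suc n)"
  by (simp add: qfact_def mult.commute)

lemma qfact_0 [simp]: "qfact q 0 = 1"
  by (simp add: qfact_def)

text \<open>The addition rule of q-integers that drives the q-Pascal recursion in
  \<open>qad_expand\<close>.\<close>

lemma qint_add:
  assumes "q \<noteq> 0"
  shows "qint q (p + k) * q powi int k = qint q p + q powi int (p + k) * qint q k"
proof -
  have "(q powi int (p + k) - q powi (- int (p + k))) * q powi int k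
     = (q powi int p - q powi (- int p)) + q powi int (p + k) * (q powi int k - q powi (- int k))"
    unfolding power_int_minus power_int_of_nat using assms by (simp add: power_add field_simps)
  then show ?thesis
    unfolding qint_def times_divide_eq_left times_divide_eq_right add_divide_distrib[symmetric]
    by (rule arg_cong)
qed

definition dpow :: "Qv \<Rightarrow> 'r::qv_algebra \<Rightarrow> nat \<Rightarrow> 'r" where
  "dpow q a n = inverse (qfact q n) *\<^sub>q a ^ n"

lemma dpow_Suc:
  assumes "\<And>s. s > 0 \<Longrightarrow> qint q s \<noteq> 0"
  shows "a * dpow q a n = qint q (Suc n) *\<^sub>q dpow q a (Suc n)"
    and "dpow q a n * a = qint q (Suc n) *\<^sub>q dpow q a (Suc n)"
  using assms[of "Suc n"]
  by (simp_all add: dpow_def qfact_Suc power_commutes field_simps)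

text \<open>Multiplication by a on either side raises one of the divided powers; the two
  contributions to the same monomial are added up by \<open>qint_add\<close>.\<close>

lemma qad_expand:
  assumes q: "q \<noteq> 0" and nz: "\<And>s. s > 0 \<Longrightarrow> qint q s \<noteq> 0"
  shows "inverse (qfact q n) *\<^sub>q qad q c a b n
    = (\<Sum>k\<le>n. ((-1) ^ k * q powi (int k * (c + int n - 1))) *\<^sub>q (dpow q a (n - k) * b * dpow q a k))"
    (is "_ = ?S n")
proof (induction n)
  case 0
  then show ?case by (simp add: dpow_def)
next
  case (Suc n)
  define T where "T p k = dpow q a p * b * dpow q a k" for p k
  define f where "f k = (-1) ^ k * q powi (int k * (c + int n - 1))" for k
  define e where "e = q powi (c + 2 * int n)"
  have l: "a * T p k = qint q (Suc p) *\<^sub>q T (Suc p) k" for p k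
    by (simp add: T_def dpow_Suc[OF nz] flip: mult.assoc)
  have r: "T p k * a = qint q (Suc k) *\<^sub>q T p (Suc k)" for p k
    by (simp add: T_def dpow_Suc[OF nz] mult.assoc)
  have coeff: "f k * qint q (Suc n - k) - (if k = 0 then 0 else e * (f (k - 1) * qint q k))
      = qint q (Suc n) * ((-1) ^ k * q powi (int k * (c + int n)))" if "k \<le> Suc n" for k
  proof -
    obtain p where p: "Suc n = p + k"
      using \<open>k \<le> Suc n\<close> by (metis le_add_diff_inverse2)
    have E: "(if k = 0 then 0 else e * (f (k - 1) * qint q k))
        = - ((-1) ^ k * q powi (int k * (c + int n - 1)) * (q powi int (p + k) * qint q k))"
    proof (cases k)
      case (Suc l)
      have "c + 2 * int n + int l * (c + int n - 1) = int k * (c + int n - 1) + int (p + k)"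
        using p Suc by (simp add: algebra_simps)
      then have "e * q powi (int l * (c + int n - 1)) = q powi (int k * (c + int n - 1)) * q powi int (p + k)"
        unfolding e_def using q by (metis power_int_add)
      then show ?thesis
        using Suc by (simp add: f_def)
    qed simp
    have "q powi (int k * (c + int n)) = q powi (int k * (c + int n - 1)) * q powi int k"
      by (subst power_int_add[symmetric]) (use q in \<open>simp_all add: algebra_simps\<close>)
    then have "qint q (Suc n) * ((-1) ^ k * q powi (int k * (c + int n)))
        = (-1) ^ k * q powi (int k * (c + int n - 1)) * (qint q (p + k) * q powi int k)"
      unfolding p by simp
    also have "\<dots> = (-1) ^ k * q powi (int k * (c + int n - 1)) * (qint q p + q powi int (p + k) * qint q k)"
      unfolding qint_add[OF q] ..
    finally show ?thesis
      unfolding E unfolding f_def p by (simp add: distrib_left)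
  qed
  \<comment> \<open>The induction step is proved after multiplication by [n+1], which is cancelled
    at the end.\<close>
  have "qint q (Suc n) *\<^sub>q inverse (qfact q (Suc n)) *\<^sub>q qad q c a b (Suc n)
      = inverse (qfact q n) *\<^sub>q qad q c a b (Suc n)"
    using nz[of "Suc n"] by (simp add: qfact_Suc field_simps)
  also have "\<dots> = a * ?S n - e *\<^sub>q (?S n * a)"
    unfolding Suc.IH[symmetric] by (simp add: qs_diff_right e_def mult.commute)
  also have "\<dots> = (\<Sum>k\<le>n. (f k * qint q (Suc (n - k))) *\<^sub>q T (Suc (n - k)) k)
      + (\<Sum>k\<le>n. (- (e * (f k * qint q (Suc k)))) *\<^sub>q T (n - k) (Suc k))"
    by (simp add: sum_distrib_left sum_distrib_right qs_sum_right sum_negf l r flip: T_def f_def)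
  also have "\<dots> = (\<Sum>k\<le>Suc n.
      (if k \<le> n then (f k * qint q (Suc (n - k))) *\<^sub>q T (Suc (n - k)) k else 0)
      + (if k = 0 then 0 else (- (e * (f (k - 1) * qint q (Suc (k - 1))))) *\<^sub>q T (Suc n - k) (Suc (k - 1))))"
    by (rule sum_antidiagonal_shift)
  also have "\<dots> = (\<Sum>k\<le>Suc n.
      (f k * qint q (Suc n - k) - (if k = 0 then 0 else e * (f (k - 1) * qint q k))) *\<^sub>q T (Suc n - k) k)"
  proof (rule sum.cong[OF refl])
    fix k assume "k \<in> {..Suc n}"
    then consider "k = Suc n" | "k \<le> n" by fastforce
    then show "(if k \<le> n then (f k * qint q (Suc (n - k))) *\<^sub>q T (Suc (n - k)) k else 0)
      + (if k = 0 then 0 else (- (e * (f (k - 1) * qint q (Suc (k - 1))))) *\<^sub>q T (Suc n - k) (Suc (k - 1)))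
      = (f k * qint q (Suc n - k) - (if k = 0 then 0 else e * (f (k - 1) * qint q k))) *\<^sub>q T (Suc n - k) k"
      by cases (simp_all add: Suc_diff_le qs_diff_left)
  qed
  also have "\<dots> = qint q (Suc n) *\<^sub>q ?S (Suc n)"
    unfolding qs_sum_right
    by (rule sum.cong[OF refl]) (simp add: coeff T_def)
  finally show ?case
    by (rule qs_cancel[THEN iffD1, OF nz[OF zero_less_Suc]])
qed

lemma lift_divpow: "lift h (divpow q p n) = dpow q (lift h p) n"
  by (simp add: divpow_def dpow_def lift_power)

lemma minus_one_power_scal: "(-1) ^ n = scal ((-1) ^ n)"
  by (induction n) (simp_all add: one_eq_scal, simp_all add: scal_def mult_single single_uminus)

text \<open>At m = 1 - c_ij the exponent k (c_ij + m - 1) in \<open>qad_expand\<close> is 0, so only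
  signs remain. The two sums run through the powers in opposite order, whence the global sign
  (-1)^m.\<close>

lemma lift_serre:
  assumes q: "vi d i \<noteq> 0" and nz: "\<And>s. s > 0 \<Longrightarrow> qint (vi d i) s \<noteq> 0" and c: "C i j \<le> 0"
  shows "lift h (serre C d X i j) =
    ((-1) ^ nat (1 - C i j) * inverse (qfact (vi d i) (nat (1 - C i j)))) *\<^sub>q
      qad (vi d i) (C i j) (h (X i)) (h (X j)) (nat (1 - C i j))"
proof -
  define m where "m = nat (1 - C i j)"
  have m: "C i j + int m - 1 = 0"
    using c by (simp add: m_def)
  let ?D = "dpow (vi d i) (h (X i))"
  have "lift h (serre C d X i j) = (\<Sum>n\<le>m. ((-1) ^ n) *\<^sub>q (?D n * h (X j) * ?D (m - n)))"
    unfolding serre_def Let_def m_def[symmetric]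
    by (simp add: lift_sum lift_mult lift_divpow minus_one_power_scal lift_scal atMost_atLeast0 mult.assoc)
  also have "\<dots> = (\<Sum>n\<le>m. ((-1) ^ (m - n)) *\<^sub>q (?D (m - n) * h (X j) * ?D n))"
    by (rule sum.reindex_bij_witness[of _ "\<lambda>n. m - n" "\<lambda>n. m - n"]) auto
  also have "\<dots> = (-1) ^ m *\<^sub>q (\<Sum>n\<le>m. ((-1) ^ n * vi d i powi (int n * (C i j + int m - 1)))
      *\<^sub>q (?D (m - n) * h (X j) * ?D n))"
    unfolding qs_sum_right
    by (rule sum.cong[OF refl]) (auto simp: m uminus_power_if)
  also have "\<dots> = (-1) ^ m *\<^sub>q inverse (qfact (vi d i) m) *\<^sub>q
      qad (vi d i) (C i j) (h (X i)) (h (X j)) m"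
    by (subst qad_expand[OF q nz]) simp_all
  finally show ?thesis
    unfolding m_def by simp
qed

section \<open>Quotients (x;Q)_a / (Q;Q)_a of q-shifted factorials and the Serre recursion\<close>

definition tcoef :: "Qv \<Rightarrow> Qv \<Rightarrow> nat \<Rightarrow> Qv" where
  "tcoef Q x a = (\<Prod>l<a. (1 - x * Q ^ l) / (1 - Q ^ Suc l))"

lemma tcoef_0 [simp]: "tcoef Q x 0 = 1"
  by (simp add: tcoef_def)

lemma tcoef_Suc:
  assumes "\<And>s. s > 0 \<Longrightarrow> Q ^ s \<noteq> 1"
  shows "(1 - Q ^ Suc a) * tcoef Q x (Suc a) = (1 - x * Q ^ a) * tcoef Q x a"
  using assms[of "Suc a"] by (simp add: tcoef_def)

lemma tcoef_eq_0:
  assumes "l < a" "x * Q ^ l = 1"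
  shows "tcoef Q x a = 0"
  unfolding tcoef_def using assms by (auto intro!: prod_zero)

text \<open>
  Rogers--Szego type polynomials: they satisfy the recursion which, by
  the commutator formulas for \<open>qad\<close>, computes the Serre element of the torus.
\<close>

definition tsum :: "Qv \<Rightarrow> Qv \<Rightarrow> Qv \<Rightarrow> 'r::qv_algebra \<Rightarrow> 'r \<Rightarrow> 'r \<Rightarrow> nat \<Rightarrow> 'r" where
  "tsum Q x y F G X n = (\<Sum>k\<le>n. (tcoef Q x (n - k) * tcoef Q y k) *\<^sub>q (F ^ (n - k) * G ^ k * X))"

text \<open>All terms are brought into the form F^a G^b X. Comparing coefficients leaves the
  identity \<open>coeff\<close>, a consequence of the first order recursion \<open>tcoef_Suc\<close>
  in each of the two indices.\<close>

lemma tsum_rec: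
  assumes Q: "\<And>s. s > 0 \<Longrightarrow> Q ^ s \<noteq> 1"
    and comm: "G * F = F * G" and XF: "X * F = u *\<^sub>q (F * X)" and XG: "X * G = u' *\<^sub>q (G * X)"
    and x: "e * u = x * Q ^ n" and y: "e * u' = y * Q ^ n"
  shows "(1 - Q ^ Suc n) *\<^sub>q tsum Q x y F G X (Suc n)
    = (F + G) * tsum Q x y F G X n - e *\<^sub>q (tsum Q x y F G X n * (F + G))
      - (if n = 0 then 0 else (1 - x * y * Q ^ (n - 1)) *\<^sub>q (F * G * tsum Q x y F G X (n - 1)))"
proof -
  define T where "T a b = F ^ a * G ^ b * X" for a b
  define c where "c = tcoef Q x"
  define d where "d = tcoef Q y"
  \<comment> \<open>The shifted coefficients are 0 at index 0, so that the boundary monomials fit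
    into the same sums.\<close>
  define c' where "c' a = (if a = 0 then 0 else c (a - 1))" for a
  define d' where "d' a = (if a = 0 then 0 else d (a - 1))" for a
  have GF: "G ^ b * F = F * G ^ b" for b
    by (induction b) (simp_all add: comm mult.assoc, simp add: comm flip: mult.assoc)
  have FG: "G * F ^ a = F ^ a * G" for a
    by (induction a) (simp, metis comm mult.assoc power_Suc)
  have FT: "F * T a b = T (Suc a) b" for a b
    by (simp add: T_def mult.assoc)
  have GT: "G * T a b = T a (Suc b)" for a b
    by (simp add: T_def FG flip: mult.assoc)
  have TF: "T a b * F = u *\<^sub>q T (Suc a) b" for a b
  proof -
    have "T a b * F = u *\<^sub>q (F ^ a * (G ^ b * F) * X)"
      by (simp add: T_def XF mult.assoc)
    then show ?thesis
      by (simp only: GF) (simp add: T_def power_commutes flip: mult.assoc)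
  qed
  have TG: "T a b * G = u' *\<^sub>q T a (Suc b)" for a b
    by (simp add: T_def XG mult.assoc power_commutes)
      (simp add: power_commutes flip: mult.assoc)
  have S: "tsum Q x y F G X n = (\<Sum>k\<le>n. (c (n - k) * d k) *\<^sub>q T (n - k) k)" for n
    by (simp add: tsum_def T_def c_def d_def)
  have main: "(F + G) * tsum Q x y F G X n - e *\<^sub>q (tsum Q x y F G X n * (F + G))
      = (\<Sum>k\<le>Suc n. ((1 - x * Q ^ n) * (c' (Suc n - k) * d k)
          + (1 - y * Q ^ n) * (c (Suc n - k) * d' k)) *\<^sub>q T (Suc n - k) k)"
  proof -
    have "(F + G) * tsum Q x y F G X n - e *\<^sub>q (tsum Q x y F G X n * (F + G))
      = (\<Sum>k\<le>n. ((1 - x * Q ^ n) * (c (n - k) * d k)) *\<^sub>q T (Suc (n - k)) k)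
        + (\<Sum>k\<le>n. ((1 - y * Q ^ n) * (c (n - k) * d k)) *\<^sub>q T (n - k) (Suc k))"
      unfolding S sum_distrib_left sum_distrib_right qs_sum_right sum.distrib[symmetric]
        sum_subtractf[symmetric] x[symmetric] y[symmetric]
      by (rule sum.cong[OF refl])
        (simp add: FT GT TF TG qs_distribs algebra_simps)
    also have "\<dots> = (\<Sum>k\<le>Suc n.
        (if k \<le> n then ((1 - x * Q ^ n) * (c (n - k) * d k)) *\<^sub>q T (Suc (n - k)) k else 0)
        + (if k = 0 then 0 else ((1 - y * Q ^ n) * (c (Suc n - k) * d (k - 1))) *\<^sub>q T (Suc n - k) (Suc (k - 1))))"
      by (rule sum_antidiagonal_shift)
    also have "\<dots> = (\<Sum>k\<le>Suc n. ((1 - x * Q ^ n) * (c' (Suc n - k) * d k)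
          + (1 - y * Q ^ n) * (c (Suc n - k) * d' k)) *\<^sub>q T (Suc n - k) k)"
    proof (rule sum.cong[OF refl])
      fix k assume "k \<in> {..Suc n}"
      then consider "k = Suc n" | "k \<le> n" by fastforce
      then show "(if k \<le> n then ((1 - x * Q ^ n) * (c (n - k) * d k)) *\<^sub>q T (Suc (n - k)) k else 0)
        + (if k = 0 then 0 else ((1 - y * Q ^ n) * (c (Suc n - k) * d (k - 1))) *\<^sub>q T (Suc n - k) (Suc (k - 1)))
        = ((1 - x * Q ^ n) * (c' (Suc n - k) * d k)
          + (1 - y * Q ^ n) * (c (Suc n - k) * d' k)) *\<^sub>q T (Suc n - k) k"
        by cases (simp_all add: c'_def d'_def Suc_diff_le qs_add_left)
    qed
    finally show ?thesis .
  qed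
  have third: "(if n = 0 then 0 else (1 - x * y * Q ^ (n - 1)) *\<^sub>q (F * G * tsum Q x y F G X (n - 1)))
      = (\<Sum>k\<le>Suc n. ((1 - x * y * Q ^ (n - 1)) * (c' (Suc n - k) * d' k)) *\<^sub>q T (Suc n - k) k)"
  proof (cases n)
    case 0
    then show ?thesis by (simp add: c'_def d'_def)
  next
    case (Suc m)
    have "(\<Sum>k\<le>Suc n. ((1 - x * y * Q ^ m) * (c' (Suc n - k) * d' k)) *\<^sub>q T (Suc n - k) k)
        = (\<Sum>k\<le>m. ((1 - x * y * Q ^ m) * (c' (n - k) * d' (Suc k))) *\<^sub>q T (n - k) (Suc k))"
      unfolding Suc by (subst sum.atMost_Suc_shift, subst sum.atMost_Suc) (simp add: c'_def d'_def)
    also have "\<dots> = (1 - x * y * Q ^ m) *\<^sub>q (F * G * tsum Q x y F G X m)"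
      unfolding S sum_distrib_left qs_sum_right Suc
      by (rule sum.cong[OF refl]) (simp add: c'_def d'_def FT GT mult.assoc Suc_diff_le)
    finally show ?thesis using Suc by simp
  qed
  have coeff: "(1 - Q ^ Suc n) * (c a * d b) = ((1 - x * Q ^ n) * (c' a * d b) + (1 - y * Q ^ n) * (c a * d' b))
      - (1 - x * y * Q ^ (n - 1)) * (c' a * d' b)" if "a + b = Suc n" for a b
  proof -
    have C: "(1 - Q ^ Suc a) * c (Suc a) = (1 - x * Q ^ a) * c a" for a
      unfolding c_def by (rule tcoef_Suc[OF Q])
    have D: "(1 - Q ^ Suc a) * d (Suc a) = (1 - y * Q ^ a) * d a" for a
      unfolding d_def by (rule tcoef_Suc[OF Q])
    consider "a = 0" | a1 where "b = 0" "a = Suc a1" | a1 b1 where "a = Suc a1" "b = Suc b1"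
      by (metis nat.exhaust)
    then show ?thesis
    proof cases
      case 1
      then show ?thesis using that D[of n] by (simp add: c'_def d'_def c_def)
    next
      case 2
      then show ?thesis using that C[of n] by (simp add: c'_def d'_def d_def)
    next
      case 3
      define s t where "s = Q ^ a1" and "t = Q ^ b1"
      have n: "n = Suc (a1 + b1)" using that 3 by simp
      have C1: "(1 - s * Q) * c a = (1 - x * s) * c a1" and D1: "(1 - t * Q) * d b = (1 - y * t) * d b1"
        using C[of a1] D[of b1] 3 by (simp_all add: s_def t_def mult.commute)
      \<comment> \<open>The splitting 1 - s t Q^2 = (1 - s Q) + s Q (1 - t Q) makes the recursions
        \<open>C1\<close> and \<open>D1\<close> applicable.\<close>
      have "(1 - s * t * Q * Q) * (c a * d b)
        = ((1 - s * Q) * c a) * d b + s * Q * c a * ((1 - t * Q) * d b)"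
        by (simp add: algebra_simps)
      also have "\<dots> = (1 - x * s) * c a1 * d b + s * Q * c a * ((1 - y * t) * d b1)"
        unfolding C1 D1 by simp
      also have "\<dots> = (1 - x * s * t * Q) * c a1 * d b + (1 - y * s * t * Q) * c a * d b1
          - x * s * c a1 * ((1 - t * Q) * d b) - ((1 - s * Q) * c a) * d b1"
        by (simp add: algebra_simps)
      also have "\<dots> = (1 - x * s * t * Q) * c a1 * d b + (1 - y * s * t * Q) * c a * d b1
          - (1 - x * y * s * t) * c a1 * d b1"
        unfolding C1 D1 by (simp add: algebra_simps)
      finally show ?thesis
        unfolding n using 3 by (simp add: c'_def d'_def s_def t_def power_add algebra_simps)
    qed
  qed
  have "(1 - Q ^ Suc n) *\<^sub>q tsum Q x y F G X (Suc n)
      = (\<Sum>k\<le>Suc n. ((1 - Q ^ Suc n) * (c (Suc n - k) * d k)) *\<^sub>q T (Suc n - k) k)"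
    unfolding S qs_sum_right by simp
  also have "\<dots> = (\<Sum>k\<le>Suc n. ((1 - x * Q ^ n) * (c' (Suc n - k) * d k)
          + (1 - y * Q ^ n) * (c (Suc n - k) * d' k)) *\<^sub>q T (Suc n - k) k
        - ((1 - x * y * Q ^ (n - 1)) * (c' (Suc n - k) * d' k)) *\<^sub>q T (Suc n - k) k)"
    by (rule sum.cong[OF refl]) (simp only: qs_diff_left[symmetric] coeff atMost_iff le_add_diff_inverse2)
  finally show ?thesis
    unfolding main third by (simp only: sum_subtractf)
qed

text \<open>Every summand has a zero factor. With Q = q^2, y Q^s = 1 kills the terms with k > s, and
  x Q^{-c-s} = 1 kills the others, for which n - k > -c - s.\<close>

lemma tsum_eq_0:
  assumes n: "int n = 1 - c" and q: "q \<noteq> 0" and s: "0 \<le> s" "s \<le> - c"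
    and x: "x = q powi (2 * c + 2 * s)" and y: "y = q powi (- 2 * s)"
  shows "tsum (q\<^sup>2) x y F G X n = 0"
proof -
  have pw: "(q\<^sup>2) ^ nat t = q powi (2 * t)" if "t \<ge> 0" for t
    by (subst power_int_mult) (use that in \<open>simp add: power_int_def\<close>)
  have s': "- c - s \<ge> 0" using s by simp
  show ?thesis
    unfolding tsum_def
  proof (rule sum.neutral, rule ballI)
    fix k assume "k \<in> {..n}"
    show "(tcoef (q\<^sup>2) x (n - k) * tcoef (q\<^sup>2) y k) *\<^sub>q (F ^ (n - k) * G ^ k * X) = 0"
    proof (cases "int k > s")
      case True
      have "y * (q\<^sup>2) ^ nat s = q powi (- 2 * s + 2 * s)"
        unfolding y pw[OF s(1)] by (rule power_int_add[symmetric]) (use q in simp)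
      then have "tcoef (q\<^sup>2) y k = 0"
        by (intro tcoef_eq_0[of "nat s"]) (use True s in \<open>simp_all add: nat_less_iff\<close>)
      then show ?thesis by simp
    next
      case False
      have "x * (q\<^sup>2) ^ nat (- c - s) = q powi ((2 * c + 2 * s) + 2 * (- c - s))"
        unfolding x pw[OF s'] by (rule power_int_add[symmetric]) (use q in simp)
      then have "tcoef (q\<^sup>2) x (n - k) = 0"
        by (intro tcoef_eq_0[of "nat (- c - s)"]) (use False s n \<open>k \<in> {..n}\<close> in auto)
      then show ?thesis by simp
    qed
  qed
qed

text \<open>By linearity the solution is the sum of the ones starting with X and with X'. Up to the
  factor (Q;Q)_n these are \<open>tsum\<close> with the roles of x and y exchanged, and both vanish
  at 1 - c.\<close>

lemma serre_recursion_vanishes: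
  fixes Y :: "nat \<Rightarrow> 'r::qv_algebra"
  assumes q: "q \<noteq> 0" "\<And>s. s > 0 \<Longrightarrow> q ^ s \<noteq> 1" and c: "c \<le> 0"
    and s: "0 \<le> s" "s \<le> - c"
    and comm: "G * F = F * G"
    and X: "X * F = q powi (c + 2 * s) *\<^sub>q (F * X)" "X * G = q powi (- (c + 2 * s)) *\<^sub>q (G * X)"
    and X': "X' * F = q powi (- (c + 2 * s)) *\<^sub>q (F * X')" "X' * G = q powi (c + 2 * s) *\<^sub>q (G * X')"
    and Y0: "Y 0 = X + X'"
    and Y: "\<And>n. Y (Suc n) = (F + G) * Y n - q powi (c + 2 * int n) *\<^sub>q (Y n * (F + G))
       - ((1 - q ^ (2 * n)) * (1 - q powi (2 * c + 2 * int n - 2))) *\<^sub>q (F * G * Y (n - 1))"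
  shows "Y (nat (1 - c)) = 0"
proof -
  define Q where "Q = q\<^sup>2"
  have Q: "Q ^ s \<noteq> 1" if "s > 0" for s
    using q(2)[of "2 * s"] that by (simp add: Q_def power_mult)
  define x y where "x = q powi (2 * c + 2 * s)" and "y = q powi (- 2 * s)"
  define P where "P n = (\<Prod>l<n. 1 - Q ^ Suc l)" for n
  define Z where "Z n = tsum Q x y F G X n + tsum Q y x F G X' n" for n
  have pw: "q powi (2 * int n) = Q ^ n" for n
    using q(1) by (simp add: Q_def power_int_mult)
  have e1: "q powi (c + 2 * int n) * q powi (c + 2 * s) = x * Q ^ n" for n
    unfolding x_def pw[symmetric]
    by (subst (1 2) power_int_add[symmetric]) (use q(1) in \<open>simp_all add: algebra_simps\<close>)
  have e2: "q powi (c + 2 * int n) * q powi (- (c + 2 * s)) = y * Q ^ n" for n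
    unfolding y_def pw[symmetric]
    by (subst (1 2) power_int_add[symmetric]) (use q(1) in \<open>simp_all add: algebra_simps\<close>)
  have e3: "1 - q powi (2 * c + 2 * int n - 2) = 1 - x * y * Q ^ (n - 1)" if "n > 0" for n
  proof -
    have "x * y = q powi (2 * c)"
      unfolding x_def y_def by (subst power_int_add[symmetric]) (use q(1) in simp_all)
    then have "x * y * Q ^ (n - 1) = q powi (2 * c + 2 * int (n - 1))"
      unfolding pw[symmetric] by (subst power_int_add) (use q(1) in simp_all)
    then show ?thesis using that by (simp add: of_nat_diff algebra_simps)
  qed
  have rec: "(1 - Q ^ Suc n) *\<^sub>q Z (Suc n) = (F + G) * Z n - q powi (c + 2 * int n) *\<^sub>q (Z n * (F + G))
      - (if n = 0 then 0 else (1 - x * y * Q ^ (n - 1)) *\<^sub>q (F * G * Z (n - 1)))" for n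
  proof -
    have r1: "(1 - Q ^ Suc n) *\<^sub>q tsum Q x y F G X (Suc n)
      = (F + G) * tsum Q x y F G X n - q powi (c + 2 * int n) *\<^sub>q (tsum Q x y F G X n * (F + G))
      - (if n = 0 then 0 else (1 - x * y * Q ^ (n - 1)) *\<^sub>q (F * G * tsum Q x y F G X (n - 1)))"
      by (rule tsum_rec[OF Q comm X e1 e2])
    have r2: "(1 - Q ^ Suc n) *\<^sub>q tsum Q y x F G X' (Suc n)
      = (F + G) * tsum Q y x F G X' n - q powi (c + 2 * int n) *\<^sub>q (tsum Q y x F G X' n * (F + G))
      - (if n = 0 then 0 else (1 - y * x * Q ^ (n - 1)) *\<^sub>q (F * G * tsum Q y x F G X' (n - 1)))"
      by (rule tsum_rec[OF Q comm X' e2 e1])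
    show ?thesis
      unfolding Z_def qs_add_right r1 r2
      by (simp add: distrib_left distrib_right qs_add_right mult.commute[of y x])
  qed
  \<comment> \<open>Two consecutive values are carried along because the recursion has three
    terms.\<close>
  have "Y n = P n *\<^sub>q Z n \<and> Y (Suc n) = P (Suc n) *\<^sub>q Z (Suc n)" for n
  proof (induction n)
    case 0
    have "Y 0 = Z 0"
      by (simp add: Y0 Z_def tsum_def)
    moreover have "Y (Suc 0) = (1 - Q) *\<^sub>q Z (Suc 0)"
      unfolding Y[of 0] \<open>Y 0 = Z 0\<close> using rec[of 0] by simp
    ultimately show ?case by (simp add: P_def)
  next
    case (Suc n)
    then have IH: "Y n = P n *\<^sub>q Z n" "Y (Suc n) = P (Suc n) *\<^sub>q Z (Suc n)" by simp_all
    have P: "P (Suc n) = (1 - q ^ (2 * Suc n)) * P n" 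
    proof -
      have "Q ^ Suc n = q ^ (2 * Suc n)" by (simp only: Q_def power_mult)
      then show ?thesis by (simp add: P_def)
    qed
    have "Y (Suc (Suc n)) = P (Suc n) *\<^sub>q ((1 - Q ^ Suc (Suc n)) *\<^sub>q Z (Suc (Suc n)))"
      unfolding Y[of "Suc n"] rec[of "Suc n"] diff_Suc_1 IH e3[OF zero_less_Suc]
      by (simp add: qs_diff_right P mult_ac)
    also have "\<dots> = P (Suc (Suc n)) *\<^sub>q Z (Suc (Suc n))"
      by (simp add: P_def)
    finally show ?case using IH by simp
  qed
  moreover have "Z (nat (1 - c)) = 0"
  proof -
    have "tsum Q x y F G X (nat (1 - c)) = 0"
      unfolding Q_def by (rule tsum_eq_0[OF _ q(1) s x_def y_def]) (use c in simp)
    \<comment> \<open>Exchanging x and y amounts to replacing s by -c - s, which lies in the same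
      range.\<close>
    moreover have "tsum Q y x F G X' (nat (1 - c)) = 0"
      unfolding Q_def
      by (rule tsum_eq_0[of _ c _ "- c - s"]) (use c s q(1) in \<open>simp_all add: x_def y_def algebra_simps\<close>)
    ultimately show ?thesis by (simp add: Z_def)
  qed
  ultimately show ?thesis by simp
qed

section \<open>Operators on functions on words\<close>

type_synonym 'q wfun = "nat list \<Rightarrow> int \<Rightarrow> 'q"

lift_definition Lop :: "nat \<Rightarrow> 'q::qv_space wfun rendo" is "\<lambda>i \<phi> w. \<phi> (i # w)"
  by (simp add: fun_eq_iff)

lift_definition Rop :: "nat \<Rightarrow> 'q::qv_space wfun rendo" is "\<lambda>i \<phi> w. \<phi> (w @ [i])"
  by (simp add: fun_eq_iff)

lift_definition Rm :: "'q::qv_algebra \<Rightarrow> 'q wfun rendo" is "\<lambda>b \<phi> w n. \<phi> w n * b"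
  by (simp add: fun_eq_iff distrib_right)

text \<open>One family for everything diagonal in the word: a scalar depending on the word, left
  multiplication by b, and a power of t. It contains the K_i and K_i' and the left
  multiplications.\<close>

lift_definition Dg :: "(nat list \<Rightarrow> Qv) \<Rightarrow> 'q::qv_algebra \<Rightarrow> int \<Rightarrow> 'q wfun rendo"
  is "\<lambda>f b s \<phi> w n. f w *\<^sub>q (b * \<phi> w (n + s))"
  by (simp add: fun_eq_iff distrib_left qs_add_right mult.commute)

text \<open>A sum over all factorisations u i u' of the word: A is applied to the function u''
  \<mapsto> \<phi>(u u'') and the result evaluated at u'. This is the only operator that vanishes at
  the empty word and satisfies \<open>der_Lop\<close>.\<close>

primrec derw :: "nat \<Rightarrow> ('q::qv_space wfun \<Rightarrow> 'q wfun) \<Rightarrow> nat list \<Rightarrow> 'q wfun \<Rightarrow> int \<Rightarrow> 'q" where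
  "derw i A [] \<phi> = 0"
| "derw i A (j # w) \<phi> = derw i A w (\<lambda>u. \<phi> (j # u)) + (if i = j then A \<phi> w else 0)"

lemma derw_add:
  assumes "\<And>x y. A (x + y) = A x + A y"
  shows "derw i A w (x + y) = derw i A w x + derw i A w y"
proof (induction w arbitrary: x y)
  case (Cons j w)
  have "(\<lambda>u. (x + y) (j # u)) = (\<lambda>u. x (j # u)) + (\<lambda>u. y (j # u))" by (simp add: fun_eq_iff)
  then show ?case by (simp only: derw.simps Cons.IH assms) (auto simp: fun_eq_iff)
qed simp

lemma derw_qs:
  assumes "\<And>c x. A (c *\<^sub>q x) = c *\<^sub>q A x"
  shows "derw i A w (c *\<^sub>q x) = c *\<^sub>q derw i A w x"
proof (induction w arbitrary: x)
  case (Cons j w)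
  have "(\<lambda>u. (c *\<^sub>q x) (j # u)) = c *\<^sub>q (\<lambda>u. x (j # u))" by (simp add: fun_eq_iff)
  then show ?case by (simp only: derw.simps Cons.IH assms) (auto simp: fun_eq_iff qs_add_right)
qed simp

lift_definition der :: "nat \<Rightarrow> 'q::qv_space wfun rendo \<Rightarrow> 'q wfun rendo" is "\<lambda>i A \<phi> w. derw i A w \<phi>"
  by (simp add: fun_eq_iff derw_add derw_qs)

lemma app_Lop [simp]: "(\<phi> \<bullet> Lop i) w = \<phi> (i # w)"
  and app_Rop [simp]: "(\<phi> \<bullet> Rop i) w = \<phi> (w @ [i])"
  by (transfer; simp)+

lemma app_Rm [simp]: "(\<phi> \<bullet> Rm b) w n = \<phi> w n * b"
  and app_Dg [simp]: "(\<phi> \<bullet> Dg f b s) w n = f w *\<^sub>q (b * \<phi> w (n + s))"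
  by (transfer; simp)+

lemma app_der_Nil [simp]: "(\<phi> \<bullet> der i A) [] = 0"
  by transfer simp

lemma app_der_Cons: "(\<phi> \<bullet> der i A) (j # w) = (\<phi> \<bullet> Lop j \<bullet> der i A) w + (if i = j then \<phi> \<bullet> A else 0) w"
  by transfer simp

lemma der_Lop: "der i A * Lop j = Lop j * der i A + (if i = j then A else 0)"
proof (rule rendo_eqI)
  fix \<phi> :: "'a wfun"
  show "\<phi> \<bullet> (der i A * Lop j) = \<phi> \<bullet> (Lop j * der i A + (if i = j then A else 0))"
    by (simp add: fun_eq_iff app_der_Cons)
qed

lemma Lop_Rop: "Lop i * Rop j = Rop j * Lop i"
  by (rule rendo_eqI) (simp add: fun_eq_iff)

lemma Rm_comm: "Rm b * Lop i = Lop i * Rm b" "Rm b * Rop i = Rop i * Rm b" "Rm b * Dg f a s = Dg f a s * Rm b"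
  by (rule rendo_eqI; simp add: fun_eq_iff mult.assoc)+

lemma Dg_mult: "Dg f a s * Dg g b t = Dg (\<lambda>w. f w * g w) (b * a) (s + t)"
  by (rule rendo_eqI) (simp add: fun_eq_iff mult.assoc add_ac mult.commute)

lemma Dg_Lop:
  assumes "\<And>w. f (i # w) = c * f w"
  shows "Dg f a s * Lop i = c *\<^sub>q (Lop i * Dg f a s)"
  by (rule rendo_eqI) (simp add: fun_eq_iff assms)

lemma Dg_Rop:
  assumes "\<And>w. f (w @ [i]) = c * f w"
  shows "Dg f a s * Rop i = c *\<^sub>q (Rop i * Dg f a s)"
  by (rule rendo_eqI) (simp add: fun_eq_iff assms)

text \<open>Moving D past one letter after the other brings every value to the empty word. Many
  operator identities below are obtained by applying this to the difference of their two
  sides.\<close>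

lemma rendo_vacuum:
  assumes "\<And>\<phi>. (\<phi> \<bullet> D) [] = 0" and "\<And>j. D * Lop j = c j *\<^sub>q (Lop j * D)"
  shows "D = 0"
proof (rule rendo_eqI)
  fix \<phi>
  have "(\<phi> \<bullet> D) w = 0" for w
  proof (induction w arbitrary: \<phi>)
    case (Cons j w)
    have "(\<phi> \<bullet> D) (j # w) = (\<phi> \<bullet> (D * Lop j)) w" by simp
    also have "\<dots> = c j *\<^sub>q (\<phi> \<bullet> Lop j \<bullet> D) w"
      unfolding assms(2) by simp
    finally show ?case using Cons.IH by simp
  qed (rule assms)
  then show "\<phi> \<bullet> D = \<phi> \<bullet> 0" by (simp add: fun_eq_iff)
qed

lemma der_add: "der i (A + A') = der i A + der i A'"
proof -
  have "der i (A + A') - der i A - der i A' = 0"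
    by (rule rendo_vacuum[where c = "\<lambda>_. 1"]) (simp_all add: left_diff_distrib right_diff_distrib der_Lop)
  then show ?thesis by (simp add: algebra_simps)
qed

text \<open>The derivation removes a letter i, whence the inverse of \<open>c i\<close>. The
  difference of the two sides again q-commutes with the letters, so \<open>rendo_vacuum\<close>
  applies.\<close>

lemma twist_der:
  assumes "\<And>\<phi>. \<phi> [] = 0 \<Longrightarrow> (\<phi> \<bullet> D) [] = 0" and "\<And>j. D * Lop j = c j *\<^sub>q (Lop j * D)"
    and "c i \<noteq> 0" and "D * A = A * D"
  shows "D * der i A = inverse (c i) *\<^sub>q (der i A * D)"
proof -
  have "D * der i A - inverse (c i) *\<^sub>q (der i A * D) = 0" (is "?Z = 0")
  proof (rule rendo_vacuum)
    fix \<phi> show "(\<phi> \<bullet> ?Z) [] = 0" by (simp add: assms(1))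
  next
    fix j
    have "?Z * Lop j = D * (der i A * Lop j) - inverse (c i) *\<^sub>q (der i A * (D * Lop j))"
      by (simp add: left_diff_distrib mult.assoc)
    also have "D * (der i A * Lop j) = (D * Lop j) * der i A + D * (if i = j then A else 0)"
      by (simp add: der_Lop distrib_left mult.assoc)
    also have "der i A * (D * Lop j) = c j *\<^sub>q ((der i A * Lop j) * D)"
      by (simp add: assms(2) mult.assoc)
    also have "(D * Lop j) * der i A + D * (if i = j then A else 0)
        - inverse (c i) *\<^sub>q c j *\<^sub>q ((der i A * Lop j) * D) = c j *\<^sub>q (Lop j * ?Z)"
      unfolding der_Lop assms(2)
      using assms(3,4) by (auto simp: distrib_right right_diff_distrib qs_distribs mult.assoc mult.commute)
    finally show "?Z * Lop j = c j *\<^sub>q (Lop j * ?Z)" .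
  qed
  then show ?thesis by simp
qed

lemma Dg_der:
  assumes "\<And>j w. f (j # w) = c j * f w" "c i \<noteq> 0" "Dg f a s * A = A * Dg f a s"
  shows "Dg f a s * der i A = inverse (c i) *\<^sub>q (der i A * Dg f a s)"
  by (rule twist_der[of _ c]) (use assms in \<open>auto simp: fun_eq_iff intro: Dg_Lop\<close>)

lemma Rm_der:
  assumes "Rm b * A = A * Rm b"
  shows "Rm b * der i A = der i A * Rm b"
  using twist_der[of "Rm b" "\<lambda>_. 1" i A] assms by (simp add: fun_eq_iff Rm_comm)

text \<open>A derivation deletes a letter, so its value at w involves shorter words only. This makes
  recursions over the length of words possible.\<close>

lemma der_local:
  assumes "\<And>\<phi> w. \<phi> w = 0 \<Longrightarrow> (\<phi> \<bullet> A) w = 0"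
    and "\<And>u. length u < length w \<Longrightarrow> \<phi> u = 0"
  shows "(\<phi> \<bullet> der i A) w = 0"
  using assms(2)
proof (induction w arbitrary: \<phi>)
  case (Cons j w)
  then have "(\<phi> \<bullet> Lop j \<bullet> der i A) w = 0" by (intro Cons.IH) (simp only: app_Lop Cons.prems length_Cons Suc_less_eq)
  moreover have "(\<phi> \<bullet> A) w = 0" by (intro assms(1) Cons.prems) simp
  ultimately show ?case by (simp add: app_der_Cons fun_eq_iff)
qed simp

lemma der_vanish:
  assumes "\<And>\<phi> w. \<phi> \<in> P \<Longrightarrow> (\<phi> \<bullet> A) w s = 0" and "\<And>\<phi> j. \<phi> \<in> P \<Longrightarrow> \<phi> \<bullet> Lop j \<in> P" and "\<phi> \<in> P"
  shows "(\<phi> \<bullet> der i A) w s = 0"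
  using assms(3) by (induction w arbitrary: \<phi>) (simp_all add: app_der_Cons assms(1,2))


section \<open>The action of the double\<close>

lemma const_zero_fun [simp]: "(\<lambda>a. 0) = 0"
  by (simp add: zero_fun_def)

text \<open>\<open>chi i j\<close> is the scalar v_i^{c_ij} by which K_i' passes F_j, and K_i K_i'
  will act as left multiplication by \<open>kk i\<close>. Symmetry and invertibility of
  \<open>chi\<close> range over all indices since words may contain any letters.\<close>

locale double_module =
  fixes I :: "nat set" and v :: "nat \<Rightarrow> Qv" and C :: "nat \<Rightarrow> nat \<Rightarrow> int"
    and chi :: "nat \<Rightarrow> nat \<Rightarrow> Qv" and kk :: "nat \<Rightarrow> 'q::qv_algebra"
  assumes v_nz: "\<And>i. i \<in> I \<Longrightarrow> v i \<noteq> 0"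
    and v_root: "\<And>i s. i \<in> I \<Longrightarrow> s > 0 \<Longrightarrow> v i ^ s \<noteq> 1"
    and C_le: "\<And>i j. i \<in> I \<Longrightarrow> j \<in> I \<Longrightarrow> i \<noteq> j \<Longrightarrow> C i j \<le> 0"
    and chi_sym: "\<And>i j. chi i j = chi j i"
    and chi_nz [simp]: "\<And>i j. chi i j \<noteq> 0"
    and chi_C: "\<And>i j. i \<in> I \<Longrightarrow> j \<in> I \<Longrightarrow> i \<noteq> j \<Longrightarrow> chi i j = v i powi C i j"
    and chi_diag: "\<And>i. i \<in> I \<Longrightarrow> chi i i = (v i)\<^sup>2"
    and kk_comm: "\<And>i j. kk i * kk j = kk j * kk i"
begin

definition wt :: "nat \<Rightarrow> nat list \<Rightarrow> Qv" where
  "wt i w = prod_list (map (chi i) w)"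

lemma wt_simps [simp]: "wt i [] = 1" "wt i (j # w) = chi i j * wt i w" "wt i (w @ [j]) = chi i j * wt i w"
  by (simp_all add: wt_def mult.commute)

lemma wt_nz [simp]: "wt i w \<noteq> 0"
  by (induction w) simp_all

text \<open>
  The integer argument of a function on words is dual to the exponent of \<open>t\<close>: multiplication by \<open>t\<close>
  is the shift by 1.
\<close>

definition K :: "nat \<Rightarrow> 'q wfun rendo" where
  "K i = Dg (\<lambda>w. inverse (wt i w)) (kk i) (- 1)"

definition K' :: "nat \<Rightarrow> 'q wfun rendo" where
  "K' i = Dg (wt i) 1 1"

definition qdenom :: "nat \<Rightarrow> Qv" where
  "qdenom i = inverse (v i - inverse (v i))"

definition E :: "nat \<Rightarrow> 'q wfun rendo" where
  "E i = der i (qdenom i *\<^sub>q (K i - K' i))"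

definition kk_op :: "nat \<Rightarrow> 'q wfun rendo" where
  "kk_op i = Dg (\<lambda>_. 1) (kk i) 0"

lemma K_Lop: "K i * Lop j = inverse (chi i j) *\<^sub>q (Lop j * K i)"
  unfolding K_def by (rule Dg_Lop) simp

lemma K'_Lop: "K' i * Lop j = chi i j *\<^sub>q (Lop j * K' i)"
  unfolding K'_def by (rule Dg_Lop) simp

lemma K_K: "K i * K j = K j * K i"
  unfolding K_def Dg_mult by (simp add: mult.commute kk_comm)

lemma K_K': "K i * K' j = K' j * K i"
  unfolding K_def K'_def Dg_mult by (simp add: mult.commute)

lemma K'_K': "K' i * K' j = K' j * K' i"
  unfolding K'_def Dg_mult by (simp add: mult.commute)

lemma K_mult_K': "K i * K' i = kk_op i"
  unfolding K_def K'_def kk_op_def Dg_mult by simp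

lemma kk_op_Lop: "kk_op i * Lop j = Lop j * kk_op i"
  using Dg_Lop[of "\<lambda>_. 1" j 1 "kk i" 0] by (simp add: kk_op_def)

lemma E_Lop: "E i * Lop j = Lop j * E i + (if i = j then qdenom i *\<^sub>q (K i - K' i) else 0)"
  unfolding E_def by (rule der_Lop)

lemma K_E: "K i * E j = chi i j *\<^sub>q (E j * K i)"
proof -
  have "K i * der j A = inverse (inverse (chi i j)) *\<^sub>q (der j A * K i)" if "K i * A = A * K i" for A
    using that unfolding K_def by (intro Dg_der) simp_all
  then show ?thesis
    unfolding E_def by (simp add: right_diff_distrib left_diff_distrib K_K K_K')
qed

lemma K'_E: "K' i * E j = inverse (chi i j) *\<^sub>q (E j * K' i)"
proof -
  have "K' i * der j A = inverse (chi i j) *\<^sub>q (der j A * K' i)" if "K' i * A = A * K' i" for A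
    using that unfolding K'_def by (intro Dg_der) simp_all
  then show ?thesis
    unfolding E_def by (simp add: right_diff_distrib left_diff_distrib K'_K' K_K'[symmetric])
qed

section \<open>The Serre relations and the action\<close>

definition S :: "nat \<Rightarrow> nat \<Rightarrow> 'q wfun rendo" where
  "S i j = qad (v i) (C i j) (Lop i) (Lop j) (nat (1 - C i j))"

lemma powi_minus_C: "i \<in> I \<Longrightarrow> j \<in> I \<Longrightarrow> i \<noteq> j \<Longrightarrow> v i powi - C i j = inverse (chi i j)"
  by (simp add: chi_C power_int_minus)

lemma gq_Serre: "i \<in> I \<Longrightarrow> j \<in> I \<Longrightarrow> i \<noteq> j \<Longrightarrow> gq (v i) (C i j) (nat (1 - C i j)) = 0"
  using v_root[of i 2] by (intro gq_zero) (simp_all add: v_nz C_le)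

text \<open>A and A' twist like K_k and K_k'. For k = i the commutator has the factor
  \<open>gq\<close>, for k = j the factor \<open>muq\<close>, and both vanish at 1 - c_ij; for other
  k nothing is picked up. Keeping A and A' apart lets the result also serve derivations in which one
  of them is 0.\<close>

lemma der_S:
  assumes ij: "i \<in> I" "j \<in> I" "i \<noteq> j"
    and A: "\<And>l. A * Lop l = inverse (chi k l) *\<^sub>q (Lop l * A)"
    and A': "\<And>l. A' * Lop l = chi k l *\<^sub>q (Lop l * A')"
  shows "der k (A + A') * S i j = S i j * der k (A + A')"
proof -
  let ?D = "der k (A + A')" and ?n = "nat (1 - C i j)"
  have D: "?D * Lop l = Lop l * ?D + (if k = l then A + A' else 0)" for l
    by (rule der_Lop)
  consider "k = i" | "k = j" | "k \<noteq> i" "k \<noteq> j" by blast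
  then show ?thesis
  proof cases
    case 1
    have "?D * qad (v i) (C i j) (Lop i) (Lop j) ?n
      = qad (v i) (C i j) (Lop i) (Lop j) ?n * ?D
        + gq (v i) (C i j) ?n *\<^sub>q (qad (v i) (C i j) (Lop i) (Lop j) (?n - 1) * A)"
      by (rule qad_commutator_base[where A' = A'])
        (use 1[symmetric] ij in \<open>simp_all add: D A A' powi_minus_C chi_diag v_nz flip: chi_C add.assoc\<close>)
    then show ?thesis
      using ij by (simp add: S_def gq_Serre)
  next
    case 2
    have "?D * qad (v i) (C i j) (Lop i) (Lop j) ?n
      = qad (v i) (C i j) (Lop i) (Lop j) ?n * ?D
        + (if ?n = 0 then A else 0) + muq (v i) (C i j) ?n *\<^sub>q (Lop i ^ ?n * A')"
      by (rule qad_commutator_argument)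
        (use 2[symmetric] ij in \<open>simp_all add: D A A' powi_minus_C v_nz chi_sym[of k i] flip: chi_C add.assoc\<close>)
    then show ?thesis
      using ij C_le[OF ij] by (simp add: S_def muq_zero)
  next
    case 3
    have "?D * qad (v i) (C i j) (Lop i) (Lop j) ?n
      = qad (v i) (C i j) (Lop i) (Lop j) ?n * ?D
        + gq (v i) (C i j) ?n *\<^sub>q (qad (v i) (C i j) (Lop i) (Lop j) (?n - 1) * 0)"
      by (rule qad_commutator_base[where A' = 0]) (use 3 ij in \<open>simp_all add: D v_nz\<close>)
    then show ?thesis
      by (simp add: S_def)
  qed
qed

lemma E_S:
  assumes "i \<in> I" "j \<in> I" "i \<noteq> j"
  shows "E k * S i j = S i j * E k"
proof -
  have "E k = der k (qdenom k *\<^sub>q K k + (- qdenom k) *\<^sub>q K' k)"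
    by (simp add: E_def qs_diff_right)
  moreover have "der k (qdenom k *\<^sub>q K k + (- qdenom k) *\<^sub>q K' k) * S i j
      = S i j * der k (qdenom k *\<^sub>q K k + (- qdenom k) *\<^sub>q K' k)"
    by (rule der_S) (use assms in \<open>simp_all add: K_Lop K'_Lop mult.commute\<close>)
  ultimately show ?thesis by metis
qed

text \<open>The same commutator formulas with the roles exchanged: \<open>Lop k\<close> is moved
  past brackets of the E's, a multiple of K_k' playing A and one of K_k playing A'. So the Serre
  bracket commutes with all letters, and it vanishes at the empty word.\<close>

lemma E_Serre:
  assumes ij: "i \<in> I" "j \<in> I" "i \<noteq> j"
  shows "qad (v i) (C i j) (E i) (E j) (nat (1 - C i j)) = 0" (is "?S = 0")
proof (rule rendo_vacuum[where c = "\<lambda>_. 1"])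
  fix \<phi>
  have "(\<phi> \<bullet> qad (v i) (C i j) (E i) (E j) n) [] = 0" for n
  proof (induction n arbitrary: \<phi>)
    case 0
    show ?case by (simp add: E_def)
  next
    case (Suc n)
    have "(\<psi> \<bullet> E i) [] = 0" for \<psi> by (simp add: E_def)
    then show ?case by (simp only: qad.simps app_diff app_mult app_qs minus_apply qs_fun_apply Suc.IH) simp
  qed
  then show "(\<phi> \<bullet> ?S) [] = 0" .
next
  fix k
  let ?n = "nat (1 - C i j)"
  have L: "Lop k * E l = E l * Lop k + (if l = k then qdenom k *\<^sub>q K' k else 0) + (if l = k then (- qdenom k) *\<^sub>q K k else 0)" for l
    by (simp add: E_Lop qs_diff_right)
  have "Lop k * ?S = ?S * Lop k"
  proof -
    consider "k = i" | "k = j" | "k \<noteq> i" "k \<noteq> j" by blast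
    then show ?thesis
    proof cases
      case 1
      have "Lop k * ?S = ?S * Lop k
          + gq (v i) (C i j) ?n *\<^sub>q (qad (v i) (C i j) (E i) (E j) (?n - 1) * (qdenom k *\<^sub>q K' k))"
        by (rule qad_commutator_base[where A' = "(- qdenom k) *\<^sub>q K k"])
          (use 1[symmetric] ij in \<open>simp_all add: L K_E K'_E powi_minus_C chi_diag v_nz mult.commute flip: chi_C\<close>)
      then show ?thesis
        using ij by (simp add: gq_Serre)
    next
      case 2
      have "Lop k * ?S = ?S * Lop k + (if ?n = 0 then qdenom k *\<^sub>q K' k else 0)
          + muq (v i) (C i j) ?n *\<^sub>q (E i ^ ?n * ((- qdenom k) *\<^sub>q K k))"
        by (rule qad_commutator_argument)
          (use 2[symmetric] ij in \<open>simp_all add: L K_E K'_E powi_minus_C v_nz mult.commute chi_sym[of k i] flip: chi_C\<close>)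
      then show ?thesis
        using ij C_le[OF ij] by (simp add: muq_zero)
    next
      case 3
      have "Lop k * ?S = ?S * Lop k
          + gq (v i) (C i j) ?n *\<^sub>q (qad (v i) (C i j) (E i) (E j) (?n - 1) * 0)"
        by (rule qad_commutator_base[where A' = 0]) (use 3 ij in \<open>simp_all add: L v_nz\<close>)
      then show ?thesis by simp
    qed
  qed
  then show "?S * Lop k = 1 *\<^sub>q (Lop k * ?S)" by simp
qed

definition Lop_word :: "nat list \<Rightarrow> 'q wfun rendo" where
  "Lop_word u = prod_list (map Lop u)"

lemma Lop_word_simps [simp]: "Lop_word [] = 1" "Lop_word (j # u) = Lop j * Lop_word u"
  by (simp_all add: Lop_word_def)

text \<open>The annihilator of the two-sided ideal generated by the Serre elements of the F_i: u is
  the left factor, the argument of the function the right one.\<close>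

definition serre_null :: "'q wfun set" where
  "serre_null = {\<phi>. \<forall>u. \<forall>i\<in>I. \<forall>j\<in>I. i \<noteq> j \<longrightarrow> \<phi> \<bullet> Lop_word u \<bullet> S i j = 0}"

lemma serre_null_D: "\<phi> \<in> serre_null \<Longrightarrow> i \<in> I \<Longrightarrow> j \<in> I \<Longrightarrow> i \<noteq> j \<Longrightarrow> \<phi> \<bullet> Lop_word u \<bullet> S i j = 0"
  by (simp add: serre_null_def)

lemma serre_null_add: "\<phi> \<in> serre_null \<Longrightarrow> \<psi> \<in> serre_null \<Longrightarrow> \<phi> + \<psi> \<in> serre_null"
  and serre_null_diff: "\<phi> \<in> serre_null \<Longrightarrow> \<psi> \<in> serre_null \<Longrightarrow> \<phi> - \<psi> \<in> serre_null"
  and serre_null_qs: "\<phi> \<in> serre_null \<Longrightarrow> c *\<^sub>q \<phi> \<in> serre_null"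
  by (simp_all add: serre_null_def app_add_left app_diff_left)

lemma serre_null_zero: "0 \<in> serre_null"
  by (simp add: serre_null_def)

lemma serre_null_Lop: "\<phi> \<in> serre_null \<Longrightarrow> \<phi> \<bullet> Lop k \<in> serre_null"
  using serre_null_D[of \<phi> _ _ "k # _"] by (simp add: serre_null_def)

lemma twist_Lop_word:
  assumes "\<And>j. D * Lop j = c j *\<^sub>q (Lop j * D)"
  shows "D * Lop_word u = prod_list (map c u) *\<^sub>q (Lop_word u * D)"
proof (induction u)
  case (Cons j u)
  have "D * Lop_word (j # u) = (D * Lop j) * Lop_word u" by (simp add: mult.assoc)
  also have "\<dots> = c j *\<^sub>q (Lop j * (D * Lop_word u))" by (simp add: assms mult.assoc)
  finally show ?case by (simp add: Cons.IH mult.assoc)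
qed simp

lemma twist_S:
  assumes "\<And>j. D * Lop j = c j *\<^sub>q (Lop j * D)"
  shows "D * S i j = (c j * c i ^ nat (1 - C i j)) *\<^sub>q (S i j * D)"
  unfolding S_def by (rule qad_twist[OF assms assms])

lemma serre_null_twist:
  assumes "\<And>j. D * Lop j = c j *\<^sub>q (Lop j * D)" and "\<phi> \<in> serre_null"
  shows "\<phi> \<bullet> D \<in> serre_null"
proof -
  have "\<phi> \<bullet> D \<bullet> Lop_word u \<bullet> S i j = 0" if ij: "i \<in> I" "j \<in> I" "i \<noteq> j" for u i j
  proof -
    have "\<phi> \<bullet> D \<bullet> Lop_word u \<bullet> S i j = \<phi> \<bullet> (D * Lop_word u * S i j)"
      by simp
    also have "D * Lop_word u * S i j = prod_list (map c u) *\<^sub>q (Lop_word u * (D * S i j))"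
      by (simp add: twist_Lop_word[OF assms(1)] mult.assoc)
    also have "\<dots> = (prod_list (map c u) * (c j * c i ^ nat (1 - C i j))) *\<^sub>q (Lop_word u * S i j * D)"
      by (simp add: twist_S[OF assms(1)] mult.assoc)
    finally show ?thesis
      using serre_null_D[OF assms(2) ij] by simp
  qed
  then show ?thesis by (simp add: serre_null_def)
qed

lemma serre_null_K: "\<phi> \<in> serre_null \<Longrightarrow> \<phi> \<bullet> K i \<in> serre_null"
  by (rule serre_null_twist[OF K_Lop])

lemma serre_null_K': "\<phi> \<in> serre_null \<Longrightarrow> \<phi> \<bullet> K' i \<in> serre_null"
  by (rule serre_null_twist[OF K'_Lop])

text \<open>Induction on u: E_k passes a letter up to K_k and K_k', under which the space is stable,
  and by \<open>E_S\<close> it commutes with the Serre element itself.\<close>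

lemma serre_null_E: "\<phi> \<in> serre_null \<Longrightarrow> \<phi> \<bullet> E k \<in> serre_null"
proof -
  have "\<phi> \<bullet> E k \<bullet> Lop_word u \<bullet> S i j = 0" if "\<phi> \<in> serre_null" and ij: "i \<in> I" "j \<in> I" "i \<noteq> j" for \<phi> u i j
    using \<open>\<phi> \<in> serre_null\<close>
  proof (induction u arbitrary: \<phi>)
    case Nil
    have "\<phi> \<bullet> S i j = 0"
      using serre_null_D[OF Nil ij, of "[]"] by simp
    moreover have "\<phi> \<bullet> E k \<bullet> S i j = \<phi> \<bullet> S i j \<bullet> E k"
      using E_S[OF ij, of k] by (metis app_mult)
    ultimately show ?case by simp
  next
    case (Cons l u)
    have "\<phi> \<bullet> E k \<bullet> Lop_word (l # u) \<bullet> S i j = \<phi> \<bullet> (E k * Lop l) \<bullet> Lop_word u \<bullet> S i j" by simp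
    also have "\<dots> = \<phi> \<bullet> Lop l \<bullet> E k \<bullet> Lop_word u \<bullet> S i j
        + (if k = l then qdenom k *\<^sub>q (\<phi> \<bullet> K k - \<phi> \<bullet> K' k) \<bullet> Lop_word u \<bullet> S i j else 0)"
      unfolding E_Lop by (simp add: app_add_left)
    also have "\<dots> = 0"
    proof -
      have "\<phi> \<bullet> Lop l \<bullet> E k \<bullet> Lop_word u \<bullet> S i j = 0"
        by (rule Cons.IH[OF serre_null_Lop[OF Cons.prems]])
      moreover have "qdenom k *\<^sub>q (\<phi> \<bullet> K k - \<phi> \<bullet> K' k) \<bullet> Lop_word u \<bullet> S i j = 0"
        by (rule serre_null_D[OF serre_null_qs[OF serre_null_diff[OF serre_null_K[OF Cons.prems] serre_null_K'[OF Cons.prems]]] ij])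
      ultimately show ?thesis by (simp only: add_0_right if_cancel)
    qed
    finally show ?case .
  qed
  then show "\<phi> \<in> serre_null \<Longrightarrow> \<phi> \<bullet> E k \<in> serre_null" by (simp add: serre_null_def)
qed

end


section \<open>The vacuum functional\<close>

lemma commute_mult:
  assumes "x * a = a * x" "x * b = b * (x :: 'r::semigroup_mult)"
  shows "x * (a * b) = a * b * x"
  using assms by (metis mult.assoc)

lemma twist_mult:
  assumes "a * m = c *\<^sub>q (m * a)" "b * m = m * (b :: 'r::qv_algebra)"
  shows "a * b * m = c *\<^sub>q (m * (a * b))"
proof -
  have "a * b * m = a * m * b" by (simp add: assms(2) mult.assoc)
  then show ?thesis by (simp add: assms(1) mult.assoc)
qed

lemma prod_list_ones [simp]: "(\<Prod>_\<leftarrow>u. 1 :: Qv) = 1"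
  by (induction u) simp_all

lemma app_commute: "a * b = b * a \<Longrightarrow> x \<bullet> a \<bullet> b = x \<bullet> b \<bullet> a"
  by (metis app_mult)

lemma app_commute2: "a * (b * c) = b * c * a \<Longrightarrow> x \<bullet> a \<bullet> b \<bullet> c = x \<bullet> b \<bullet> c \<bullet> a"
  by (metis app_mult)

text \<open>F_i and G_i stand for the sums of the x_k and of the x_k^{-1} with i_k = i. The quiver
  enters through \<open>twist\<close>, where s reflects the orientation of the edges between i and
  j.\<close>

locale torus_module = double_module +
  fixes B F G :: "nat \<Rightarrow> 'a"
  assumes B: "\<And>i. B i = F i + G i"
    and FG: "\<And>i. G i * F i = F i * G i"
    and kk: "\<And>i. kk i = (- inverse (v i) * (v i - inverse (v i))\<^sup>2) *\<^sub>q (F i * G i)"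
    and kk_B: "\<And>i j. kk i * B j = B j * kk i"
    and twist: "\<And>i j. i \<in> I \<Longrightarrow> j \<in> I \<Longrightarrow> i \<noteq> j \<Longrightarrow> \<exists>s. 0 \<le> s \<and> s \<le> - C i j \<and>
      F j * F i = v i powi (C i j + 2 * s) *\<^sub>q (F i * F j) \<and>
      F j * G i = v i powi (- (C i j + 2 * s)) *\<^sub>q (G i * F j) \<and>
      G j * F i = v i powi (- (C i j + 2 * s)) *\<^sub>q (F i * G j) \<and>
      G j * G i = v i powi (C i j + 2 * s) *\<^sub>q (G i * G j)"
begin

abbreviation Lm :: "'a \<Rightarrow> 'a wfun rendo" where
  "Lm b \<equiv> Dg (\<lambda>_. 1) b 0"

definition e :: "nat \<Rightarrow> 'a wfun rendo" where
  "e i = der i (qdenom i *\<^sub>q K i)"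

text \<open>The part of E_i K_i' in which the powers of t coming from K_i and K_i' cancel.\<close>

definition theta :: "nat \<Rightarrow> 'a wfun rendo" where
  "theta i = e i * K' i"

definition M :: "nat \<Rightarrow> 'a wfun rendo" where
  "M i = (chi i i * qdenom i) *\<^sub>q Dg (wt i) (kk i) 0"

text \<open>The counterpart of \<open>theta\<close> for right multiplication; \<open>M i\<close> is
  the defect with which \<open>theta i\<close> commutes with \<open>Rop i\<close>.\<close>

definition theta' :: "nat \<Rightarrow> 'a wfun rendo" where
  "theta' i = der i (M i)"

lemma e_Lop: "e i * Lop j = Lop j * e i + (if i = j then qdenom i *\<^sub>q K i else 0)"
  unfolding e_def by (rule der_Lop)

text \<open>The relation of the q-boson algebra, with constant term a multiple of left
  multiplication by \<open>kk i\<close>.\<close>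

lemma theta_Lop: "theta i * Lop j = chi i j *\<^sub>q (Lop j * theta i) + (if i = j then (chi i i * qdenom i) *\<^sub>q kk_op i else 0)"
proof -
  have "theta i * Lop j = chi i j *\<^sub>q (e i * Lop j * K' i)"
    by (simp add: theta_def K'_Lop mult.assoc)
  also have "\<dots> = chi i j *\<^sub>q (Lop j * theta i) + (if i = j then (chi i i * qdenom i) *\<^sub>q kk_op i else 0)"
    by (simp add: e_Lop distrib_right qs_add_right theta_def K_mult_K' mult.assoc)
  finally show ?thesis .
qed

lemma theta'_Lop: "theta' i * Lop j = Lop j * theta' i + (if i = j then M i else 0)"
  unfolding theta'_def by (rule der_Lop)

lemma M_Lop: "M i * Lop j = chi i j *\<^sub>q (Lop j * M i)"
  using Dg_Lop[of "wt i" j "chi i j" "kk i" 0] by (simp add: M_def mult.commute)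

lemma kk_op_Rop: "kk_op i * Rop j = Rop j * kk_op i"
  using Dg_Rop[of "\<lambda>_. 1" j 1 "kk i" 0] by (simp add: kk_op_def)

lemma theta_Nil [simp]: "(\<phi> \<bullet> theta i) [] = 0"
  by (simp add: theta_def e_def K'_def fun_eq_iff)

lemma theta'_Nil [simp]: "(\<phi> \<bullet> theta' i) [] = 0"
  by (simp add: theta'_def)

lemma Rop_Lop: "Rop j * Lop i = Lop i * Rop j" "Rop j * (Lop i * a) = Lop i * (Rop j * a)"
  by (simp_all add: Lop_Rop flip: mult.assoc)

text \<open>The constant terms of \<open>theta_Lop\<close> cancel in the difference of the two
  sides, which therefore q-commutes with the letters. It remains to compare values at the empty
  word, where \<open>Rop l\<close> followed by evaluation is \<open>Lop l\<close>.\<close>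

lemma theta_Rop: "theta i * Rop l = Rop l * theta i + (if i = l then M i else 0)"
proof -
  have "theta i * Rop l - Rop l * theta i - (if i = l then M i else 0) = 0" (is "?D = 0")
  proof (rule rendo_vacuum[where c = "chi i"])
    fix \<phi>
    have "(\<phi> \<bullet> theta i) [l] = (\<phi> \<bullet> (theta i * Lop l)) []" by simp
    also have "\<dots> = (if i = l then (chi i i * qdenom i) *\<^sub>q (\<phi> \<bullet> kk_op i) [] else 0)"
      unfolding theta_Lop by simp
    finally show "(\<phi> \<bullet> ?D) [] = 0"
      by (simp add: M_def kk_op_def fun_eq_iff)
  next
    fix j
    have "?D * Lop j = (theta i * Lop j) * Rop l - Rop l * (theta i * Lop j) - (if i = l then M i * Lop j else 0)"
      by (simp add: left_diff_distrib mult.assoc Rop_Lop)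
    also have "\<dots> = chi i j *\<^sub>q (Lop j * ?D)"
    proof -
      have "theta i * Lop j * Rop l - Rop l * (theta i * Lop j)
          = chi i j *\<^sub>q (Lop j * (theta i * Rop l)) - chi i j *\<^sub>q (Lop j * (Rop l * theta i))"
        unfolding theta_Lop
        by (simp add: distrib_left distrib_right kk_op_Rop Rop_Lop mult.assoc)
      then show ?thesis
        by (simp add: M_Lop right_diff_distrib qs_diff_right)
    qed
    finally show "?D * Lop j = chi i j *\<^sub>q (Lop j * ?D)" .
  qed
  then show ?thesis by (simp add: algebra_simps)
qed

lemma Lm_Lop: "Lm b * Lop j = Lop j * Lm b"
  using Dg_Lop[of "\<lambda>_. 1" j 1 b 0] by simp

lemma Lm_Rop: "Lm b * Rop j = Rop j * Lm b"
  using Dg_Rop[of "\<lambda>_. 1" j 1 b 0] by simp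

lemma Lm_der: "Lm b * A = A * Lm b \<Longrightarrow> Lm b * der i A = der i A * Lm b"
  using Dg_der[of "\<lambda>_. 1" "\<lambda>_. 1" i b 0 A] by simp

lemma Lm_theta:
  assumes "b * kk i = kk i * b"
  shows "Lm b * theta i = theta i * Lm b" "Lm b * theta' i = theta' i * Lm b"
proof -
  have "Lm b * K i = K i * Lm b" "Lm b * K' i = K' i * Lm b" and M: "Lm b * M i = M i * Lm b"
    by (simp_all add: K_def K'_def M_def Dg_mult assms)
  then have "Lm b * e i = e i * Lm b"
    unfolding e_def by (intro Lm_der) simp
  then show "Lm b * theta i = theta i * Lm b"
    using \<open>Lm b * K' i = K' i * Lm b\<close> unfolding theta_def by (rule commute_mult)
  show "Lm b * theta' i = theta' i * Lm b"
    unfolding theta'_def by (rule Lm_der[OF M])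
qed

lemma kk_op_theta': "kk_op i * theta' l = theta' l * kk_op i"
  unfolding kk_op_def by (rule Lm_theta(2)) (rule kk_comm)

lemma theta_M: "theta i * M l = chi i l *\<^sub>q (M l * theta i)"
proof -
  have "Dg (wt l) (kk l) 0 * e i = inverse (chi l i) *\<^sub>q (e i * Dg (wt l) (kk l) 0)"
    unfolding e_def by (rule Dg_der) (simp_all add: K_def Dg_mult kk_comm mult.commute)
  then have "e i * M l = chi i l *\<^sub>q (M l * e i)"
    by (simp add: M_def chi_sym[of l i] field_simps)
  moreover have "K' i * M l = M l * K' i"
    by (simp add: K'_def M_def Dg_mult mult.commute)
  ultimately show ?thesis
    unfolding theta_def by (rule twist_mult)
qed

lemma theta_theta': "theta i * theta' l = theta' l * theta i"
proof -
  have "theta i * theta' l - theta' l * theta i = 0" (is "?D = 0")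
  proof (rule rendo_vacuum[where c = "chi i"])
    fix \<phi> show "(\<phi> \<bullet> ?D) [] = 0" by simp
  next
    fix j
    have 1: "theta i * (theta' l * Lop j) = (theta i * Lop j) * theta' l + (if l = j then theta i * M l else 0)"
      by (simp add: theta'_Lop distrib_left mult.assoc)
    have 2: "theta' l * (theta i * Lop j)
        = chi i j *\<^sub>q ((theta' l * Lop j) * theta i) + (if i = j then (chi i i * qdenom i) *\<^sub>q (theta' l * kk_op i) else 0)"
      by (simp add: theta_Lop distrib_left mult.assoc)
    have "?D * Lop j = theta i * (theta' l * Lop j) - theta' l * (theta i * Lop j)"
      by (simp add: left_diff_distrib mult.assoc)
    also have "\<dots> = chi i j *\<^sub>q (Lop j * ?D)"
      unfolding 1 2 unfolding theta_Lop theta'_Lop theta_M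
      by (simp add: distrib_right right_diff_distrib qs_distribs kk_op_theta' mult.assoc)
    finally show "?D * Lop j = chi i j *\<^sub>q (Lop j * ?D)" .
  qed
  then show ?thesis by simp
qed

lemma Rm_theta: "Rm b * theta i = theta i * Rm b" "Rm b * theta' i = theta' i * Rm b"
proof -
  have "Rm b * K i = K i * Rm b" "Rm b * K' i = K' i * Rm b" "Rm b * M i = M i * Rm b"
    by (simp_all add: K_def K'_def M_def Rm_comm)
  then have "Rm b * e i = e i * Rm b" "Rm b * K' i = K' i * Rm b"
    unfolding e_def by (simp_all add: Rm_der)
  then show "Rm b * theta i = theta i * Rm b"
    unfolding theta_def by (rule commute_mult)
  show "Rm b * theta' i = theta' i * Rm b"
    unfolding theta'_def by (rule Rm_der) fact
qed

section \<open>Locality of the derivations and the construction of \<open>Psi\<close>\<close>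

lemma theta_local:
  assumes "\<And>u. length u < length w \<Longrightarrow> \<phi> u = 0"
  shows "(\<phi> \<bullet> theta i) w = 0" "(\<phi> \<bullet> theta' i) w = 0"
proof -
  have "(\<phi> \<bullet> e i) w = 0"
    unfolding e_def by (rule der_local[OF _ assms]) (simp_all add: K_def fun_eq_iff)
  then show "(\<phi> \<bullet> theta i) w = 0"
    by (simp add: theta_def K'_def fun_eq_iff)
  show "(\<phi> \<bullet> theta' i) w = 0"
    unfolding theta'_def by (rule der_local[OF _ assms]) (simp_all add: M_def fun_eq_iff)
qed

text \<open>K_i and K_i' shift the exponent of t in opposite directions.\<close>

lemma theta_degree:
  assumes "\<And>w. \<phi> w s = 0"
  shows "(\<phi> \<bullet> theta i) w s = 0"
proof -
  have "(\<phi> \<bullet> e i) w (s + 1) = 0"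
    unfolding e_def
    by (rule der_vanish[where P = "{\<phi>. \<forall>w. \<phi> w s = 0}"]) (simp_all add: K_def assms)
  then show ?thesis
    by (simp add: theta_def K'_def)
qed

text \<open>\<open>theta\<close> takes a whole function as argument, so the recursion runs over
  stages: stage m is correct on words of length at most m.\<close>

primrec psi_approx :: "nat \<Rightarrow> 'a wfun" where
  "psi_approx 0 = (\<lambda>w n. if w = [] \<and> n = 0 then 1 else 0)"
| "psi_approx (Suc m) = (\<lambda>w n. case w of [] \<Rightarrow> (if n = 0 then 1 else 0)
     | i # u \<Rightarrow> B i * psi_approx m u n - (psi_approx m \<bullet> theta i) u n)"

definition Psi :: "'a wfun" where
  "Psi w = psi_approx (length w) w"

lemma theta_cong:
  assumes "\<And>u. length u < length w \<Longrightarrow> \<phi> u = \<psi> u"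
  shows "(\<phi> \<bullet> theta i) w = (\<psi> \<bullet> theta i) w"
proof -
  have "((\<phi> - \<psi>) \<bullet> theta i) w = 0"
    by (rule theta_local) (simp add: assms)
  then show ?thesis by (simp add: app_diff_left)
qed

lemma psi_approx_Suc: "length w \<le> m \<Longrightarrow> psi_approx (Suc m) w = psi_approx m w"
proof (induction m arbitrary: w)
  case (Suc m)
  show ?case
  proof (cases w)
    case (Cons i u)
    then have u: "length u \<le> m" using Suc.prems by simp
    have "(psi_approx (Suc m) \<bullet> theta i) u = (psi_approx m \<bullet> theta i) u"
      by (rule theta_cong, rule Suc.IH) (use u in simp)
    moreover have "psi_approx (Suc m) u = psi_approx m u"
      by (rule Suc.IH[OF u])
    moreover have "psi_approx (Suc m') w = (\<lambda>n. B i * psi_approx m' u n - (psi_approx m' \<bullet> theta i) u n)" for m'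
      by (simp only: Cons psi_approx.simps(2)[of m'] list.case)
    ultimately show ?thesis by metis
  qed simp
qed simp

lemma psi_approx_eq: "length w \<le> m \<Longrightarrow> psi_approx m w = Psi w"
proof (induction m)
  case (Suc m)
  show ?case
  proof (cases "length w \<le> m")
    case True
    then show ?thesis using Suc.IH psi_approx_Suc by metis
  next
    case False
    then have "length w = Suc m" using Suc.prems by simp
    then show ?thesis by (simp add: Psi_def)
  qed
qed (simp add: Psi_def)

lemma Psi_Nil: "Psi [] n = (if n = 0 then 1 else 0)"
  by (simp add: Psi_def)

lemma Psi_Lop: "Psi \<bullet> Lop i = Psi \<bullet> Lm (B i) - Psi \<bullet> theta i"
proof (intro ext)
  fix u n
  have "Psi (i # u) n = B i * psi_approx (length u) u n - (psi_approx (length u) \<bullet> theta i) u n"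
    by (simp add: Psi_def)
  also have "(psi_approx (length u) \<bullet> theta i) u = (Psi \<bullet> theta i) u"
    by (rule theta_cong) (simp add: psi_approx_eq)
  finally show "(Psi \<bullet> Lop i) u n = (Psi \<bullet> Lm (B i) - Psi \<bullet> theta i) u n"
    by (simp add: psi_approx_eq)
qed

lemma Psi_degree: "n \<noteq> 0 \<Longrightarrow> Psi w n = 0"
proof -
  assume n: "n \<noteq> 0"
  have "psi_approx m w n = 0" for m w
    using n by (induction m arbitrary: w) (simp_all add: theta_degree split: list.split)
  then show ?thesis by (simp add: Psi_def)
qed

text \<open>By \<open>theta_local\<close> the equation expresses the value at a word through values
  at shorter words.\<close>

lemma left_unique:
  assumes "\<chi> [] = 0" "\<And>i. \<chi> \<bullet> Lop i = \<chi> \<bullet> Lm (B i) - \<chi> \<bullet> theta i"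
  shows "\<chi> = 0"
proof -
  have "\<chi> w = 0" for w
  proof (induction w rule: length_induct)
    case (1 w)
    show ?case
    proof (cases w)
      case (Cons i u)
      have "\<chi> u = 0" "(\<chi> \<bullet> theta i) u = 0"
        using 1 Cons by (auto intro!: theta_local)
      moreover have "\<chi> w = (\<chi> \<bullet> Lop i) u" using Cons by simp
      ultimately show ?thesis
        unfolding assms(2) by (simp add: fun_eq_iff)
    qed (simp add: assms)
  qed
  then show ?thesis by (simp add: fun_eq_iff)
qed

lemma right_unique:
  assumes "\<chi> [] = 0" "\<And>i. \<chi> \<bullet> Rop i = \<chi> \<bullet> Rm (B i) - \<chi> \<bullet> theta' i"
  shows "\<chi> = 0"
proof -
  have "\<chi> w = 0" for w
  proof (induction w rule: length_induct)
    case (1 w)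
    show ?case
    proof (cases w rule: rev_cases)
      case (snoc u i)
      have "\<chi> u = 0" "(\<chi> \<bullet> theta' i) u = 0"
        using 1 snoc by (auto intro!: theta_local)
      moreover have "\<chi> w = (\<chi> \<bullet> Rop i) u" using snoc by simp
      ultimately show ?thesis
        unfolding assms(2) by (simp add: fun_eq_iff)
    qed (simp add: assms)
  qed
  then show ?thesis by (simp add: fun_eq_iff)
qed

text \<open>
  \<open>Lop i + theta i\<close> and \<open>Rop l + theta' l\<close> are left and right multiplication by the generators of
  the \<open>\<imath>\<close>quantum group, transported to words; hence they commute.
\<close>

lemma left_right_comm: "(Lop i + theta i) * (Rop l + theta' l) = (Rop l + theta' l) * (Lop i + theta i)"
  \<comment> \<open>The defects \<open>M\<close> in \<open>theta_Rop\<close> and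
    \<open>theta'_Lop\<close> cancel.\<close>
  by (simp add: distrib_left distrib_right Lop_Rop theta_Rop theta_theta' theta'_Lop)

text \<open>The difference \<chi> of the two sides solves the left recursion, because left and right
  operators commute, and it vanishes at the empty word. Hence it is 0 by
  \<open>left_unique\<close>.\<close>

lemma Psi_Rop: "Psi \<bullet> Rop l = Psi \<bullet> Rm (B l) - Psi \<bullet> theta' l"
proof -
  define \<chi> where "\<chi> = Psi \<bullet> (Rop l + theta' l - Rm (B l))"
  have "\<chi> = 0"
  proof (rule left_unique)
    have "Psi [l] = (Psi \<bullet> Lop l) []" by simp
    then have "Psi [l] = (Psi \<bullet> Lm (B l)) []" unfolding Psi_Lop by simp
    then show "\<chi> [] = 0"
      by (simp add: \<chi>_def fun_eq_iff Psi_Nil)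
  next
    fix i
    have "\<chi> \<bullet> (Lop i + theta i) = Psi \<bullet> ((Rop l + theta' l - Rm (B l)) * (Lop i + theta i))"
      by (simp add: \<chi>_def)
    also have "(Rop l + theta' l - Rm (B l)) * (Lop i + theta i) = (Lop i + theta i) * (Rop l + theta' l - Rm (B l))"
      unfolding left_diff_distrib right_diff_distrib left_right_comm
      by (simp add: distrib_left distrib_right Rm_comm Rm_theta)
    also have "Psi \<bullet> \<dots> = (Psi \<bullet> Lop i + Psi \<bullet> theta i) \<bullet> (Rop l + theta' l - Rm (B l))"
      by simp
    also have "\<dots> = Psi \<bullet> (Lm (B i) * (Rop l + theta' l - Rm (B l)))"
      unfolding Psi_Lop by simp
    also have "Lm (B i) * (Rop l + theta' l - Rm (B l)) = (Rop l + theta' l - Rm (B l)) * Lm (B i)"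
      by (simp add: distrib_left distrib_right left_diff_distrib right_diff_distrib
          Lm_Rop Lm_theta kk_B Rm_comm)
    finally have "\<chi> \<bullet> (Lop i + theta i) = \<chi> \<bullet> Lm (B i)"
      by (simp only: \<chi>_def app_mult)
    then show "\<chi> \<bullet> Lop i = \<chi> \<bullet> Lm (B i) - \<chi> \<bullet> theta i"
      by (simp only: app_add eq_diff_eq)
  qed
  then show ?thesis
    by (simp only: \<chi>_def app_add app_diff eq_diff_eq right_minus_eq)
qed


section \<open>Vanishing of \<open>Psi\<close> on the Serre ideal\<close>

lemma theta'_S:
  assumes "i \<in> I" "j \<in> I" "i \<noteq> j"
  shows "theta' l * S i j = S i j * theta' l"
  using der_S[OF assms, of 0 l "M l"] by (simp add: theta'_def M_Lop)

lemma theta_S: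
  assumes ij: "i \<in> I" "j \<in> I" "i \<noteq> j"
  obtains c where "theta l * S i j = c *\<^sub>q (S i j * theta l)"
proof -
  have e: "e l * S i j = S i j * e l"
    using der_S[OF ij, of "qdenom l *\<^sub>q K l" l 0] by (simp add: e_def K_Lop mult.commute)
  obtain c where c: "K' l * S i j = c *\<^sub>q (S i j * K' l)"
    using twist_S[OF K'_Lop] by blast
  have "theta l * S i j = e l * (K' l * S i j)"
    by (simp add: theta_def mult.assoc)
  also have "\<dots> = c *\<^sub>q (e l * S i j * K' l)"
    by (simp add: c mult.assoc)
  also have "\<dots> = c *\<^sub>q (S i j * theta l)"
    by (simp add: e theta_def mult.assoc)
  finally show ?thesis by (rule that)
qed

text \<open>Let y_n be the value of \<open>Psi\<close> on the n-fold bracket. A first letter F_i is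
  removed by the left recursion and a last one by the right recursion; both produce B_i, and the
  commutator of \<open>theta\<close> with the bracket adds a term in y_{n-1}. As \<open>kk i\<close>
  is a multiple of F_i G_i, this is the recursion of
  \<open>serre_recursion_vanishes\<close>.\<close>

lemma Psi_S_Nil:
  assumes ij: "i \<in> I" "j \<in> I" "i \<noteq> j"
  shows "(Psi \<bullet> S i j) [] t = 0"
proof -
  let ?Y = "qad (v i) (C i j) (Lop i) (Lop j)"
  define y where "y n = (Psi \<bullet> ?Y n) [] t" for n
  \<comment> \<open>The value of \<open>Psi\<close> at the empty word; with it one argument covers
    all exponents t.\<close>
  define \<epsilon> :: 'a where "\<epsilon> = (if t = 0 then 1 else 0)"
  note v = v_nz[OF ij(1)]
  have root2: "v i - inverse (v i) \<noteq> 0"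
    using v v_root[OF ij(1), of 2] by (simp add: field_simps power2_eq_square)
  obtain s where s: "0 \<le> s" "s \<le> - C i j"
    and tw: "F j * F i = v i powi (C i j + 2 * s) *\<^sub>q (F i * F j)"
      "F j * G i = v i powi (- (C i j + 2 * s)) *\<^sub>q (G i * F j)"
      "G j * F i = v i powi (- (C i j + 2 * s)) *\<^sub>q (F i * G j)"
      "G j * G i = v i powi (C i j + 2 * s) *\<^sub>q (G i * G j)"
    using twist[OF ij] by blast
  \<comment> \<open>The defect \<open>M i\<close> twists like K_i', so the commutator formula
    applies with A = 0 and leaves no correction.\<close>
  have theta': "theta' i * ?Y n = ?Y n * theta' i" for n
  proof -
    have "theta' i * ?Y n = ?Y n * theta' i + gq (v i) (C i j) n *\<^sub>q (?Y (n - 1) * 0)"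
      by (rule qad_commutator_base[where A' = "M i"])
        (use ij in \<open>simp_all add: theta'_Lop M_Lop v chi_diag flip: chi_C\<close>)
    then show ?thesis by simp
  qed
  define ex where "ex n = v i powi (C i j + 2 * int n)" for n
  have theta: "theta i * ?Y n = ex n *\<^sub>q (?Y n * theta i) + (ex n * gq (v i) (C i j) n * qdenom i) *\<^sub>q (?Y (n - 1) * kk_op i)" for n
  proof -
    have e: "e i * ?Y n = ?Y n * e i + gq (v i) (C i j) n *\<^sub>q (?Y (n - 1) * (qdenom i *\<^sub>q K i))"
      by (rule qad_commutator_base[where A' = 0])
        (use ij in \<open>simp_all add: e_Lop K_Lop v chi_diag powi_minus_C mult.commute\<close>)
    have "K' i * ?Y n = (chi i j * chi i i ^ n) *\<^sub>q (?Y n * K' i)"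
      by (rule qad_twist) (rule K'_Lop)+
    also have "chi i j * chi i i ^ n = ex n"
      using ij v by (simp add: ex_def chi_C chi_diag power_int_add power_int_mult)
    finally have "theta i * ?Y n = ex n *\<^sub>q (e i * ?Y n * K' i)"
      by (simp add: theta_def mult.assoc)
    then show ?thesis
      unfolding e by (simp add: distrib_right qs_add_right theta_def K_mult_K' mult.assoc)
  qed
  have "y (nat (1 - C i j)) = 0"
  proof (rule serre_recursion_vanishes[where q = "v i" and s = s and F = "F i" and G = "G i"
        and X = "\<epsilon> * F j" and X' = "\<epsilon> * G j"])
    have "(Psi \<bullet> Lop j) [] t = B j * \<epsilon>"
      unfolding Psi_Lop by (simp add: Psi_Nil \<epsilon>_def)
    then show "y 0 = \<epsilon> * F j + \<epsilon> * G j"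
      by (simp add: y_def B \<epsilon>_def distrib_right)
  next
    fix n
    have left: "(Psi \<bullet> Lop i \<bullet> ?Y n) [] t = B i * y n
        - (ex n * gq (v i) (C i j) n * qdenom i) *\<^sub>q (kk i * y (n - 1))"
    proof -
      have "Lm (B i) * ?Y n = ?Y n * Lm (B i)"
        using qad_twist[of "Lm (B i)" "Lop i" 1 "Lop j" 1] by (simp add: Lm_Lop)
      then have "Psi \<bullet> Lm (B i) \<bullet> ?Y n = Psi \<bullet> ?Y n \<bullet> Lm (B i)"
        by (rule app_commute)
      moreover have "Psi \<bullet> theta i \<bullet> ?Y n
          = ex n *\<^sub>q (Psi \<bullet> ?Y n \<bullet> theta i) + (ex n * gq (v i) (C i j) n * qdenom i) *\<^sub>q (Psi \<bullet> ?Y (n - 1) \<bullet> kk_op i)"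
        using arg_cong[OF theta[of n], of "\<lambda>a. Psi \<bullet> a"] by (simp only: app_mult app_add app_qs)
      ultimately have "Psi \<bullet> Lop i \<bullet> ?Y n = Psi \<bullet> ?Y n \<bullet> Lm (B i) - (ex n *\<^sub>q (Psi \<bullet> ?Y n \<bullet> theta i)
          + (ex n * gq (v i) (C i j) n * qdenom i) *\<^sub>q (Psi \<bullet> ?Y (n - 1) \<bullet> kk_op i))"
        unfolding Psi_Lop app_diff_left by simp
      then show ?thesis
        by (simp only: minus_apply plus_fun_apply qs_fun_apply theta_Nil) (simp add: y_def kk_op_def)
    qed
    \<comment> \<open>At the empty word \<open>Lop i\<close> and \<open>Rop i\<close> agree, and
      \<open>Rop i\<close> commutes with the bracket.\<close>
    have right: "(Psi \<bullet> ?Y n \<bullet> Lop i) [] t = y n * B i"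
    proof -
      have "Rop i * ?Y n = ?Y n * Rop i"
        using qad_twist[of "Rop i" "Lop i" 1 "Lop j" 1] by (simp add: Lop_Rop)
      then have "Psi \<bullet> ?Y n \<bullet> Rop i = Psi \<bullet> Rop i \<bullet> ?Y n"
        by (rule app_commute[symmetric])
      also have "\<dots> = Psi \<bullet> Rm (B i) \<bullet> ?Y n - Psi \<bullet> theta' i \<bullet> ?Y n"
        unfolding Psi_Rop app_diff_left ..
      also have "Psi \<bullet> Rm (B i) \<bullet> ?Y n = Psi \<bullet> ?Y n \<bullet> Rm (B i)"
        using qad_twist[of "Rm (B i)" "Lop i" 1 "Lop j" 1] by (intro app_commute) (simp add: Rm_comm)
      also have "Psi \<bullet> theta' i \<bullet> ?Y n = Psi \<bullet> ?Y n \<bullet> theta' i"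
        by (rule app_commute[OF theta'])
      finally have eq: "Psi \<bullet> ?Y n \<bullet> Rop i = Psi \<bullet> ?Y n \<bullet> Rm (B i) - Psi \<bullet> ?Y n \<bullet> theta' i" .
      have "(Psi \<bullet> ?Y n \<bullet> Lop i) [] t = (Psi \<bullet> ?Y n \<bullet> Rop i) [] t"
        by simp
      also have "\<dots> = y n * B i"
        unfolding eq by (simp add: y_def)
      finally show ?thesis .
    qed
    have "y (Suc n) = (Psi \<bullet> Lop i \<bullet> ?Y n) [] t - ex n *\<^sub>q (Psi \<bullet> ?Y n \<bullet> Lop i) [] t"
      by (simp only: y_def qad.simps app_diff app_mult app_qs minus_apply qs_fun_apply ex_def)
    also have "\<dots> = B i * y n - ex n *\<^sub>q (y n * B i) - (ex n * gq (v i) (C i j) n * qdenom i) *\<^sub>q (kk i * y (n - 1))"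
      unfolding left right by simp
    \<comment> \<open>The normalisation -v_i^{-1} (v_i - v_i^{-1})^2 of \<open>kk i\<close> turns
      the coefficient into the product of \<open>gq_closed\<close>.\<close>
    also have "(ex n * gq (v i) (C i j) n * qdenom i) *\<^sub>q (kk i * y (n - 1))
        = ((1 - v i ^ (2 * n)) * (1 - v i powi (2 * C i j + 2 * int n - 2))) *\<^sub>q (F i * G i * y (n - 1))"
    proof -
      have "ex n * gq (v i) (C i j) n * qdenom i * (- inverse (v i) * (v i - inverse (v i))\<^sup>2)
          = - ((v i - inverse (v i)) * (ex n / v i) * gq (v i) (C i j) n)"
        using root2 by (simp add: qdenom_def power2_eq_square divide_inverse mult_ac)
      also have "ex n / v i = v i powi (C i j + 2 * int n - 1)"
        using v by (simp add: ex_def power_int_diff)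
      finally have "ex n * gq (v i) (C i j) n * qdenom i * (- inverse (v i) * (v i - inverse (v i))\<^sup>2)
          = (1 - v i ^ (2 * n)) * (1 - v i powi (2 * C i j + 2 * int n - 2))"
        unfolding gq_closed[OF v] by simp
      then show ?thesis
        unfolding kk by (simp only: qs_mult_left qs_qs)
    qed
    finally show "y (Suc n) = (F i + G i) * y n - v i powi (C i j + 2 * int n) *\<^sub>q (y n * (F i + G i))
       - ((1 - v i ^ (2 * n)) * (1 - v i powi (2 * C i j + 2 * int n - 2))) *\<^sub>q (F i * G i * y (n - 1))"
      by (simp add: B ex_def)
  qed (use v v_root[OF ij(1)] C_le[OF ij] s FG tw in \<open>simp_all add: \<epsilon>_def\<close>)
  then show ?thesis by (simp add: y_def S_def)
qed

text \<open>Right multiplications and \<open>theta'\<close> commute with \<open>S i j\<close>, so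
  \<open>Psi \<bullet> S i j\<close> inherits the right recursion of \<open>Psi\<close>; its value
  at the empty word is 0.\<close>

lemma Psi_S:
  assumes ij: "i \<in> I" "j \<in> I" "i \<noteq> j"
  shows "Psi \<bullet> S i j = 0"
proof (rule right_unique)
  show "(Psi \<bullet> S i j) [] = 0"
    by (rule ext) (simp add: Psi_S_Nil[OF ij])
next
  fix l
  have 1: "Rop l * S i j = S i j * Rop l" "Rm (B l) * S i j = S i j * Rm (B l)"
    using twist_S[of "Rop l" "\<lambda>_. 1" i j] twist_S[of "Rm (B l)" "\<lambda>_. 1" i j]
    by (simp_all add: Rm_comm Lop_Rop)
  have "Psi \<bullet> S i j \<bullet> Rop l = Psi \<bullet> Rop l \<bullet> S i j"
    by (rule app_commute[OF 1(1), symmetric])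
  also have "\<dots> = Psi \<bullet> Rm (B l) \<bullet> S i j - Psi \<bullet> theta' l \<bullet> S i j"
    unfolding Psi_Rop app_diff_left ..
  also have "Psi \<bullet> Rm (B l) \<bullet> S i j = Psi \<bullet> S i j \<bullet> Rm (B l)"
    by (rule app_commute[OF 1(2)])
  also have "Psi \<bullet> theta' l \<bullet> S i j = Psi \<bullet> S i j \<bullet> theta' l"
    by (rule app_commute[OF theta'_S[OF ij]])
  finally show "Psi \<bullet> S i j \<bullet> Rop l = Psi \<bullet> S i j \<bullet> Rm (B l) - Psi \<bullet> S i j \<bullet> theta' l" .
qed

text \<open>Moved to the right, \<open>theta l\<close> passes each letter up to a scalar or replaces
  it by \<open>kk_op l\<close>, which shortens u and commutes with what follows. Past the Serre
  element it only picks up a scalar.\<close>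

lemma theta_Lop_word_S:
  assumes ij: "i \<in> I" "j \<in> I" "i \<noteq> j"
    and "\<And>u'. length u' \<le> length u \<Longrightarrow> \<phi> \<bullet> Lop_word u' \<bullet> S i j = 0"
  shows "\<phi> \<bullet> theta l \<bullet> Lop_word u \<bullet> S i j = 0"
  using assms(4)
proof (induction u arbitrary: \<phi>)
  case Nil
  obtain c where c: "theta l * S i j = c *\<^sub>q (S i j * theta l)"
    using theta_S[OF ij] .
  have "\<phi> \<bullet> S i j = 0"
    using Nil[of "[]"] by simp
  moreover have "\<phi> \<bullet> theta l \<bullet> S i j = c *\<^sub>q (\<phi> \<bullet> S i j \<bullet> theta l)"
    using arg_cong[OF c, of "\<lambda>a. \<phi> \<bullet> a"] by (simp only: app_mult app_qs)
  ultimately show ?case by simp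
next
  case (Cons k u)
  have kk_op: "kk_op l * (Lop_word u * S i j) = Lop_word u * S i j * kk_op l"
    using twist_Lop_word[of "kk_op l" "\<lambda>_. 1" u] twist_S[of "kk_op l" "\<lambda>_. 1" i j]
    by (intro commute_mult) (simp_all add: kk_op_Lop)
  have 1: "\<phi> \<bullet> Lop k \<bullet> theta l \<bullet> Lop_word u \<bullet> S i j = 0"
  proof (rule Cons.IH)
    fix u' :: "nat list" assume "length u' \<le> length u"
    then have "\<phi> \<bullet> Lop_word (k # u') \<bullet> S i j = 0"
      by (intro Cons.prems) simp
    then show "\<phi> \<bullet> Lop k \<bullet> Lop_word u' \<bullet> S i j = 0"
      by (simp only: Lop_word_simps app_mult)
  qed
  have 2: "\<phi> \<bullet> kk_op l \<bullet> Lop_word u \<bullet> S i j = 0"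
  proof -
    have "\<phi> \<bullet> Lop_word u \<bullet> S i j = 0"
      by (rule Cons.prems) simp
    moreover have "\<phi> \<bullet> kk_op l \<bullet> Lop_word u \<bullet> S i j = \<phi> \<bullet> Lop_word u \<bullet> S i j \<bullet> kk_op l"
      using kk_op by (rule app_commute2)
    ultimately show ?thesis by simp
  qed
  have "\<phi> \<bullet> theta l \<bullet> Lop_word (k # u) \<bullet> S i j = \<phi> \<bullet> (theta l * Lop k) \<bullet> Lop_word u \<bullet> S i j"
    by (simp only: Lop_word_simps app_mult)
  also have "\<dots> = 0"
    unfolding theta_Lop using 1 2 by (cases "l = k") (simp_all add: app_add_left del: app_Lop)
  finally show ?case .
qed

lemma Psi_in_serre_null: "Psi \<in> serre_null"
proof -
  have "Psi \<bullet> Lop_word u \<bullet> S i j = 0" if ij: "i \<in> I" "j \<in> I" "i \<noteq> j" for u i j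
  proof (induction u rule: length_induct)
    case (1 u)
    show ?case
    proof (cases u)
      case Nil
      then show ?thesis using Psi_S[OF ij] by simp
    next
      case (Cons k u')
      have "Lm (B k) * (Lop_word u' * S i j) = Lop_word u' * S i j * Lm (B k)"
        using twist_Lop_word[of "Lm (B k)" "\<lambda>_. 1" u'] twist_S[of "Lm (B k)" "\<lambda>_. 1" i j]
        by (intro commute_mult) (simp_all add: Lm_Lop)
      then have "Psi \<bullet> Lm (B k) \<bullet> Lop_word u' \<bullet> S i j = Psi \<bullet> Lop_word u' \<bullet> S i j \<bullet> Lm (B k)"
        by (rule app_commute2)
      moreover have "Psi \<bullet> Lop_word u' \<bullet> S i j = 0"
        using 1 Cons by simp
      moreover have "Psi \<bullet> theta k \<bullet> Lop_word u' \<bullet> S i j = 0"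
        by (rule theta_Lop_word_S[OF ij]) (use 1 Cons in simp)
      ultimately show ?thesis
        unfolding Cons Lop_word_simps app_mult Psi_Lop app_diff_left by simp
    qed
  qed
  then show ?thesis by (simp add: serre_null_def)
qed

text \<open>Reading the value at -m as the coefficient of t^m, \<phi> is a power series in t with
  constant term \<sigma> \<open>Psi\<close>. Since \<sigma> commutes with the \<open>kk i\<close>,
  left multiplication by \<sigma> commutes with \<open>theta\<close>.\<close>

definition good :: "'a \<Rightarrow> 'a wfun \<Rightarrow> bool" where
  "good \<sigma> \<phi> \<longleftrightarrow> \<phi> \<in> serre_null \<and> (\<forall>w n. n > 0 \<longrightarrow> \<phi> w n = 0) \<and> (\<forall>w. \<phi> w 0 = \<sigma> * Psi w 0) \<and>
    (\<forall>i. \<sigma> * kk i = kk i * \<sigma>)"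

lemma good_Psi: "good 1 Psi"
  by (simp add: good_def Psi_in_serre_null Psi_degree)

text \<open>\<open>Psi\<close> is 1 at the empty word, so \<sigma> can be read off there.\<close>

lemma good_zero: "good \<sigma> 0 \<Longrightarrow> \<sigma> = 0"
  by (simp add: good_def) (metis Psi_Nil mult.right_neutral)

lemma good_add: "good \<sigma> \<phi> \<Longrightarrow> good \<tau> \<psi> \<Longrightarrow> good (\<sigma> + \<tau>) (\<phi> + \<psi>)"
  by (simp add: good_def serre_null_add distrib_left distrib_right)

lemma good_qs: "good \<sigma> \<phi> \<Longrightarrow> good (c *\<^sub>q \<sigma>) (c *\<^sub>q \<phi>)"
  by (simp add: good_def serre_null_qs)

lemma good_kk_op:
  assumes "good \<sigma> \<phi>"
  shows "good (\<sigma> * kk i) (\<phi> \<bullet> (K i * K' i))"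
proof -
  have "\<sigma> * (kk i * x) = kk i * (\<sigma> * x)" for x
    using assms by (simp add: good_def flip: mult.assoc)
  moreover have "\<phi> \<bullet> kk_op i \<in> serre_null"
    using assms serre_null_K serre_null_K' by (simp add: good_def flip: K_mult_K')
  moreover have "\<sigma> * kk i * kk j = kk j * (\<sigma> * kk i)" for j
  proof -
    have "\<sigma> * kk j = kk j * \<sigma>"
      using assms by (simp add: good_def)
    then show ?thesis
      by (metis kk_comm mult.assoc)
  qed
  ultimately show ?thesis
    using assms unfolding K_mult_K' by (simp add: good_def kk_op_def mult.assoc)
qed

text \<open>E_i K_i' is the sum of \<open>theta i\<close> and a part containing K_i' twice, which
  carries t^2 and does not reach the constant term. At t = 0 there remains
  \<open>Lop i + theta i\<close>, which takes \<sigma> \<open>Psi\<close> to \<sigma> B_i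
  \<open>Psi\<close>.\<close>

lemma good_B:
  assumes g: "good \<sigma> \<phi>"
  shows "good (\<sigma> * B i) (\<phi> \<bullet> (Lop i + E i * K' i))"
proof -
  have pos: "\<phi> w n = 0" if "n > 0" for w n
    using g that by (simp add: good_def)
  define e2 where "e2 = der i ((- qdenom i) *\<^sub>q K' i)"
  have E: "E i * K' i = theta i + e2 * K' i"
  proof -
    have "E i = e i + e2"
      by (simp add: E_def e_def e2_def qs_diff_right flip: der_add)
    then show ?thesis by (simp add: theta_def distrib_right)
  qed
  have e2: "(\<phi> \<bullet> (e2 * K' i)) w n = 0" if "n \<ge> 0" for w n
  proof -
    have "(\<phi> \<bullet> e2) w (n + 1) = 0"
      unfolding e2_def
      by (rule der_vanish[where P = "{\<phi>. \<forall>w n. n > 0 \<longrightarrow> \<phi> w n = 0}"])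
        (use that in \<open>simp_all add: K'_def pos\<close>)
    then show ?thesis by (simp add: K'_def)
  qed
  have theta_pos: "(\<phi> \<bullet> theta i) w n = 0" if "n > 0" for w n
    by (rule theta_degree) (rule pos[OF that])
  have theta_0: "(\<phi> \<bullet> theta i) w 0 = \<sigma> * (Psi \<bullet> theta i) w 0" for w
  proof -
    \<comment> \<open>The difference has no term of exponent 0, and \<open>theta\<close> preserves
      exponents.\<close>
    have "((\<phi> - Psi \<bullet> Lm \<sigma>) \<bullet> theta i) w 0 = 0"
      by (rule theta_degree) (use g in \<open>simp add: good_def\<close>)
    then have "(\<phi> \<bullet> theta i) w 0 = (Psi \<bullet> (Lm \<sigma> * theta i)) w 0"
      by (simp add: app_diff_left)
    also have "Lm \<sigma> * theta i = theta i * Lm \<sigma>"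
      using g by (intro Lm_theta) (simp add: good_def)
    finally show ?thesis by simp
  qed
  have Psi0: "Psi (i # w) 0 = B i * Psi w 0 - (Psi \<bullet> theta i) w 0" for w
  proof -
    have "(Psi \<bullet> Lop i) w 0 = B i * Psi w 0 - (Psi \<bullet> theta i) w 0"
      unfolding Psi_Lop by simp
    then show ?thesis by simp
  qed
  have X: "\<phi> \<bullet> (Lop i + E i * K' i) \<in> serre_null"
    using g by (simp only: good_def app_add app_mult serre_null_add serre_null_Lop serre_null_E serre_null_K')
  have val: "(\<phi> \<bullet> (Lop i + E i * K' i)) w n = \<phi> (i # w) n + (\<phi> \<bullet> theta i) w n + (\<phi> \<bullet> (e2 * K' i)) w n" for w n
    unfolding E by (simp add: add.assoc)
  have "(\<phi> \<bullet> (Lop i + E i * K' i)) w 0 = \<sigma> * B i * Psi w 0" for w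
    unfolding val using g by (simp add: e2 theta_0 Psi0 good_def right_diff_distrib mult.assoc del: app_mult)
  moreover have "(\<phi> \<bullet> (Lop i + E i * K' i)) w n = 0" if "n > 0" for w n
    unfolding val using that by (simp add: e2 theta_pos pos del: app_mult)
  moreover have "\<sigma> * B i * kk j = kk j * (\<sigma> * B i)" for j
  proof -
    have "\<sigma> * kk j = kk j * \<sigma>"
      using g by (simp add: good_def)
    then show ?thesis
      by (metis kk_B mult.assoc)
  qed
  ultimately show ?thesis
    using X by (simp add: good_def del: app_add app_mult)
qed

end


section \<open>Quotients of the free algebra\<close>

definition two_sided :: "'a::ring set \<Rightarrow> bool" where
  "two_sided J \<longleftrightarrow> 0 \<in> J \<and> (\<forall>x\<in>J. \<forall>y\<in>J. x + y \<in> J) \<and> (\<forall>x\<in>J. - x \<in> J) \<and>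
     (\<forall>x\<in>J. \<forall>a. a * x \<in> J \<and> x * a \<in> J)"

lemma two_sidedD:
  assumes "two_sided J"
  shows "0 \<in> J" "x \<in> J \<Longrightarrow> y \<in> J \<Longrightarrow> x + y \<in> J" "x \<in> J \<Longrightarrow> y \<in> J \<Longrightarrow> x - y \<in> J"
    "x \<in> J \<Longrightarrow> - x \<in> J" "x \<in> J \<Longrightarrow> a * x \<in> J" "x \<in> J \<Longrightarrow> x * a \<in> J"
  using assms unfolding two_sided_def by (auto simp: diff_conv_add_uminus simp del: add_uminus_conv_diff)

lemma two_sided_cong:
  assumes "two_sided J" "a - a' \<in> J" "b - b' \<in> J"
  shows "(a + b) - (a' + b') \<in> J" "(a - b) - (a' - b') \<in> J" "a * b - a' * b' \<in> J"
proof -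
  have "(a - a') + (b - b') \<in> J" "(a - a') - (b - b') \<in> J" "(a - a') * b + a' * (b - b') \<in> J"
    using assms(2,3) by (blast intro: two_sidedD[OF assms(1)])+
  then show "(a + b) - (a' + b') \<in> J" "(a - b) - (a' - b') \<in> J" "a * b - a' * b' \<in> J"
    by (simp_all add: algebra_simps)
qed

lemma scal_add: "scal (c + e) = scal c + scal e"
  and scal_mult: "scal (c * e) = scal c * scal e"
  and scal_1: "scal 1 = 1"
  and scal_0: "scal 0 = 0"
  by (simp_all add: scal_def single_add mult_single)

lemma scal_central: "x * scal c = scal c * x"
  by (induction x rule: poly_mapping_single_induct)
    (simp_all add: scal_def mult_single mult.commute distrib_left distrib_right)

text \<open>
  The quotients of the free algebra by all its two-sided ideals, bundled into one type, so that
  computations in a single quotient can use type class reasoning.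
\<close>

quotient_type 'g qalg = "(Qv, 'g) free_alg set \<Rightarrow> (Qv, 'g) free_alg" /
  "\<lambda>f g. \<forall>J. two_sided J \<longrightarrow> f J - g J \<in> J"
proof (rule equivpI)
  show "reflp (\<lambda>f g :: (Qv, 'g) free_alg set \<Rightarrow> _. \<forall>J. two_sided J \<longrightarrow> f J - g J \<in> J)"
    by (rule reflpI) (simp add: two_sidedD)
  show "symp (\<lambda>f g :: (Qv, 'g) free_alg set \<Rightarrow> _. \<forall>J. two_sided J \<longrightarrow> f J - g J \<in> J)"
    by (rule sympI) (metis minus_diff_eq two_sidedD(4))
  show "transp (\<lambda>f g :: (Qv, 'g) free_alg set \<Rightarrow> _. \<forall>J. two_sided J \<longrightarrow> f J - g J \<in> J)"
  proof (rule transpI, intro allI impI)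
    fix f g h :: "(Qv, 'g) free_alg set \<Rightarrow> (Qv, 'g) free_alg" and J :: "(Qv, 'g) free_alg set"
    assume "\<forall>J. two_sided J \<longrightarrow> f J - g J \<in> J" "\<forall>J. two_sided J \<longrightarrow> g J - h J \<in> J" "two_sided J"
    then have "(f J - g J) + (g J - h J) \<in> J" by (intro two_sidedD(2)) simp_all
    then show "f J - h J \<in> J" by (simp only: diff_add_cancel add_diff_eq)
  qed
qed

instantiation qalg :: (type) "{ring, monoid_mult}"
begin

lift_definition zero_qalg :: "'a qalg" is "\<lambda>J. 0" .
lift_definition one_qalg :: "'a qalg" is "\<lambda>J. 1" .
lift_definition plus_qalg :: "'a qalg \<Rightarrow> 'a qalg \<Rightarrow> 'a qalg" is "\<lambda>f g J. f J + g J"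
  by (simp add: two_sided_cong)
lift_definition uminus_qalg :: "'a qalg \<Rightarrow> 'a qalg" is "\<lambda>f J. - f J"
  by (metis minus_diff_eq minus_diff_minus two_sidedD(4))
lift_definition minus_qalg :: "'a qalg \<Rightarrow> 'a qalg \<Rightarrow> 'a qalg" is "\<lambda>f g J. f J - g J"
  by (simp add: two_sided_cong)
lift_definition times_qalg :: "'a qalg \<Rightarrow> 'a qalg \<Rightarrow> 'a qalg" is "\<lambda>f g J. f J * g J"
  by (simp add: two_sided_cong)
instance
  by standard (transfer; simp add: two_sidedD(1) algebra_simps)+

end

definition qconst :: "Qv \<Rightarrow> 'g qalg" where
  "qconst c = abs_qalg (\<lambda>_. scal c)"

lemma qconst_simps: "qconst (c + e) = qconst c + qconst e" "qconst (c * e) = qconst c * qconst e" "qconst 1 = 1"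
  by (simp_all add: qconst_def scal_add scal_mult scal_1 plus_qalg.abs_eq times_qalg.abs_eq one_qalg.abs_eq)

lemma qconst_central: "x * qconst c = qconst c * x"
  by (induction x rule: qalg.abs_induct) (simp add: qconst_def times_qalg.abs_eq scal_central)

instantiation qalg :: (type) qv_algebra
begin

definition qs_qalg :: "Qv \<Rightarrow> 'a qalg \<Rightarrow> 'a qalg" where
  "qs_qalg c x = qconst c * x"

instance
proof
  fix c e :: Qv and x y :: "'a qalg"
  show "x * c *\<^sub>q y = c *\<^sub>q (x * y)"
    unfolding qs_qalg_def by (metis mult.assoc qconst_central)
qed (simp_all add: qs_qalg_def qconst_simps distrib_left distrib_right mult.assoc)

end

lemma qs_abs_qalg: "c *\<^sub>q abs_qalg f = abs_qalg (\<lambda>J. scal c * f J)"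
  by (simp add: qs_qalg_def qconst_def times_qalg.abs_eq)

text \<open>
  In the quotients other than the one by \<open>J\<close> the generators are sent to 0, so that relations
  without constant term which hold modulo \<open>J\<close> hold exactly.
\<close>

definition qgen :: "(Qv, 'g) free_alg set \<Rightarrow> 'g \<Rightarrow> 'g qalg" where
  "qgen J g = abs_qalg (\<lambda>J'. if J' = J then gen g else 0)"

definition emb :: "(Qv, 'g) free_alg set \<Rightarrow> (Qv, 'g) free_alg \<Rightarrow> 'g qalg" where
  "emb J = lift (qgen J)"

lemma emb_representative:
  "\<exists>f. emb J p = abs_qalg f \<and> f J = p \<and> (\<forall>J'. J' \<noteq> J \<longrightarrow> f J' = scal (Poly_Mapping.lookup p 0))"
proof (induction p rule: poly_mapping_single_induct)
  case (single u c)
  \<comment> \<open>Away from J every nonempty product of generators is 0, so only the constant term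
    of p survives there.\<close>
  have prod: "\<exists>f. prod_list (map (qgen J) ls) = abs_qalg f \<and> f J = Poly_Mapping.single (Word ls) 1
      \<and> (\<forall>J'. J' \<noteq> J \<longrightarrow> f J' = (if ls = [] then 1 else 0))" for ls
  proof (induction ls)
    case Nil
    show ?case
      by (rule exI[of _ "\<lambda>J. 1"]) (simp add: one_qalg.abs_eq flip: zero_word_def)
  next
    case (Cons g ls)
    then obtain f where f: "prod_list (map (qgen J) ls) = abs_qalg f" "f J = Poly_Mapping.single (Word ls) 1"
      by blast
    have "qgen J g * abs_qalg f = abs_qalg (\<lambda>J'. (if J' = J then gen g else 0) * f J')"
      by (simp add: qgen_def times_qalg.abs_eq)
    then show ?case
      by (intro exI[of _ "\<lambda>J'. (if J' = J then gen g else 0) * f J'"])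
        (simp add: f gen_def mult_single plus_word_def)
  qed
  obtain f where f: "prod_list (map (qgen J) (letters u)) = abs_qalg f" "f J = Poly_Mapping.single u 1"
      "\<forall>J'. J' \<noteq> J \<longrightarrow> f J' = (if letters u = [] then 1 else 0)"
    using prod[of "letters u"] by auto
  have u: "u = 0 \<longleftrightarrow> letters u = []"
    by (cases u) (simp add: zero_word_def)
  show ?case
    by (rule exI[of _ "\<lambda>J'. scal c * f J'"])
      (simp add: emb_def lift_single f qs_abs_qalg scal_def mult_single lookup_single when_def u)
next
  case (add p q)
  then obtain f g where "emb J p = abs_qalg f" "f J = p" "\<forall>J'. J' \<noteq> J \<longrightarrow> f J' = scal (Poly_Mapping.lookup p 0)"
    "emb J q = abs_qalg g" "g J = q" "\<forall>J'. J' \<noteq> J \<longrightarrow> g J' = scal (Poly_Mapping.lookup q 0)"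
    by blast
  then show ?case
    by (intro exI[of _ "\<lambda>J'. f J' + g J'"])
      (simp add: emb_def lift_add plus_qalg.abs_eq lookup_add scal_add)
qed

lemma emb_eq_0D:
  assumes "two_sided J" "emb J p = 0"
  shows "p \<in> J"
proof -
  obtain f where f: "emb J p = abs_qalg f" "f J = p"
    using emb_representative by blast
  then have "abs_qalg f = abs_qalg (\<lambda>_. 0)"
    using assms(2) by (simp add: zero_qalg.abs_eq)
  then have "f J - 0 \<in> J"
    using assms(1) by (simp only: qalg.abs_eq_iff)
  then show ?thesis using f by simp
qed

lemma emb_eq_0I:
  assumes "p \<in> J" "Poly_Mapping.lookup p 0 = 0"
  shows "emb J p = 0"
proof -
  obtain f where f: "emb J p = abs_qalg f" "f J = p" "\<forall>J'. J' \<noteq> J \<longrightarrow> f J' = scal (Poly_Mapping.lookup p 0)"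
    using emb_representative by blast
  have "f J' - 0 \<in> J'" if "two_sided J'" for J'
    using f assms that by (cases "J' = J") (simp_all add: scal_0 two_sidedD(1))
  then show ?thesis
    unfolding f(1) zero_qalg.abs_eq by (simp add: qalg.abs_eq_iff)
qed

text \<open>Multiplying the relation by x' on both sides turns it into a relation for x', which like
  the original one has no constant term and so holds exactly in \<open>qalg\<close>.\<close>

lemma two_sided_inverse_twist:
  assumes J: "two_sided J" and "x * x' - 1 \<in> J" "x' * x - 1 \<in> J" and "x * y - scal c * y * x \<in> J"
  shows "y * x' - scal c * x' * y \<in> J"
proof -
  have "x' * (x * y - scal c * y * x) * x' - (x' * x - 1) * (y * x') + scal c * x' * y * (x * x' - 1) \<in> J"
    using assms(2-4) by (blast intro: two_sidedD[OF J])
  moreover have "x' * (scal c * y * x) * x' = scal c * x' * y * x * x'"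
    by (metis mult.assoc scal_central)
  ultimately show ?thesis
    by (simp add: algebra_simps)
qed

lemma emb_twist:
  assumes "gen g * gen g' - scal c * gen g' * gen g \<in> J"
  shows "qgen J g * qgen J g' = c *\<^sub>q (qgen J g' * qgen J g)"
proof -
  have "emb J (gen g * gen g' - scal c * gen g' * gen g) = 0"
    using assms
    by (rule emb_eq_0I) (simp add: gen_def scal_def mult_single lookup_minus lookup_single zero_word_def
        plus_word_def)
  then show ?thesis
    by (simp add: emb_def lift_simps)
qed

lemma sum_twist:
  fixes f g :: "nat \<Rightarrow> 'r::qv_algebra"
  assumes "\<And>a b. a \<in> A \<Longrightarrow> b \<in> B \<Longrightarrow> f a * g b = c *\<^sub>q (g b * f a)"
  shows "sum f A * sum g B = c *\<^sub>q (sum g B * sum f A)"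
proof -
  have "sum f A * sum g B = (\<Sum>a\<in>A. \<Sum>b\<in>B. c *\<^sub>q (g b * f a))"
    by (simp add: sum_product assms)
  also have "\<dots> = c *\<^sub>q (\<Sum>b\<in>B. \<Sum>a\<in>A. g b * f a)"
    by (simp add: qs_sum_right) (rule sum.swap)
  finally show ?thesis by (simp add: sum_product)
qed

section \<open>Powers of v and the skew-symmetrised Euler form\<close>

lemma qv_power: "qv ^ n = Fract (Polynomial.monom 1 n) 1"
  by (induction n) (simp_all add: qv_def monom_Suc One_fract_def flip: monom_0)

lemma qv_nz: "qv \<noteq> 0"
  by (simp add: qv_def eq_fract Zero_fract_def)

lemma qv_root: "s > 0 \<Longrightarrow> qv ^ s \<noteq> 1"
  by (simp add: qv_power One_fract_def eq_fract monom_eq_1_iff)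

lemma vi_powi: "vi d i powi n = qv powi (int (d i) * n)"
  by (simp add: vi_def power_int_mult)

lemma euler_form_unit:
  assumes "verts (quiv Q) = {1..N}" "i \<in> {1..N}" "j \<in> {1..N}"
  shows "euler_form Q (unit_vec i) (unit_vec j) = (if i = j then int (vval Q i)
         else - int (num_arrows Q i j) * int (lcm (vval Q i) (vval Q j)))"
proof -
  have "euler_form Q (unit_vec i) (unit_vec j) = (\<Sum>a\<in>{1..N}. \<Sum>b\<in>{1..N}.
      if a = i then if b = j then (if i = j then int (vval Q i)
         else - int (num_arrows Q i j) * int (lcm (vval Q i) (vval Q j))) else 0 else 0)"
    unfolding euler_form_def assms(1) by (intro sum.cong refl) (simp add: unit_vec_def)
  also have "\<dots> = (\<Sum>a\<in>{1..N}. if a = i then (if i = j then int (vval Q i)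
         else - int (num_arrows Q i j) * int (lcm (vval Q i) (vval Q j))) else 0)"
    by (intro sum.cong refl) (use assms(3) in simp)
  also have "\<dots> = (if i = j then int (vval Q i)
         else - int (num_arrows Q i j) * int (lcm (vval Q i) (vval Q j)))"
    using assms(2) by simp
  finally show ?thesis .
qed

definition eskew :: "'e valued_quiver \<Rightarrow> nat \<Rightarrow> nat \<Rightarrow> int" where
  "eskew Q i j = euler_form Q (unit_vec i) (unit_vec j) - euler_form Q (unit_vec j) (unit_vec i)"

text \<open>
  With \<open>r\<close> arrows from \<open>j\<close> to \<open>i\<close> one has \<open>s = r * lcm (d i) (d j) / d i\<close>.
\<close>

lemma eskew_cartan:
  assumes sym: "symmetrizer N C d" and Q: "associated_valued_quiver N C d Q"
    and ij: "i \<in> {1..N}" "j \<in> {1..N}" "i \<noteq> j"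
  obtains s where "0 \<le> s" "s \<le> - C i j" "eskew Q i j = int (d i) * (C i j + 2 * s)"
proof -
  define L where "L = lcm (d i) (d j)"
  have dpos: "d i > 0" using sym ij by (simp add: symmetrizer_def)
  have fin: "finite (arcs (quiv Q))"
    using Q by (simp add: associated_valued_quiver_def fin_digraph_def fin_digraph_axioms_def)
  have vv: "vval Q i = d i" "vval Q j = d j" "verts (quiv Q) = {1..N}"
    using Q ij by (simp_all add: associated_valued_quiver_def)
  have "{a \<in> arcs (quiv Q). {tail (quiv Q) a, head (quiv Q) a} = {i, j}}
      = {a \<in> arcs (quiv Q). tail (quiv Q) a = i \<and> head (quiv Q) a = j}
      \<union> {a \<in> arcs (quiv Q). tail (quiv Q) a = j \<and> head (quiv Q) a = i}"
    by (auto simp: doubleton_eq_iff)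
  then have card: "card {a \<in> arcs (quiv Q). {tail (quiv Q) a, head (quiv Q) a} = {i, j}}
      = num_arrows Q i j + num_arrows Q j i"
    unfolding num_arrows_def using fin ij by (simp, subst card_Un_disjoint) auto
  \<comment> \<open>By this symmetry d_i c_ij is divisible by d_i and by d_j, so the division in the
    number of edges is exact.\<close>
  have "int (d i) * C i j = int (d j) * C j i"
    using sym ij by (simp add: symmetrizer_def)
  then have "int (d j) dvd int (d i) * C i j"
    by simp
  with dvd_triv_left[of "int (d i)" "C i j"] have "int L dvd int (d i) * C i j"
    unfolding L_def lcm_int_int_eq[symmetric] by (rule lcm_least)
  then have "int L dvd - (int (d i) * C i j)" by simp
  moreover have "int (num_arrows Q i j + num_arrows Q j i) = (- (int (d i) * C i j)) div int L"
  proof -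
    have "\<forall>i\<in>{1..N}. \<forall>j\<in>{1..N}. i \<noteq> j \<longrightarrow>
        int (card {a \<in> arcs (quiv Q). {tail (quiv Q) a, head (quiv Q) a} = {i, j}}) =
          (- (int (d i) * C i j)) div int (lcm (d i) (d j))"
      using Q unfolding associated_valued_quiver_def by blast
    from this[rule_format, OF ij] show ?thesis
      by (simp only: card L_def)
  qed
  ultimately have tot: "int (num_arrows Q i j + num_arrows Q j i) * int L = - (int (d i) * C i j)"
    by simp
  obtain l where l: "L = d i * l"
    unfolding L_def by (meson dvd_lcm1 dvdE)
  define s where "s = int (num_arrows Q j i) * int l"
  have "int (d i) * (int (num_arrows Q i j + num_arrows Q j i) * int l) = int (d i) * (- C i j)"
    using tot unfolding l by (simp add: algebra_simps)
  then have tot': "int (num_arrows Q i j) * int l + s = - C i j"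
    unfolding mult_cancel_left using dpos by (simp add: s_def distrib_right)
  have "eskew Q i j = - int (num_arrows Q i j) * int L + int (num_arrows Q j i) * int L"
    unfolding eskew_def euler_form_unit[OF vv(3) ij(1,2)] euler_form_unit[OF vv(3) ij(2,1)]
    using ij by (simp add: vv L_def lcm.commute)
  also have "\<dots> = int (d i) * (- (int (num_arrows Q i j) * int l) + s)"
    by (simp add: l s_def algebra_simps)
  also have "- (int (num_arrows Q i j) * int l) + s = C i j + 2 * s"
    using tot' by simp
  finally have "eskew Q i j = int (d i) * (C i j + 2 * s)" .
  moreover have "0 \<le> s" by (simp add: s_def)
  moreover have "0 \<le> int (num_arrows Q i j) * int l" by simp
  then have "s \<le> - C i j" using tot' by linarith
  ultimately show ?thesis by (intro that)
qed

section \<open>Presented algebras in terms of representatives\<close>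

lemma presented_simps:
  "carrier (presented_algebra X R) = a_rcosets\<^bsub>free_algebra X\<^esub> (Idl\<^bsub>free_algebra X\<^esub> R)"
  "mult (presented_algebra X R) = rcoset_mult (free_algebra X) (Idl\<^bsub>free_algebra X\<^esub> R)"
  "one (presented_algebra X R) = (Idl\<^bsub>free_algebra X\<^esub> R) +>\<^bsub>free_algebra X\<^esub> \<one>\<^bsub>free_algebra X\<^esub>"
  "zero (presented_algebra X R) = Idl\<^bsub>free_algebra X\<^esub> R"
  "add (presented_algebra X R) = set_add (free_algebra X)"
  "smult (presented_algebra X R) = (\<lambda>c Y. \<Union>x\<in>Y. (Idl\<^bsub>free_algebra X\<^esub> R) +>\<^bsub>free_algebra X\<^esub> (c \<odot>\<^bsub>free_algebra X\<^esub> x))"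
  by (simp_all add: presented_algebra_def alg_quot_def FactRing_def ring.defs)

lemma free_algebra_simps:
  "mult (free_algebra X) = (*)" "one (free_algebra X) = 1" "zero (free_algebra X) = 0"
  "add (free_algebra X) = (+)" "smult (free_algebra X) = (\<lambda>c p. scal c * p)"
  by (simp_all add: free_algebra_def)

locale presentation =
  fixes X :: "'g set" and R :: "(Qv, 'g) free_alg set"
  assumes R: "R \<subseteq> carrier (free_algebra X)"
begin

abbreviation "A \<equiv> (free_algebra X :: (Qv, (Qv, 'g) free_alg) module)"
abbreviation "P \<equiv> presented_algebra X R"
abbreviation "cls \<equiv> pres_class X R"
abbreviation "J \<equiv> Idl\<^bsub>A\<^esub> R"

lemma ideal_J: "ideal J A"
  by (rule ring.genideal_ideal[OF ring_free_algebra R])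

lemma R_J: "R \<subseteq> J"
  by (rule ring.genideal_self[OF ring_free_algebra R])

lemma J_add: "p \<in> J \<Longrightarrow> q \<in> J \<Longrightarrow> p + q \<in> J"
  using additive_subgroup.a_closed[OF ideal.axioms(1)[OF ideal_J]] by (simp add: free_algebra_simps)

lemma J_zero: "0 \<in> J"
  using additive_subgroup.zero_closed[OF ideal.axioms(1)[OF ideal_J]] by (simp add: free_algebra_simps)

lemma J_left: "p \<in> J \<Longrightarrow> a \<in> carrier A \<Longrightarrow> a * p \<in> J"
  using ideal.I_l_closed[OF ideal_J] by (simp add: free_algebra_simps)

lemma J_right: "p \<in> J \<Longrightarrow> a \<in> carrier A \<Longrightarrow> p * a \<in> J"
  using ideal.I_r_closed[OF ideal_J] by (simp add: free_algebra_simps)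

lemma J_scal: "p \<in> J \<Longrightarrow> scal c * p \<in> J"
  by (rule J_left[OF _ scal_in_free_algebra])

lemma J_uminus: "p \<in> J \<Longrightarrow> - p \<in> J"
  using J_scal[of p "-1"] by (simp add: scal_def single_uminus)

lemma cls_def': "cls p = (\<lambda>h. h + p) ` J"
  by (auto simp: pres_class_def a_r_coset_def r_coset_def free_algebra_simps)

lemma cls_eq_iff: "cls p = cls q \<longleftrightarrow> p - q \<in> J"
proof
  assume "cls p = cls q"
  then have "p \<in> cls q"
    using J_zero unfolding cls_def' by (metis add_0 image_eqI)
  then show "p - q \<in> J"
    by (auto simp: cls_def')
next
  assume d: "p - q \<in> J"
  have "(\<lambda>h. h + p) ` J \<subseteq> (\<lambda>h. h + q) ` J" if "p - q \<in> J" for p q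
  proof clarify
    fix h assume "h \<in> J"
    have "h + p = (h + (p - q)) + q" by simp
    moreover have "h + (p - q) \<in> J" using \<open>h \<in> J\<close> that by (rule J_add)
    ultimately show "h + p \<in> (\<lambda>h. h + q) ` J" by (rule image_eqI)
  qed
  from this[OF d] this[of q p] show "cls p = cls q"
    unfolding cls_def' using J_uminus[OF d] by (intro equalityI) simp_all
qed

lemma carrier_P: "carrier P = cls ` carrier A"
  unfolding presented_simps by (auto simp: A_RCOSETS_def' pres_class_def)

lemma cls_add: "p \<in> carrier A \<Longrightarrow> q \<in> carrier A \<Longrightarrow> cls p \<oplus>\<^bsub>P\<^esub> cls q = cls (p + q)"
  unfolding presented_simps pres_class_def
  by (simp add: abelian_subgroup.a_rcos_sum[OF abelian_subgroupI3[OF ideal.axioms(1)[OF ideal_J]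
        ring.is_abelian_group[OF ring_free_algebra]]] free_algebra_simps)

lemma cls_mult: "p \<in> carrier A \<Longrightarrow> q \<in> carrier A \<Longrightarrow> cls p \<otimes>\<^bsub>P\<^esub> cls q = cls (p * q)"
  unfolding presented_simps pres_class_def
  by (simp add: ideal.rcoset_mult_add[OF ideal_J] free_algebra_simps)

lemma cls_one: "\<one>\<^bsub>P\<^esub> = cls 1"
  unfolding presented_simps pres_class_def by (simp add: free_algebra_simps)

lemma cls_zero: "\<zero>\<^bsub>P\<^esub> = cls 0"
  unfolding presented_simps cls_def' by simp

lemma cls_smult: "c \<odot>\<^bsub>P\<^esub> cls p = cls (scal c * p)"
proof -
  have "(Idl\<^bsub>A\<^esub> R) +>\<^bsub>A\<^esub> (scal c * x) = cls (scal c * p)" if "x \<in> cls p" for x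
  proof -
    have "x - p \<in> J" using that by (auto simp: cls_def')
    then have "cls (scal c * x) = cls (scal c * p)"
      using J_scal[of "x - p" c] by (simp add: cls_eq_iff right_diff_distrib)
    then show ?thesis by (simp add: pres_class_def)
  qed
  moreover have "p \<in> cls p"
    using J_zero unfolding cls_def' by (metis add_0 image_eqI)
  ultimately show ?thesis
    unfolding presented_simps free_algebra_simps by auto
qed

lemma ring_P: "ring P"
proof (rule ringI)
  show "abelian_group P"
  proof (rule abelian_groupI)
    fix x assume "x \<in> carrier P"
    then obtain p where p: "p \<in> carrier A" "x = cls p" by (auto simp: carrier_P)
    then show "\<exists>y\<in>carrier P. y \<oplus>\<^bsub>P\<^esub> x = \<zero>\<^bsub>P\<^esub>"
      by (intro bexI[of _ "cls (- p)"])
        (simp_all add: cls_add cls_zero carrier_P free_algebra_uminus_closed)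
  qed (auto simp: carrier_P cls_add cls_zero free_algebra_add_closed free_algebra_zero_closed add_ac)
  show "Group.monoid P"
    by (rule Group.monoidI)
      (auto simp: carrier_P cls_mult cls_one free_algebra_mult_closed free_algebra_one_closed mult.assoc)
qed (auto simp: carrier_P cls_mult cls_add free_algebra_mult_closed free_algebra_add_closed
    distrib_left distrib_right)

lemma cls_finsum:
  assumes "finite S" "\<And>k. k \<in> S \<Longrightarrow> f k \<in> carrier A"
  shows "(\<Oplus>\<^bsub>P\<^esub>k\<in>S. cls (f k)) = cls (\<Sum>k\<in>S. f k)"
proof -
  interpret P: ring P by (rule ring_P)
  show ?thesis
    using assms
  proof (induction S)
    case empty
    then show ?case by (simp add: cls_zero)
  next
    case (insert a S)
    have "(\<Oplus>\<^bsub>P\<^esub>k\<in>insert a S. cls (f k)) = cls (f a) \<oplus>\<^bsub>P\<^esub> (\<Oplus>\<^bsub>P\<^esub>k\<in>S. cls (f k))"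
      using insert by (intro P.finsum_insert) (auto simp: carrier_P)
    then show ?case
      using insert by (simp add: cls_add free_algebra_sum_closed)
  qed
qed

text \<open>The retraction onto the free algebra on X that sends all other letters to 0. Taking
  preimages under it extends the ideal of relations to a two-sided ideal of the whole type, as
  \<open>qalg\<close> requires, without changing it on the carrier.\<close>

definition restr :: "(Qv, 'g) free_alg \<Rightarrow> (Qv, 'g) free_alg" where
  "restr p = (\<Sum>u\<in>{u \<in> Poly_Mapping.keys p. set (letters u) \<subseteq> X}. Poly_Mapping.single u (Poly_Mapping.lookup p u))"

lemma lookup_restr: "Poly_Mapping.lookup (restr p) u = (if set (letters u) \<subseteq> X then Poly_Mapping.lookup p u else 0)"
proof -
  have "Poly_Mapping.lookup (restr p) u = (\<Sum>u'\<in>{u \<in> Poly_Mapping.keys p. set (letters u) \<subseteq> X}.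
      if u' = u then Poly_Mapping.lookup p u else 0)"
    unfolding restr_def lookup_sum by (intro sum.cong refl) (auto simp: lookup_single when_def)
  then show ?thesis by (simp add: in_keys_iff)
qed

lemma restr_add: "restr (p + q) = restr p + restr q"
  by (rule poly_mapping_eqI) (simp add: lookup_restr lookup_add)

lemma restr_uminus: "restr (- p) = - restr p"
  by (rule poly_mapping_eqI) (simp add: lookup_restr)

lemma restr_single: "restr (Poly_Mapping.single u c) = (if set (letters u) \<subseteq> X then Poly_Mapping.single u c else 0)"
  by (rule poly_mapping_eqI) (auto simp: lookup_restr lookup_single when_def)

text \<open>A concatenation uses letters of X only if and only if both factors do.\<close>

lemma restr_mult: "restr (p * q) = restr p * restr q"
proof (induction p rule: poly_mapping_single_induct)
  case (single u c)
  show ?case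
    by (induction q rule: poly_mapping_single_induct)
      (simp_all add: mult_single restr_single plus_word_def distrib_left restr_add)
qed (simp_all add: distrib_right restr_add)

lemma restr_carrier: "restr p \<in> carrier A"
  by (auto simp: free_algebra_def in_keys_iff lookup_restr split: if_splits)

lemma restr_id: "p \<in> carrier A \<Longrightarrow> restr p = p"
  by (rule poly_mapping_eqI) (auto simp: free_algebra_def in_keys_iff lookup_restr)

definition full_ideal :: "(Qv, 'g) free_alg set" where
  "full_ideal = {p. restr p \<in> J}"

lemma two_sided_full_ideal: "two_sided full_ideal"
proof -
  have "restr 0 = 0" by (rule poly_mapping_eqI) (simp add: lookup_restr)
  then show ?thesis
    unfolding two_sided_def full_ideal_def
    by (auto simp: restr_add restr_uminus restr_mult J_zero intro: J_add J_uminus J_left J_right restr_carrier)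
qed

lemma full_ideal_carrier: "p \<in> carrier A \<Longrightarrow> p \<in> full_ideal \<longleftrightarrow> p \<in> J"
  by (simp add: full_ideal_def restr_id)

lemma R_full_ideal: "R \<subseteq> full_ideal"
  using R_J R full_ideal_carrier by blast

end


section \<open>The homomorphism\<close>

lemma app_sum: "x \<bullet> (\<Sum>a\<in>S. f a) = (\<Sum>a\<in>S. x \<bullet> f a)"
  by (induction S rule: infinite_finite_induct) simp_all

locale quiver_torus =
  fixes N :: nat and C :: "nat \<Rightarrow> nat \<Rightarrow> int" and d :: "nat \<Rightarrow> nat"
    and Q :: "'e valued_quiver" and w :: "nat list"
  assumes gcm: "gen_cartan_matrix N C" and sym: "symmetrizer N C d"
    and quiver: "associated_valued_quiver N C d Q" and w: "set w \<subseteq> {1..N}"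
  notes One_nat_def [simp del]
begin

interpretation T: presentation "tgens w" "trels Q w"
  by unfold_locales (rule trels_subset)

interpretation U: presentation "dgens N" "drels N C d"
  by unfold_locales (rule drels_subset)

section \<open>The q-commutation relations of the torus\<close>

definition xp :: "nat \<Rightarrow> tgen qalg" where "xp k = qgen T.full_ideal (tX k)"
definition xm :: "nat \<Rightarrow> tgen qalg" where "xm k = qgen T.full_ideal (tX' k)"

lemma trels_rules:
  assumes "k \<in> {1..length w}"
  shows "gen (tX k) * gen (tX' k) - 1 \<in> T.full_ideal" "gen (tX' k) * gen (tX k) - 1 \<in> T.full_ideal"
    "l \<in> {1..length w} \<Longrightarrow> gen (tX l) * gen (tX k) -
      scal (qv powi eskew Q (letter w k) (letter w l)) * gen (tX k) * gen (tX l) \<in> T.full_ideal"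
  using assms T.R_full_ideal unfolding trels_def eskew_def by blast+

lemma eskew_swap: "eskew Q j i = - eskew Q i j"
  by (simp add: eskew_def)

text \<open>The presentation gives the relation between the x_k; the other three follow by inverting
  first one and then the other variable with \<open>two_sided_inverse_twist\<close>.\<close>

lemma x_twist:
  assumes "k \<in> {1..length w}" "l \<in> {1..length w}"
  shows "xp l * xp k = qv powi eskew Q (letter w k) (letter w l) *\<^sub>q (xp k * xp l)"
    and "xp l * xm k = qv powi (- eskew Q (letter w k) (letter w l)) *\<^sub>q (xm k * xp l)"
    and "xm l * xm k = qv powi eskew Q (letter w k) (letter w l) *\<^sub>q (xm k * xm l)"
    and "xm l * xp k = qv powi (- eskew Q (letter w k) (letter w l)) *\<^sub>q (xp k * xm l)"
proof -
  note J = T.two_sided_full_ideal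
  have mixed: "gen (tX l) * gen (tX' k) - scal (qv powi eskew Q (letter w l) (letter w k)) * gen (tX' k) * gen (tX l) \<in> T.full_ideal"
    if "k \<in> {1..length w}" "l \<in> {1..length w}" for k l
    by (rule two_sided_inverse_twist[OF J trels_rules(1)[OF that(1)] trels_rules(2)[OF that(1)]
          trels_rules(3)[OF that(2,1)]])
  have neg: "gen (tX' k) * gen (tX' l) - scal (qv powi eskew Q (letter w l) (letter w k)) * gen (tX' l) * gen (tX' k) \<in> T.full_ideal"
    by (rule two_sided_inverse_twist[OF J trels_rules(1)[OF assms(2)] trels_rules(2)[OF assms(2)]
          mixed[OF assms]])
  show "xp l * xp k = qv powi eskew Q (letter w k) (letter w l) *\<^sub>q (xp k * xp l)"
    unfolding xp_def by (rule emb_twist[OF trels_rules(3)[OF assms]])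
  show "xp l * xm k = qv powi (- eskew Q (letter w k) (letter w l)) *\<^sub>q (xm k * xp l)"
    unfolding xp_def xm_def eskew_swap[of "letter w l", symmetric] by (rule emb_twist[OF mixed[OF assms]])
  have "xm k * xm l = qv powi eskew Q (letter w l) (letter w k) *\<^sub>q (xm l * xm k)"
    unfolding xm_def by (rule emb_twist[OF neg])
  then show "xm l * xm k = qv powi eskew Q (letter w k) (letter w l) *\<^sub>q (xm k * xm l)"
    using qv_nz by (simp add: eskew_swap[of "letter w l" "letter w k"] power_int_minus)
  have "xp k * xm l = qv powi eskew Q (letter w k) (letter w l) *\<^sub>q (xm l * xp k)"
    unfolding xp_def xm_def by (rule emb_twist[OF mixed[OF assms(2,1)]])
  then show "xm l * xp k = qv powi (- eskew Q (letter w k) (letter w l)) *\<^sub>q (xp k * xm l)"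
    using qv_nz by (simp add: power_int_minus)
qed

definition Fq :: "nat \<Rightarrow> tgen qalg" where "Fq i = (\<Sum>k\<in>occ w i. xp k)"
definition Gq :: "nat \<Rightarrow> tgen qalg" where "Gq i = (\<Sum>k\<in>occ w i. xm k)"

lemma finite_occ: "finite (occ w i)"
  by (simp add: occ_def)

lemma x_twist_occ:
  assumes "l \<in> occ w j" "k \<in> occ w i"
  shows "xp l * xp k = qv powi eskew Q i j *\<^sub>q (xp k * xp l)"
    and "xp l * xm k = qv powi (- eskew Q i j) *\<^sub>q (xm k * xp l)"
    and "xm l * xm k = qv powi eskew Q i j *\<^sub>q (xm k * xm l)"
    and "xm l * xp k = qv powi (- eskew Q i j) *\<^sub>q (xp k * xm l)"
  using x_twist[of k l] assms unfolding occ_def by blast+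

lemma FG_twist:
  shows "Fq j * Fq i = qv powi eskew Q i j *\<^sub>q (Fq i * Fq j)"
    and "Fq j * Gq i = qv powi (- eskew Q i j) *\<^sub>q (Gq i * Fq j)"
    and "Gq j * Fq i = qv powi (- eskew Q i j) *\<^sub>q (Fq i * Gq j)"
    and "Gq j * Gq i = qv powi eskew Q i j *\<^sub>q (Gq i * Gq j)"
  unfolding Fq_def Gq_def by (rule sum_twist, rule x_twist_occ; assumption)+

abbreviation I :: "nat set" where "I \<equiv> {1..N}"

text \<open>The value 1 outside the index set makes \<open>ch\<close> symmetric and nonzero on all
  indices, as \<open>double_module\<close> asks.\<close>

definition ch :: "nat \<Rightarrow> nat \<Rightarrow> Qv" where
  "ch i j = (if i \<in> I \<and> j \<in> I then vi d i powi C i j else 1)"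

definition kq :: "nat \<Rightarrow> tgen qalg" where
  "kq i = (- inverse (vi d i) * (vi d i - inverse (vi d i))\<^sup>2) *\<^sub>q (Fq i * Gq i)"

text \<open>The scalars picked up from F_i and from G_i are inverse to each other.\<close>

lemma FG_central:
  "Fq i * Gq i * Fq j = Fq j * (Fq i * Gq i)" "Fq i * Gq i * Gq j = Gq j * (Fq i * Gq i)"
proof -
  have "Fq i * Gq i * Fq j = Fq i * (Gq i * Fq j)" by (simp add: mult.assoc)
  also have "\<dots> = qv powi (- eskew Q j i) *\<^sub>q (Fq i * Fq j * Gq i)"
    by (simp add: FG_twist(3)[of i j] mult.assoc)
  also have "\<dots> = Fq j * Fq i * Gq i"
    using qv_nz by (simp add: FG_twist(1)[of i j] power_int_minus)
  finally show "Fq i * Gq i * Fq j = Fq j * (Fq i * Gq i)" by (simp add: mult.assoc)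
  have "Fq i * Gq i * Gq j = Fq i * (Gq i * Gq j)" by (simp add: mult.assoc)
  also have "\<dots> = qv powi eskew Q j i *\<^sub>q (Fq i * Gq j * Gq i)"
    by (simp add: FG_twist(4)[of i j] mult.assoc)
  also have "\<dots> = Gq j * Fq i * Gq i"
    using qv_nz by (simp add: FG_twist(2)[of i j] power_int_minus)
  finally show "Fq i * Gq i * Gq j = Gq j * (Fq i * Gq i)" by (simp add: mult.assoc)
qed

lemma vi_nz: "vi d i \<noteq> 0"
  by (simp add: vi_def qv_nz)

lemma vi_root: "i \<in> I \<Longrightarrow> s > 0 \<Longrightarrow> vi d i ^ s \<noteq> 1"
  using sym unfolding vi_def power_mult[symmetric] by (intro qv_root) (simp add: symmetrizer_def)

interpretation M: torus_module I "vi d" C ch kq "\<lambda>i. Fq i + Gq i" Fq Gq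
proof unfold_locales
  fix i j
  show "vi d i \<noteq> 0" by (rule vi_nz)
  show "i \<in> I \<Longrightarrow> s > 0 \<Longrightarrow> vi d i ^ s \<noteq> 1" for s by (rule vi_root)
  show "i \<in> I \<Longrightarrow> j \<in> I \<Longrightarrow> i \<noteq> j \<Longrightarrow> C i j \<le> 0"
    using gcm by (simp add: gen_cartan_matrix_def)
  show "ch i j = ch j i"
    using sym by (simp add: ch_def vi_powi symmetrizer_def)
  show "ch i j \<noteq> 0" by (simp add: ch_def vi_nz)
  show "i \<in> I \<Longrightarrow> j \<in> I \<Longrightarrow> i \<noteq> j \<Longrightarrow> ch i j = vi d i powi C i j" by (simp add: ch_def)
  show "i \<in> I \<Longrightarrow> ch i i = (vi d i)\<^sup>2"
    using gcm by (simp add: ch_def gen_cartan_matrix_def)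
  have "Fq i * Gq i * (Fq j * Gq j) = Fq j * Gq j * (Fq i * Gq i)"
    by (rule commute_mult[OF FG_central])
  then show "kq i * kq j = kq j * kq i"
    by (simp add: kq_def mult.commute)
  show "kq i * (Fq j + Gq j) = (Fq j + Gq j) * kq i"
    by (simp add: kq_def distrib_left distrib_right FG_central qs_add_right)
  show "Gq i * Fq i = Fq i * Gq i"
    using FG_twist(3)[of i i] by (simp add: eskew_def)
  show "kq i = (- inverse (vi d i) * (vi d i - inverse (vi d i))\<^sup>2) *\<^sub>q (Fq i * Gq i)"
    by (rule kq_def)
  assume ij: "i \<in> I" "j \<in> I" "i \<noteq> j"
  obtain s where s: "0 \<le> s" "s \<le> - C i j" "eskew Q i j = int (d i) * (C i j + 2 * s)"
    using eskew_cartan[OF sym quiver ij] .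
  have p: "vi d i powi (C i j + 2 * s) = qv powi eskew Q i j"
    "vi d i powi (- (C i j + 2 * s)) = qv powi (- eskew Q i j)"
    by (simp_all only: s(3) vi_powi mult_minus_right)
  show "\<exists>s\<ge>0. s \<le> - C i j \<and>
      Fq j * Fq i = vi d i powi (C i j + 2 * s) *\<^sub>q (Fq i * Fq j) \<and>
      Fq j * Gq i = vi d i powi (- (C i j + 2 * s)) *\<^sub>q (Gq i * Fq j) \<and>
      Gq j * Fq i = vi d i powi (- (C i j + 2 * s)) *\<^sub>q (Fq i * Gq j) \<and>
      Gq j * Gq i = vi d i powi (C i j + 2 * s) *\<^sub>q (Gq i * Gq j)"
    by (rule exI[of _ s]) (unfold p, intro conjI s(1,2) FG_twist)
qed auto

section \<open>The representation of the double\<close>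

primrec double_rep :: "dgen \<Rightarrow> tgen qalg wfun rendo" where
  "double_rep (dE i) = M.E i"
| "double_rep (dF i) = Lop i"
| "double_rep (dK i) = M.K i"
| "double_rep (dK' i) = M.K' i"

lemma serre_null_lift:
  assumes "\<phi> \<in> M.serre_null"
  shows "\<phi> \<bullet> lift double_rep p \<in> M.serre_null"
proof -
  have double_rep: "\<phi> \<bullet> double_rep g \<in> M.serre_null" if "\<phi> \<in> M.serre_null" for \<phi> g
    using that by (cases g) (simp_all add: M.serre_null_E M.serre_null_Lop M.serre_null_K M.serre_null_K' del: app_Lop)
  have words: "\<phi> \<bullet> prod_list (map double_rep ls) \<in> M.serre_null" if "\<phi> \<in> M.serre_null" for \<phi> ls
    using that by (induction ls arbitrary: \<phi>) (simp_all add: double_rep)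
  have "(\<Sum>u\<in>S. Poly_Mapping.lookup p u *\<^sub>q (\<phi> \<bullet> prod_list (map double_rep (letters u)))) \<in> M.serre_null" for S
  proof (induction S rule: infinite_finite_induct)
    case (insert x F)
    show ?case
      unfolding sum.insert[OF insert(1,2)] by (intro M.serre_null_add M.serre_null_qs words assms insert(3))
  qed (simp_all add: M.serre_null_zero)
  then show ?thesis
    by (simp add: lift_def app_sum)
qed

lemma qint_nz: "i \<in> I \<Longrightarrow> s > 0 \<Longrightarrow> qint (vi d i) s \<noteq> 0"
proof -
  assume i: "i \<in> I" and s: "s > 0"
  have "vi d i ^ s * vi d i ^ s \<noteq> 1"
    using vi_root[OF i, of "2 * s"] s by (simp add: power_add mult_2)
  then have "vi d i powi int s \<noteq> vi d i powi (- int s)"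
    using vi_nz[of i] by (simp add: power_int_minus field_simps)
  moreover have "vi d i \<noteq> inverse (vi d i)"
    using vi_root[OF i, of 2] vi_nz[of i] by (simp add: field_simps power2_eq_square)
  ultimately show ?thesis by (simp add: qint_def)
qed

lemma serre_vanish:
  assumes "\<phi> \<in> M.serre_null" "i \<in> I" "j \<in> I" "i \<noteq> j"
  shows "\<phi> \<bullet> lift double_rep (serre C d dE i j) = 0" "\<phi> \<bullet> lift double_rep (serre C d dF i j) = 0"
proof -
  have c: "C i j \<le> 0" using M.C_le assms by blast
  note s = lift_serre[where d = d and i = i and C = C and j = j, OF vi_nz qint_nz[OF assms(2)] c]
  show "\<phi> \<bullet> lift double_rep (serre C d dE i j) = 0"
    using assms by (simp add: s M.E_Serre)
  have "\<phi> \<bullet> M.S i j = 0"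
    using M.serre_null_D[OF assms, of "[]"] by simp
  then show "\<phi> \<bullet> lift double_rep (serre C d dF i j) = 0"
    using assms by (simp add: s M.S_def)
qed

text \<open>The Serre relations of the F_i hold on \<open>serre_null\<close> by its definition; the
  others hold as identities of operators.\<close>

lemma drels_vanish:
  assumes "p \<in> drels N C d" "\<phi> \<in> M.serre_null"
  shows "\<phi> \<bullet> lift double_rep p = 0"
proof -
  obtain i j where ij: "i \<in> I" "j \<in> I" and p: "p \<in>
      {commutator (gen (dE i)) (gen (dF j)) -
          (if i = j then scal (inverse (vi d i - inverse (vi d i))) * (gen (dK i) - gen (dK' i)) else 0),
        commutator (gen (dK i)) (gen (dK j)),
        commutator (gen (dK i)) (gen (dK' j)),
        commutator (gen (dK' i)) (gen (dK' j)),
        gen (dK i) * gen (dE j) - scal (vi d i powi C i j) * gen (dE j) * gen (dK i),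
        gen (dK i) * gen (dF j) - scal (vi d i powi (- C i j)) * gen (dF j) * gen (dK i),
        gen (dK' i) * gen (dE j) - scal (vi d i powi (- C i j)) * gen (dE j) * gen (dK' i),
        gen (dK' i) * gen (dF j) - scal (vi d i powi C i j) * gen (dF j) * gen (dK' i)} \<union>
       (if i \<noteq> j then {serre C d dE i j, serre C d dF i j} else {})"
    using assms(1) unfolding drels_def by blast
  have ch: "vi d i powi C i j = ch i j" "vi d i powi (- C i j) = inverse (ch i j)"
    using ij by (simp_all add: ch_def power_int_minus)
  from p consider "i \<noteq> j" "p = serre C d dE i j \<or> p = serre C d dF i j"
    | "lift double_rep p = 0"
    unfolding ch
    by (auto simp: commutator_def lift_simps M.E_Lop M.K_K M.K_K' M.K'_K' M.K_E M.K'_E M.K_Lop M.K'_Lop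
        M.qdenom_def mult.assoc split: if_splits)
  then show ?thesis
    by cases (use serre_vanish[OF assms(2) ij] in auto)
qed

text \<open>The elements acting by 0 on \<open>serre_null\<close> form a two-sided ideal, because
  this space is stable under the action.\<close>

lemma U_vanish:
  assumes "p \<in> U.J" "\<phi> \<in> M.serre_null"
  shows "\<phi> \<bullet> lift double_rep p = 0"
proof -
  let ?V = "{p \<in> carrier U.A. \<forall>\<phi>\<in>M.serre_null. \<phi> \<bullet> lift double_rep p = 0}"
  have "ideal ?V U.A"
  proof (rule idealI[OF ring_free_algebra])
    have "abelian_group U.A"
      using ring_free_algebra by (rule ring.is_abelian_group)
    then have inv: "\<ominus>\<^bsub>U.A\<^esub> p = - p" if "p \<in> carrier U.A" for p
      using that by (intro abelian_group.minus_equality)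
        (simp_all add: free_algebra_simps free_algebra_uminus_closed)
    show "subgroup ?V (add_monoid U.A)"
    proof (rule subgroup.intro)
      fix x assume "x \<in> ?V"
      then have "inv\<^bsub>add_monoid U.A\<^esub> x = - x"
        by (intro inv[unfolded a_inv_def]) simp
      then show "inv\<^bsub>add_monoid U.A\<^esub> x \<in> ?V"
        using \<open>x \<in> ?V\<close> by (simp add: free_algebra_uminus_closed lift_uminus)
    qed (auto simp: free_algebra_simps free_algebra_closed lift_add)
  qed (auto simp: free_algebra_simps free_algebra_mult_closed lift_mult serre_null_lift)
  then have "U.J \<subseteq> ?V"
    by (rule ring.genideal_minimal[OF ring_free_algebra]) (use U.R drels_vanish in blast)
  then show ?thesis using assms by blast
qed

text \<open>The graph of the homomorphism, on representatives: acting by p changes the constant term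
  \<sigma> \<open>Psi\<close> into \<sigma> \<tau> \<open>Psi\<close>. Such pairs are closed under
  the algebra operations.\<close>

definition related :: "(Qv, dgen) free_alg \<Rightarrow> (Qv, tgen) free_alg \<Rightarrow> bool" where
  "related p \<tau> \<longleftrightarrow> p \<in> carrier U.A \<and> \<tau> \<in> carrier T.A \<and>
     (\<forall>\<sigma> \<phi>. M.good \<sigma> \<phi> \<longrightarrow> M.good (\<sigma> * emb T.full_ideal \<tau>) (\<phi> \<bullet> lift double_rep p))"

lemma related_add: "related p \<tau> \<Longrightarrow> related p' \<tau>' \<Longrightarrow> related (p + p') (\<tau> + \<tau>')"
  by (simp add: related_def free_algebra_add_closed emb_def lift_add distrib_left M.good_add)

lemma related_mult: "related p \<tau> \<Longrightarrow> related p' \<tau>' \<Longrightarrow> related (p * p') (\<tau> * \<tau>')"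
  by (simp add: related_def free_algebra_mult_closed emb_def lift_mult flip: mult.assoc)

lemma related_scal: "related (scal c) (scal c)"
  by (simp add: related_def scal_in_free_algebra emb_def lift_scal M.good_qs)

lemma related_smult: "related p \<tau> \<Longrightarrow> related (scal c * p) (scal c * \<tau>)"
  by (rule related_mult[OF related_scal])

lemma related_one: "related 1 1"
  using related_scal[of 1] by (simp add: scal_1)

lemma related_uminus: "related p \<tau> \<Longrightarrow> related (- p) (- \<tau>)"
  using related_smult[of p \<tau> "-1"] by (simp add: scal_def single_uminus)

text \<open>If p - p' is 0 in the double, it acts by 0 on \<open>Psi\<close>; but the constant term
  of the result is the image of \<tau> - \<tau>' times \<open>Psi\<close>, so this image is
  0.\<close>

lemma related_wd:
  assumes "related p \<tau>" "related p' \<tau>'" "U.cls p = U.cls p'"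
  shows "T.cls \<tau> = T.cls \<tau>'"
proof -
  have R: "related (p - p') (\<tau> - \<tau>')"
    using related_add[OF assms(1) related_uminus[OF assms(2)]] by simp
  have "p - p' \<in> U.J"
    using assms(3) by (simp add: U.cls_eq_iff)
  then have 0: "M.Psi \<bullet> lift double_rep (p - p') = 0"
    by (rule U_vanish[OF _ M.Psi_in_serre_null])
  have "M.good (1 * emb T.full_ideal (\<tau> - \<tau>')) (M.Psi \<bullet> lift double_rep (p - p'))"
    using R M.good_Psi unfolding related_def by blast
  then have "1 * emb T.full_ideal (\<tau> - \<tau>') = 0"
    unfolding 0 by (rule M.good_zero)
  then have "emb T.full_ideal (\<tau> - \<tau>') = 0"
    by simp
  then have "\<tau> - \<tau>' \<in> T.full_ideal"
    by (rule emb_eq_0D[OF T.two_sided_full_ideal])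
  then have "\<tau> - \<tau>' \<in> T.J"
    using R by (simp add: related_def T.full_ideal_carrier)
  then show ?thesis by (simp add: T.cls_eq_iff)
qed

definition phi :: "(Qv, dgen) free_alg set \<Rightarrow> (Qv, tgen) free_alg set" where
  "phi x = (SOME y. \<exists>p \<tau>. related p \<tau> \<and> x = U.cls p \<and> y = T.cls \<tau>)"

lemma phi_eq: "related p \<tau> \<Longrightarrow> phi (U.cls p) = T.cls \<tau>"
  unfolding phi_def by (rule some_equality) (use related_wd in blast)+

lemma related_B: "i \<in> I \<Longrightarrow> related (gen (dF i) + gen (dE i) * gen (dK' i)) (\<Sum>k\<in>occ w i. gen (tX k) + gen (tX' k))"
proof -
  assume i: "i \<in> I"
  have "emb T.full_ideal (\<Sum>k\<in>occ w i. gen (tX k) + gen (tX' k)) = Fq i + Gq i"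
    by (simp add: emb_def lift_sum lift_add Fq_def Gq_def xp_def xm_def sum.distrib)
  moreover have "lift double_rep (gen (dF i) + gen (dE i) * gen (dK' i)) = Lop i + M.E i * M.K' i"
    by (simp add: lift_add lift_mult)
  moreover have "(\<Sum>k\<in>occ w i. gen (tX k) + gen (tX' k)) \<in> carrier T.A"
    by (intro free_algebra_closed) (auto simp: tgens_def occ_def)
  moreover have "gen (dF i) + gen (dE i) * gen (dK' i) \<in> carrier U.A"
    using i by (intro free_algebra_closed) (auto simp: dgens_def)
  ultimately show ?thesis
    unfolding related_def using M.good_B by simp
qed

lemma related_k: "i \<in> I \<Longrightarrow> related (gen (dK i) * gen (dK' i))
   (scal (- inverse (vi d i) * (vi d i - inverse (vi d i))\<^sup>2) *
     ((\<Sum>k\<in>occ w i. gen (tX k)) * (\<Sum>k\<in>occ w i. gen (tX' k))))"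
proof -
  assume i: "i \<in> I"
  have "emb T.full_ideal (scal (- inverse (vi d i) * (vi d i - inverse (vi d i))\<^sup>2) *
     ((\<Sum>k\<in>occ w i. gen (tX k)) * (\<Sum>k\<in>occ w i. gen (tX' k)))) = kq i"
    unfolding emb_def lift_scal_mult
    by (simp add: lift_sum lift_mult kq_def Fq_def Gq_def xp_def xm_def)
  moreover have "lift double_rep (gen (dK i) * gen (dK' i)) = M.K i * M.K' i"
    by (simp add: lift_mult)
  moreover have "scal (- inverse (vi d i) * (vi d i - inverse (vi d i))\<^sup>2) *
     ((\<Sum>k\<in>occ w i. gen (tX k)) * (\<Sum>k\<in>occ w i. gen (tX' k))) \<in> carrier T.A"
    by (intro free_algebra_closed) (auto simp: tgens_def occ_def)
  moreover have "gen (dK i) * gen (dK' i) \<in> carrier U.A"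
    using i by (intro free_algebra_closed) (auto simp: dgens_def)
  ultimately show ?thesis
    unfolding related_def using M.good_kk_op by simp
qed

lemma iB_cls: "i \<in> I \<Longrightarrow> iB N C d i = U.cls (gen (dF i) + gen (dE i) * gen (dK' i))"
  and ik_cls: "i \<in> I \<Longrightarrow> ik N C d i = U.cls (gen (dK i) * gen (dK' i))"
proof -
  assume i: "i \<in> I"
  have c: "gen (dE i) \<in> carrier U.A" "gen (dF i) \<in> carrier U.A" "gen (dK i) \<in> carrier U.A" "gen (dK' i) \<in> carrier U.A"
    using i by (auto intro!: gen_in_free_algebra simp: dgens_def)
  show "iB N C d i = U.cls (gen (dF i) + gen (dE i) * gen (dK' i))"
    unfolding iB_def ugen_def Utilde_def by (simp add: U.cls_mult U.cls_add c free_algebra_mult_closed)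
  show "ik N C d i = U.cls (gen (dK i) * gen (dK' i))"
    unfolding ik_def ugen_def Utilde_def by (simp add: U.cls_mult c)
qed

text \<open>The classes of elements having a related partner form a subalgebra with all B_i and K_i
  K_i' in it, hence they exhaust the generated one.\<close>

lemma iUtilde_carrier:
  assumes "x \<in> carrier (iUtilde N C d)"
  obtains p \<tau> where "related p \<tau>" "x = U.cls p"
proof -
  let ?V = "{U.cls p | p \<tau>. related p \<tau>}"
  have car: "related p \<tau> \<Longrightarrow> p \<in> carrier U.A" for p \<tau> by (simp add: related_def)
  have "subring ?V U.P"
  proof (rule ring.subringI[OF U.ring_P])
    show "?V \<subseteq> carrier U.P"
      using car by (auto simp: U.carrier_P)
    show "\<one>\<^bsub>U.P\<^esub> \<in> ?V"
      using related_one by (auto simp: U.cls_one)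
    fix h assume "h \<in> ?V"
    then obtain p \<tau> where p: "related p \<tau>" "h = U.cls p" by blast
    have "\<ominus>\<^bsub>U.P\<^esub> h = U.cls (- p)"
      using p car[OF p(1)] U.ring_P
      by (intro abelian_group.minus_equality ring.is_abelian_group)
        (auto simp: U.cls_add U.cls_zero U.carrier_P free_algebra_uminus_closed)
    then show "\<ominus>\<^bsub>U.P\<^esub> h \<in> ?V" using related_uminus[OF p(1)] by blast
    fix h' assume "h' \<in> ?V"
    then obtain p' \<tau>' where p': "related p' \<tau>'" "h' = U.cls p'" by blast
    show "h \<otimes>\<^bsub>U.P\<^esub> h' \<in> ?V" "h \<oplus>\<^bsub>U.P\<^esub> h' \<in> ?V"
      using related_mult[OF p(1) p'(1)] related_add[OF p(1) p'(1)]
      by (auto simp: p p' U.cls_mult U.cls_add car[OF p(1)] car[OF p'(1)])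
  qed
  moreover have "\<forall>c. \<forall>x\<in>?V. c \<odot>\<^bsub>U.P\<^esub> x \<in> ?V"
    using related_smult by (auto simp: U.cls_smult) blast
  moreover have "iB N C d ` {1..N} \<union> ik N C d ` {1..N} \<subseteq> ?V"
    using related_B related_k iB_cls ik_cls by blast
  ultimately have "generated_subalgebra U.P (iB N C d ` {1..N} \<union> ik N C d ` {1..N}) \<subseteq> ?V"
    unfolding generated_subalgebra_def by (intro Inter_lower CollectI conjI)
  then have "carrier (iUtilde N C d) \<subseteq> ?V"
    by (simp add: iUtilde_def Utilde_def)
  then show ?thesis using assms that by blast
qed

section \<open>The homomorphism property and the values on generators\<close>

lemma iUtilde_simps:
  "x \<otimes>\<^bsub>iUtilde N C d\<^esub> y = x \<otimes>\<^bsub>U.P\<^esub> y" "x \<oplus>\<^bsub>iUtilde N C d\<^esub> y = x \<oplus>\<^bsub>U.P\<^esub> y"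
  "\<one>\<^bsub>iUtilde N C d\<^esub> = \<one>\<^bsub>U.P\<^esub>" "c \<odot>\<^bsub>iUtilde N C d\<^esub> x = c \<odot>\<^bsub>U.P\<^esub> x"
  by (simp_all add: iUtilde_def Utilde_def)

lemma phi_hom: "phi \<in> alg_hom (iUtilde N C d) (qtorus Q w)"
proof -
  have car: "related p \<tau> \<Longrightarrow> p \<in> carrier U.A" "related p \<tau> \<Longrightarrow> \<tau> \<in> carrier T.A" for p \<tau>
    by (simp_all add: related_def)
  have "phi \<in> ring_hom (iUtilde N C d) T.P"
  proof (rule ring_hom_memI)
    fix x assume "x \<in> carrier (iUtilde N C d)"
    then obtain p \<tau> where p: "related p \<tau>" "x = U.cls p" by (rule iUtilde_carrier)
    show "phi x \<in> carrier T.P"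
      using p car by (auto simp: phi_eq T.carrier_P)
    fix y assume "y \<in> carrier (iUtilde N C d)"
    then obtain p' \<tau>' where p': "related p' \<tau>'" "y = U.cls p'" by (rule iUtilde_carrier)
    show "phi (x \<otimes>\<^bsub>iUtilde N C d\<^esub> y) = phi x \<otimes>\<^bsub>T.P\<^esub> phi y"
      using p p' car phi_eq[OF related_mult[OF p(1) p'(1)]]
      by (simp add: iUtilde_simps U.cls_mult T.cls_mult phi_eq)
    show "phi (x \<oplus>\<^bsub>iUtilde N C d\<^esub> y) = phi x \<oplus>\<^bsub>T.P\<^esub> phi y"
      using p p' car phi_eq[OF related_add[OF p(1) p'(1)]]
      by (simp add: iUtilde_simps U.cls_add T.cls_add phi_eq)
  qed (simp add: iUtilde_simps U.cls_one T.cls_one phi_eq[OF related_one])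
  moreover have "phi (c \<odot>\<^bsub>iUtilde N C d\<^esub> x) = c \<odot>\<^bsub>T.P\<^esub> phi x" if x: "x \<in> carrier (iUtilde N C d)" for c x
  proof -
    obtain p \<tau> where p: "related p \<tau>" "x = U.cls p"
      using x by (rule iUtilde_carrier)
    then show ?thesis
      using phi_eq[OF related_smult[OF p(1)]] by (simp add: iUtilde_simps U.cls_smult T.cls_smult phi_eq)
  qed
  ultimately show ?thesis
    by (simp add: alg_hom_def qtorus_def)
qed

lemma tx_finsum:
  "(\<Oplus>\<^bsub>T.P\<^esub>k\<in>occ w i. tx Q w k \<oplus>\<^bsub>T.P\<^esub> tx' Q w k) = T.cls (\<Sum>k\<in>occ w i. gen (tX k) + gen (tX' k))"
  "(\<Oplus>\<^bsub>T.P\<^esub>k\<in>occ w i. tx Q w k) = T.cls (\<Sum>k\<in>occ w i. gen (tX k))"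
  "(\<Oplus>\<^bsub>T.P\<^esub>k\<in>occ w i. tx' Q w k) = T.cls (\<Sum>k\<in>occ w i. gen (tX' k))"
proof -
  have c: "gen (tX k) \<in> carrier T.A" "gen (tX' k) \<in> carrier T.A" if "k \<in> occ w i" for k
    using that by (auto intro!: gen_in_free_algebra simp: tgens_def occ_def)
  interpret P: ring T.P by (rule T.ring_P)
  have "(\<Oplus>\<^bsub>T.P\<^esub>k\<in>occ w i. tx Q w k \<oplus>\<^bsub>T.P\<^esub> tx' Q w k)
      = (\<Oplus>\<^bsub>T.P\<^esub>k\<in>occ w i. T.cls (gen (tX k) + gen (tX' k)))"
    by (rule P.finsum_cong')
      (auto simp: tx_def tx'_def T.cls_add c T.carrier_P free_algebra_add_closed)
  then show "(\<Oplus>\<^bsub>T.P\<^esub>k\<in>occ w i. tx Q w k \<oplus>\<^bsub>T.P\<^esub> tx' Q w k) = T.cls (\<Sum>k\<in>occ w i. gen (tX k) + gen (tX' k))"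
    by (simp add: T.cls_finsum finite_occ c free_algebra_add_closed)
  show "(\<Oplus>\<^bsub>T.P\<^esub>k\<in>occ w i. tx Q w k) = T.cls (\<Sum>k\<in>occ w i. gen (tX k))"
    "(\<Oplus>\<^bsub>T.P\<^esub>k\<in>occ w i. tx' Q w k) = T.cls (\<Sum>k\<in>occ w i. gen (tX' k))"
    unfolding tx_def tx'_def by (simp_all add: T.cls_finsum finite_occ c)
qed

lemma phi_generators:
  assumes i: "i \<in> I"
  shows "phi (iB N C d i) = (\<Oplus>\<^bsub>qtorus Q w\<^esub>k\<in>occ w i. tx Q w k \<oplus>\<^bsub>qtorus Q w\<^esub> tx' Q w k)"
    and "phi (ik N C d i) =
      (- inverse (vi d i) * (vi d i - inverse (vi d i))\<^sup>2) \<odot>\<^bsub>qtorus Q w\<^esub>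
        ((\<Oplus>\<^bsub>qtorus Q w\<^esub>k \<in> occ w i. tx Q w k) \<otimes>\<^bsub>qtorus Q w\<^esub>
         (\<Oplus>\<^bsub>qtorus Q w\<^esub>k \<in> occ w i. tx' Q w k))"
proof -
  have c: "(\<Sum>k\<in>occ w i. gen (tX k)) \<in> carrier T.A" "(\<Sum>k\<in>occ w i. gen (tX' k)) \<in> carrier T.A"
    by (auto intro!: free_algebra_closed simp: tgens_def occ_def)
  show "phi (iB N C d i) = (\<Oplus>\<^bsub>qtorus Q w\<^esub>k\<in>occ w i. tx Q w k \<oplus>\<^bsub>qtorus Q w\<^esub> tx' Q w k)"
    unfolding qtorus_def tx_finsum iB_cls[OF i] by (rule phi_eq[OF related_B[OF i]])
  show "phi (ik N C d i) =
      (- inverse (vi d i) * (vi d i - inverse (vi d i))\<^sup>2) \<odot>\<^bsub>qtorus Q w\<^esub>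
        ((\<Oplus>\<^bsub>qtorus Q w\<^esub>k \<in> occ w i. tx Q w k) \<otimes>\<^bsub>qtorus Q w\<^esub>
         (\<Oplus>\<^bsub>qtorus Q w\<^esub>k \<in> occ w i. tx' Q w k))"
    unfolding qtorus_def tx_finsum ik_cls[OF i] T.cls_mult[OF c] T.cls_smult
    by (rule phi_eq[OF related_k[OF i]])
qed

end

theorem theorem2p4:
  fixes N :: nat and C :: "nat \<Rightarrow> nat \<Rightarrow> int" and d :: "nat \<Rightarrow> nat"
    and Q :: "'e valued_quiver" and w :: "nat list"
  assumes "gen_cartan_matrix N C" and "symmetrizer N C d"
    and "associated_valued_quiver N C d Q"
    and "set w \<subseteq> {1..N}"
  shows "\<exists>\<phi> \<in> alg_hom (iUtilde N C d) (qtorus Q w). \<forall>i \<in> {1..N}.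
    \<phi> (iB N C d i) = (\<Oplus>\<^bsub>qtorus Q w\<^esub>k \<in> occ w i. tx Q w k \<oplus>\<^bsub>qtorus Q w\<^esub> tx' Q w k) \<and>
    \<phi> (ik N C d i) =
      (- inverse (vi d i) * (vi d i - inverse (vi d i))\<^sup>2) \<odot>\<^bsub>qtorus Q w\<^esub>
        ((\<Oplus>\<^bsub>qtorus Q w\<^esub>k \<in> occ w i. tx Q w k) \<otimes>\<^bsub>qtorus Q w\<^esub>
         (\<Oplus>\<^bsub>qtorus Q w\<^esub>k \<in> occ w i. tx' Q w k))"
proof -
  interpret quiver_torus N C d Q w
    by (rule quiver_torus.intro[OF assms])
  show ?thesis
    using phi_hom phi_generators by blast
qed

end
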